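(* Let $(M,g)$ be an almost-complex manifold of real even dimension $n\ge2$ with a Riemannian metric $g$, and $\nabla$ a symmetric connection on $T_M$. The complex structures $A\in C(M)$ with $d^\nabla A=0$ are variationally realized by the restricted functionals $$\mathcal C^\nabla[1]\Big|_{\widetilde\Omega^1(M,T_M)\cap\widetilde{\mathcal C}(M)}\quad\text{and}\quad\mathcal C^\nabla[1,3]\Big|_{\widetilde{\mathcal C}(M)},$$ that is, for each of these two restricted functionals, the projection to $\Omega^1(M,T_M)$ of its set of critical points equals $\{A\in C(M)\mid d^\nabla A=0\}$. Moreover, if $\nabla$ is the Levi-Civita connection of $g$, then $$\mathcal C^\nabla[1]\Big|_{\widetilde\Omega^1(M,T_M)\cap\widetilde{AC}(M)_g}\quad\text{and}\quad\mathcal C^\nabla[1,3]\Big|_{\widetilde{AC}(M)_g}$$ realize, in the same sense, the complex structures that are Kähler for $g$, i.e. for each of them the projection to $\Omega^1(M,T_M)$ of the set of critical points equals the set of $A\in C(M)\cap AC(M)_g$ for which $(M,A,g)$ is Kähler.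
   Context: $AC(M)=\{A\in\Omega^1(M,T_M)\mid A\circ A=-\mathrm{Id}\}$; $C(M)=\{A\in AC(M)\mid N_A=0\}$, $N_A(\zeta,\eta)=[A\zeta,A\eta]-A([A\zeta,\eta]+[\zeta,A\eta])-[\zeta,\eta]$; $AC(M)_g=\{A\in AC(M)\mid g(A\zeta,A\eta)=g(\zeta,\eta)\ \forall\zeta,\eta\}$. $(M,A,g)$ with $A\in C(M)\cap AC(M)_g$ is Kähler if $g(A\cdot,\cdot)$ is closed. A connection is symmetric if it is torsion-free. $d^\nabla$ is the covariant exterior derivative on $\Omega^\bullet(M,T_M)=\bigoplus_{k=0}^n\Omega^k(M,T_M)$; for $\gamma\in\Omega^\bullet(M,T_M)$, $\gamma_k$ denotes its degree-$k$ component. $\widetilde{\mathcal C}(M)=\{\gamma\mid\gamma_1\in C(M)\}$, $\widetilde{AC}(M)_g=\{\gamma\mid\gamma_1\in AC(M)_g\}$. $L^2$ product: for $\alpha=\sum a_i\otimes\frac{\partial}{\partial x_i}$, $\beta=\sum b_j\otimes\frac{\partial}{\partial x_j}$ locally, $\alpha\wedge_g\beta=\sum_{i,j}a_i\wedge b_j\,g(\frac{\partial}{\partial x_i},\frac{\partial}{\partial x_j})$, $\langle\alpha,\beta\rangle_g=\sum_{i,j}\langle a_i,b_j\rangle g(\frac{\partial}{\partial x_i},\frac{\partial}{\partial x_j})$ in equal degree, $\star_g$ is defined by $\alpha\wedge_g\star_g\beta=\langle\alpha,\beta\rangle_g\mathrm{vol}_g$, and $\langle\langle\gamma,\gamma'\rangle\rangle=\sum_k\int_M\gamma_k\wedge_g\star_g\gamma'_k$.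 $\delta^\nabla$ is the formal adjoint of $d^\nabla$ for $\langle\langle\cdot,\cdot\rangle\rangle$. The variational calculus is formal: the integrals are taken to be defined and the formal adjoint relation $\langle\langle d^\nabla\alpha,\beta\rangle\rangle=\langle\langle\alpha,\delta^\nabla\beta\rangle\rangle$ is taken to hold. $d^\nabla[1]$ is the operator equal to $d^\nabla$ on $\Omega^i(M,T_M)$ for $i\ne0$ and to $0$ on $\Omega^0(M,T_M)$; $d^\nabla[1,3]$ equals $d^\nabla$ on $\Omega^i(M,T_M)$ for $i\ne0,2$ and $0$ for $i=0,2$. $\widetilde\Omega^1(M,T_M)=\{\gamma\in\Omega^\bullet(M,T_M)\mid\delta^\nabla\gamma_3=0\}$. The functionals are $\mathcal C^\nabla[1]:\widetilde\Omega^1(M,T_M)\to\mathbb R$, $\gamma\mapsto\langle\langle d^\nabla[1]\gamma,\gamma\rangle\rangle$ and $\mathcal C^\nabla[1,3]:\Omega^\bullet(M,T_M)\to\mathbb R$, $\gamma\mapsto\langle\langle d^\nabla[1,3]\gamma,\gamma\rangle\rangle$. A critical point of a functional restricted to a subset is a point of the subset at which the first variation vanishes along every smooth curve in the subset through that point. *)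

theory Defs
  imports "HOL-Analysis.Analysis" "HOL-Library.Function_Algebras"
begin

section \<open>Smooth manifolds\<close>

primrec Ck_on :: "nat \<Rightarrow> 'a::real_normed_vector set \<Rightarrow> ('a \<Rightarrow> 'b::real_normed_vector) \<Rightarrow> bool" where
  "Ck_on 0 S f \<longleftrightarrow> continuous_on S f"
| "Ck_on (Suc k) S f \<longleftrightarrow> (\<forall>x\<in>S. f differentiable (at x)) \<and>
     (\<forall>v. Ck_on k S (\<lambda>x. frechet_derivative f (at x) v))"

text \<open>Only used for open subsets of finite-dimensional spaces, where the existence and continuity
  of all iterated directional derivatives is the usual notion of smoothness.\<close>

definition smooth_on :: "'a::real_normed_vector set \<Rightarrow> ('a \<Rightarrow> 'b::real_normed_vector) \<Rightarrow> bool" where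
  "smooth_on S f \<longleftrightarrow> (\<forall>k. Ck_on k S f)"

text \<open>The manifold is the whole type \<open>'m\<close>; a chart is a pair of its domain and its coordinate
  map, and the atlas need not be maximal.\<close>

type_synonym ('m, 'n) chart = "'m set \<times> ('m \<Rightarrow> real ^ 'n)"

definition chart_inv :: "('m, 'n) chart \<Rightarrow> real ^ 'n \<Rightarrow> 'm" where
  "chart_inv c = inv_into (fst c) (snd c)"

definition smooth_atlas ::
  "('m::{t2_space,second_countable_topology}, 'n::finite) chart set \<Rightarrow> bool" where
  "smooth_atlas \<A> \<longleftrightarrow>
     (\<Union>c\<in>\<A>. fst c) = UNIV \<and>
     (\<forall>c\<in>\<A>. open (fst c) \<and> open (snd c ` fst c) \<and>
        homeomorphism (fst c) (snd c ` fst c) (snd c) (chart_inv c)) \<and>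
     (\<forall>c\<in>\<A>. \<forall>c'\<in>\<A>. smooth_on (snd c ` (fst c \<inter> fst c')) (snd c' \<circ> chart_inv c))"

definition smooth_functions :: "('m, 'n::finite) chart set \<Rightarrow> ('m \<Rightarrow> real) set" where
  "smooth_functions \<A> = {f. \<forall>c\<in>\<A>. smooth_on (snd c ` fst c) (f \<circ> chart_inv c)}"

section \<open>Vector fields\<close>

text \<open>A tangent vector is identified with the directional derivative it defines on smooth functions,
  a vector field with the operator \<open>f \<mapsto> X f\<close> (extended by zero to non-smooth functions).\<close>

type_synonym 'm vfield = "('m \<Rightarrow> real) \<Rightarrow> 'm \<Rightarrow> real"

definition has_coords ::
  "('m, 'n::finite) chart set \<Rightarrow> ('m, 'n) chart \<Rightarrow> 'm \<Rightarrow> 'm vfield \<Rightarrow> real ^ 'n \<Rightarrow> bool" where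
  "has_coords \<A> c p X w \<longleftrightarrow>
     (\<forall>f\<in>smooth_functions \<A>. X f p = frechet_derivative (f \<circ> chart_inv c) (at (snd c p)) w)"

definition vector_fields :: "('m, 'n::finite) chart set \<Rightarrow> 'm vfield set" where
  "vector_fields \<A> = {X.
     (\<forall>f\<in>smooth_functions \<A>. X f \<in> smooth_functions \<A>) \<and>
     (\<forall>f. f \<notin> smooth_functions \<A> \<longrightarrow> X f = 0) \<and>
     (\<forall>c\<in>\<A>. \<forall>p\<in>fst c. \<exists>w. has_coords \<A> c p X w)}"

definition fscale :: "('m \<Rightarrow> real) \<Rightarrow> 'm vfield \<Rightarrow> 'm vfield" where
  "fscale h X = (\<lambda>f p. h p * X f p)"

definition lie_bracket :: "'m vfield \<Rightarrow> 'm vfield \<Rightarrow> 'm vfield" where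
  "lie_bracket X Y = (\<lambda>f. X (Y f) - Y (X f))"

definition coords ::
  "('m, 'n::finite) chart set \<Rightarrow> ('m, 'n) chart \<Rightarrow> 'm \<Rightarrow> 'm vfield \<Rightarrow> real ^ 'n" where
  "coords \<A> c p X = (THE w. has_coords \<A> c p X w)"

text \<open>A global vector field whose value at \<open>p\<close> is the coordinate vector \<open>\<partial>/\<partial>x\<^sub>i\<close>; it is only inserted
  in tensors evaluated at \<open>p\<close>, so the choice of the extension is irrelevant.\<close>

definition coord_field ::
  "('m, 'n::finite) chart set \<Rightarrow> ('m, 'n) chart \<Rightarrow> 'm \<Rightarrow> 'n \<Rightarrow> 'm vfield" where
  "coord_field \<A> c p i = (SOME X. X \<in> vector_fields \<A> \<and> has_coords \<A> c p X (axis i 1))"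

section \<open>Forms with values in the tangent bundle\<close>

text \<open>Tensor fields are \<open>C\<^sup>\<infinity>(M)\<close>-multilinear maps on vector fields. The arguments of a form are
  collected in a list; a form of degree \<open>k\<close> is zero on all other lists than those
  consisting of \<open>k\<close> vector fields.\<close>

type_synonym 'm vform = "'m vfield list \<Rightarrow> 'm vfield"

definition Omega :: "('m, 'n::finite) chart set \<Rightarrow> nat \<Rightarrow> 'm vform set" where
  "Omega \<A> k = {\<alpha>.
     (\<forall>Xs. length Xs = k \<and> set Xs \<subseteq> vector_fields \<A> \<longrightarrow> \<alpha> Xs \<in> vector_fields \<A>) \<and>
     (\<forall>Xs. \<not> (length Xs = k \<and> set Xs \<subseteq> vector_fields \<A>) \<longrightarrow> \<alpha> Xs = 0) \<and>
     (\<forall>Xs i X Y. \<forall>f\<in>smooth_functions \<A>. \<forall>h\<in>smooth_functions \<A>.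
        length Xs = k \<and> set Xs \<subseteq> vector_fields \<A> \<and> i < k \<and>
        X \<in> vector_fields \<A> \<and> Y \<in> vector_fields \<A> \<longrightarrow>
        \<alpha> (Xs[i := fscale f X + fscale h Y]) = fscale f (\<alpha> (Xs[i := X])) + fscale h (\<alpha> (Xs[i := Y]))) \<and>
     (\<forall>Xs i j. length Xs = k \<and> set Xs \<subseteq> vector_fields \<A> \<and> i < j \<and> j < k \<and> Xs ! i = Xs ! j \<longrightarrow>
        \<alpha> Xs = 0)}"

type_synonym 'm gform = "nat \<Rightarrow> 'm vform"

definition Omega_total :: "('m, 'n::finite) chart set \<Rightarrow> 'm gform set" where
  "Omega_total \<A> =
     {\<gamma>. (\<forall>k\<le>CARD('n). \<gamma> k \<in> Omega \<A> k) \<and> (\<forall>k>CARD('n). \<gamma> k = 0)}"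

definition del_nth :: "nat \<Rightarrow> 'a list \<Rightarrow> 'a list" where
  "del_nth i xs = take i xs @ drop (Suc i) xs"

definition alt_sign :: "nat \<Rightarrow> 'b::ab_group_add \<Rightarrow> 'b" where
  "alt_sign i y = (if even i then y else - y)"

text \<open>Exterior derivative with respect to a derivative \<open>D\<close> of the values: with \<open>D = \<nabla>\<close> it is the
  covariant one on tangent-valued forms, with \<open>D X f = X f\<close> the de Rham differential.\<close>

definition ext_deriv ::
  "('m, 'n::finite) chart set \<Rightarrow> ('m vfield \<Rightarrow> 'b \<Rightarrow> 'b) \<Rightarrow>
   ('m vfield list \<Rightarrow> 'b) \<Rightarrow> 'm vfield list \<Rightarrow> 'b::ab_group_add" where
  "ext_deriv \<A> D \<alpha> Xs =
     (if set Xs \<subseteq> vector_fields \<A> then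
        (\<Sum>i<length Xs. alt_sign i (D (Xs ! i) (\<alpha> (del_nth i Xs)))) +
        (\<Sum>j<length Xs. \<Sum>i<j.
           alt_sign (i + j) (\<alpha> (lie_bracket (Xs ! i) (Xs ! j) # del_nth i (del_nth j Xs))))
      else 0)"

section \<open>Metrics and connections\<close>

definition riemannian_metric ::
  "('m, 'n::finite) chart set \<Rightarrow> ('m vfield \<Rightarrow> 'm vfield \<Rightarrow> 'm \<Rightarrow> real) \<Rightarrow> bool" where
  "riemannian_metric \<A> g \<longleftrightarrow>
     (\<forall>X\<in>vector_fields \<A>. \<forall>Y\<in>vector_fields \<A>. g X Y \<in> smooth_functions \<A> \<and> g X Y = g Y X) \<and>
     (\<forall>f\<in>smooth_functions \<A>. \<forall>h\<in>smooth_functions \<A>.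
        \<forall>X\<in>vector_fields \<A>. \<forall>Y\<in>vector_fields \<A>. \<forall>Z\<in>vector_fields \<A>.
        g (fscale f X + fscale h Y) Z = (\<lambda>p. f p * g X Z p + h p * g Y Z p)) \<and>
     (\<forall>X\<in>vector_fields \<A>. \<forall>p. 0 \<le> g X X p \<and> (g X X p = 0 \<longrightarrow> (\<forall>f. X f p = 0)))"

definition connection ::
  "('m, 'n::finite) chart set \<Rightarrow> ('m vfield \<Rightarrow> 'm vfield \<Rightarrow> 'm vfield) \<Rightarrow> bool" where
  "connection \<A> nabla \<longleftrightarrow>
     (\<forall>X\<in>vector_fields \<A>. \<forall>Y\<in>vector_fields \<A>. nabla X Y \<in> vector_fields \<A>) \<and>
     (\<forall>f\<in>smooth_functions \<A>. \<forall>h\<in>smooth_functions \<A>.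
        \<forall>X\<in>vector_fields \<A>. \<forall>Y\<in>vector_fields \<A>. \<forall>Z\<in>vector_fields \<A>.
        nabla (fscale f X + fscale h Y) Z = fscale f (nabla X Z) + fscale h (nabla Y Z)) \<and>
     (\<forall>X\<in>vector_fields \<A>. \<forall>Y\<in>vector_fields \<A>. \<forall>Z\<in>vector_fields \<A>.
        nabla X (Y + Z) = nabla X Y + nabla X Z) \<and>
     (\<forall>f\<in>smooth_functions \<A>. \<forall>X\<in>vector_fields \<A>. \<forall>Y\<in>vector_fields \<A>.
        nabla X (fscale f Y) = fscale (X f) Y + fscale f (nabla X Y))"

definition symmetric_connection ::
  "('m, 'n::finite) chart set \<Rightarrow> ('m vfield \<Rightarrow> 'm vfield \<Rightarrow> 'm vfield) \<Rightarrow> bool" where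
  "symmetric_connection \<A> nabla \<longleftrightarrow> connection \<A> nabla \<and>
     (\<forall>X\<in>vector_fields \<A>. \<forall>Y\<in>vector_fields \<A>. nabla X Y - nabla Y X = lie_bracket X Y)"

definition levi_civita ::
  "('m, 'n::finite) chart set \<Rightarrow> ('m vfield \<Rightarrow> 'm vfield \<Rightarrow> 'm \<Rightarrow> real) \<Rightarrow>
   ('m vfield \<Rightarrow> 'm vfield \<Rightarrow> 'm vfield) \<Rightarrow> bool" where
  "levi_civita \<A> g nabla \<longleftrightarrow> symmetric_connection \<A> nabla \<and>
     (\<forall>X\<in>vector_fields \<A>. \<forall>Y\<in>vector_fields \<A>. \<forall>Z\<in>vector_fields \<A>.
        X (g Y Z) = g (nabla X Y) Z + g Y (nabla X Z))"

section \<open>Almost complex, complex and Kaehler structures\<close>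

definition AC :: "('m, 'n::finite) chart set \<Rightarrow> 'm vform set" where
  "AC \<A> = {A \<in> Omega \<A> 1. \<forall>X\<in>vector_fields \<A>. A [A [X]] = - X}"

definition nijenhuis :: "'m vform \<Rightarrow> 'm vfield \<Rightarrow> 'm vfield \<Rightarrow> 'm vfield" where
  "nijenhuis A X Y = lie_bracket (A [X]) (A [Y])
     - A [lie_bracket (A [X]) Y + lie_bracket X (A [Y])] - lie_bracket X Y"

definition complex_structures :: "('m, 'n::finite) chart set \<Rightarrow> 'm vform set" where
  "complex_structures \<A> =
     {A \<in> AC \<A>. \<forall>X\<in>vector_fields \<A>. \<forall>Y\<in>vector_fields \<A>. nijenhuis A X Y = 0}"

definition AC_metric ::
  "('m, 'n::finite) chart set \<Rightarrow> ('m vfield \<Rightarrow> 'm vfield \<Rightarrow> 'm \<Rightarrow> real) \<Rightarrow> 'm vform set" where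
  "AC_metric \<A> g =
     {A \<in> AC \<A>. \<forall>X\<in>vector_fields \<A>. \<forall>Y\<in>vector_fields \<A>. g (A [X]) (A [Y]) = g X Y}"

definition fundamental_form ::
  "('m vfield \<Rightarrow> 'm vfield \<Rightarrow> 'm \<Rightarrow> real) \<Rightarrow> 'm vform \<Rightarrow> 'm vfield list \<Rightarrow> 'm \<Rightarrow> real" where
  "fundamental_form g A Xs = (if length Xs = 2 then g (A [Xs ! 0]) (Xs ! 1) else 0)"

definition kaehler_structures ::
  "('m, 'n::finite) chart set \<Rightarrow> ('m vfield \<Rightarrow> 'm vfield \<Rightarrow> 'm \<Rightarrow> real) \<Rightarrow> 'm vform set" where
  "kaehler_structures \<A> g =
     {A \<in> complex_structures \<A> \<inter> AC_metric \<A> g. ext_deriv \<A> (\<lambda>X f. X f) (fundamental_form g A) = 0}"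

definition complex_total :: "('m, 'n::finite) chart set \<Rightarrow> 'm gform set" where
  "complex_total \<A> = {\<gamma> \<in> Omega_total \<A>. \<gamma> 1 \<in> complex_structures \<A>}"

definition AC_metric_total ::
  "('m, 'n::finite) chart set \<Rightarrow> ('m vfield \<Rightarrow> 'm vfield \<Rightarrow> 'm \<Rightarrow> real) \<Rightarrow> 'm gform set" where
  "AC_metric_total \<A> g = {\<gamma> \<in> Omega_total \<A>. \<gamma> 1 \<in> AC_metric \<A> g}"

section \<open>The \<open>L\<^sup>2\<close> product\<close>

definition metric_coeffs ::
  "('m, 'n::finite) chart set \<Rightarrow> ('m vfield \<Rightarrow> 'm vfield \<Rightarrow> 'm \<Rightarrow> real) \<Rightarrow>
   ('m, 'n) chart \<Rightarrow> 'm \<Rightarrow> real ^ 'n ^ 'n" where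
  "metric_coeffs \<A> g c p = (\<chi> i j. g (coord_field \<A> c p i) (coord_field \<A> c p j) p)"

text \<open>\<open>\<mu>\<close> is the measure \<open>vol\<^sub>g\<close>, with density \<open>\<surd>(det g\<^sub>i\<^sub>j)\<close> in every chart.\<close>

definition riemannian_volume ::
  "('m::topological_space, 'n::finite) chart set \<Rightarrow> ('m vfield \<Rightarrow> 'm vfield \<Rightarrow> 'm \<Rightarrow> real) \<Rightarrow>
   'm measure \<Rightarrow> bool" where
  "riemannian_volume \<A> g \<mu> \<longleftrightarrow> sets \<mu> = sets borel \<and>
     (\<forall>c\<in>\<A>. \<forall>B\<in>sets borel. B \<subseteq> fst c \<longrightarrow>
        emeasure \<mu> B =
          (\<integral>\<^sup>+x\<in>snd c ` B. ennreal (sqrt (det (metric_coeffs \<A> g c (chart_inv c x)))) \<partial>lborel))"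

text \<open>The values at \<open>p\<close> of these vector fields form an orthonormal basis of the tangent space.\<close>

definition orthonormal_frame ::
  "('m, 'n::finite) chart set \<Rightarrow> ('m vfield \<Rightarrow> 'm vfield \<Rightarrow> 'm \<Rightarrow> real) \<Rightarrow> 'm \<Rightarrow> 'm vfield list" where
  "orthonormal_frame \<A> g p = (SOME E. length E = CARD('n) \<and> set E \<subseteq> vector_fields \<A> \<and>
     (\<forall>i<CARD('n). \<forall>j<CARD('n). g (E ! i) (E ! j) p = (if i = j then 1 else 0)))"

text \<open>The inner product of real-valued \<open>k\<close>-forms at \<open>p\<close>: the sum over \<open>i\<^sub>1 < \<dots> < i\<^sub>k\<close> of the products
  of the components in an orthonormal basis.\<close>

definition form_inner ::
  "('m, 'n::finite) chart set \<Rightarrow> ('m vfield \<Rightarrow> 'm vfield \<Rightarrow> 'm \<Rightarrow> real) \<Rightarrow> nat \<Rightarrow> 'm \<Rightarrow>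
   ('m vfield list \<Rightarrow> real) \<Rightarrow> ('m vfield list \<Rightarrow> real) \<Rightarrow> real" where
  "form_inner \<A> g k p a b =
     (\<Sum>K | K \<subseteq> {..<CARD('n)} \<and> card K = k.
        a (nths (orthonormal_frame \<A> g p) K) * b (nths (orthonormal_frame \<A> g p) K))"

text \<open>With \<open>\<alpha> = \<Sum> a\<^sub>i \<otimes> \<partial>/\<partial>x\<^sub>i\<close> and \<open>\<beta> = \<Sum> b\<^sub>j \<otimes> \<partial>/\<partial>x\<^sub>j\<close> in a chart around \<open>p\<close>, this is
  \<open>\<Sum> \<langle>a\<^sub>i, b\<^sub>j\<rangle> g(\<partial>/\<partial>x\<^sub>i, \<partial>/\<partial>x\<^sub>j)\<close> at \<open>p\<close>.\<close>

definition vform_inner ::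
  "('m, 'n::finite) chart set \<Rightarrow> ('m vfield \<Rightarrow> 'm vfield \<Rightarrow> 'm \<Rightarrow> real) \<Rightarrow> nat \<Rightarrow>
   'm vform \<Rightarrow> 'm vform \<Rightarrow> 'm \<Rightarrow> real" where
  "vform_inner \<A> g k \<alpha> \<beta> p =
     (let c = (SOME c. c \<in> \<A> \<and> p \<in> fst c) in
      \<Sum>i\<in>UNIV. \<Sum>j\<in>UNIV.
        form_inner \<A> g k p (\<lambda>Xs. coords \<A> c p (\<alpha> Xs) $ i) (\<lambda>Xs. coords \<A> c p (\<beta> Xs) $ j) *
        metric_coeffs \<A> g c p $ i $ j)"

text \<open>The Hodge operator is characterised by \<open>\<alpha> \<and>\<^sub>g \<star>\<^sub>g \<beta> = \<langle>\<alpha>, \<beta>\<rangle>\<^sub>g vol\<^sub>g\<close>, so the integral of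
  \<open>\<gamma>\<^sub>k \<and>\<^sub>g \<star>\<^sub>g \<gamma>'\<^sub>k\<close> is that of \<open>\<langle>\<gamma>\<^sub>k, \<gamma>'\<^sub>k\<rangle>\<^sub>g\<close> against \<open>vol\<^sub>g\<close>.\<close>

definition L2_degree ::
  "('m, 'n::finite) chart set \<Rightarrow> ('m vfield \<Rightarrow> 'm vfield \<Rightarrow> 'm \<Rightarrow> real) \<Rightarrow> 'm measure \<Rightarrow> nat \<Rightarrow>
   'm vform \<Rightarrow> 'm vform \<Rightarrow> real" where
  "L2_degree \<A> g \<mu> k \<alpha> \<beta> = (LINT p|\<mu>. vform_inner \<A> g k \<alpha> \<beta> p)"

definition L2_product ::
  "('m, 'n::finite) chart set \<Rightarrow> ('m vfield \<Rightarrow> 'm vfield \<Rightarrow> 'm \<Rightarrow> real) \<Rightarrow> 'm measure \<Rightarrow>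
   'm gform \<Rightarrow> 'm gform \<Rightarrow> real" where
  "L2_product \<A> g \<mu> \<gamma> \<gamma>' = (\<Sum>k\<le>CARD('n). L2_degree \<A> g \<mu> k (\<gamma> k) (\<gamma>' k))"

definition integrals_defined ::
  "('m, 'n::finite) chart set \<Rightarrow> ('m vfield \<Rightarrow> 'm vfield \<Rightarrow> 'm \<Rightarrow> real) \<Rightarrow> 'm measure \<Rightarrow> bool" where
  "integrals_defined \<A> g \<mu> \<longleftrightarrow>
     (\<forall>k. \<forall>\<alpha>\<in>Omega \<A> k. \<forall>\<beta>\<in>Omega \<A> k. integrable \<mu> (vform_inner \<A> g k \<alpha> \<beta>))"

definition formal_adjoint ::
  "('m, 'n::finite) chart set \<Rightarrow> ('m vfield \<Rightarrow> 'm vfield \<Rightarrow> 'm \<Rightarrow> real) \<Rightarrow> 'm measure \<Rightarrow>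
   ('m vfield \<Rightarrow> 'm vfield \<Rightarrow> 'm vfield) \<Rightarrow> ('m vform \<Rightarrow> 'm vform) \<Rightarrow> bool" where
  "formal_adjoint \<A> g \<mu> nabla \<delta> \<longleftrightarrow>
     (\<forall>k. \<forall>\<beta>\<in>Omega \<A> (Suc k). \<delta> \<beta> \<in> Omega \<A> k \<and>
        (\<forall>\<alpha>\<in>Omega \<A> k.
           L2_degree \<A> g \<mu> (Suc k) (ext_deriv \<A> nabla \<alpha>) \<beta> = L2_degree \<A> g \<mu> k \<alpha> (\<delta> \<beta>)))"

section \<open>The functionals and their critical points\<close>

text \<open>The operator on graded forms that is \<open>d\<^sup>\<nabla>\<close> in the degrees outside \<open>S\<close> and \<open>0\<close> in the degrees
  in \<open>S\<close>.\<close>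

definition trunc_deriv ::
  "('m, 'n::finite) chart set \<Rightarrow> ('m vfield \<Rightarrow> 'm vfield \<Rightarrow> 'm vfield) \<Rightarrow> nat set \<Rightarrow>
   'm gform \<Rightarrow> 'm gform" where
  "trunc_deriv \<A> nabla S \<gamma> k =
     (case k of 0 \<Rightarrow> 0 | Suc i \<Rightarrow> if i \<in> S then 0 else ext_deriv \<A> nabla (\<gamma> i))"

definition C_1 ::
  "('m, 'n::finite) chart set \<Rightarrow> ('m vfield \<Rightarrow> 'm vfield \<Rightarrow> 'm \<Rightarrow> real) \<Rightarrow> 'm measure \<Rightarrow>
   ('m vfield \<Rightarrow> 'm vfield \<Rightarrow> 'm vfield) \<Rightarrow> 'm gform \<Rightarrow> real" where
  "C_1 \<A> g \<mu> nabla \<gamma> = L2_product \<A> g \<mu> (trunc_deriv \<A> nabla {0} \<gamma>) \<gamma>"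

definition C_1_3 ::
  "('m, 'n::finite) chart set \<Rightarrow> ('m vfield \<Rightarrow> 'm vfield \<Rightarrow> 'm \<Rightarrow> real) \<Rightarrow> 'm measure \<Rightarrow>
   ('m vfield \<Rightarrow> 'm vfield \<Rightarrow> 'm vfield) \<Rightarrow> 'm gform \<Rightarrow> real" where
  "C_1_3 \<A> g \<mu> nabla \<gamma> = L2_product \<A> g \<mu> (trunc_deriv \<A> nabla {0, 2} \<gamma>) \<gamma>"

definition coclosed_3 ::
  "('m, 'n::finite) chart set \<Rightarrow> ('m vform \<Rightarrow> 'm vform) \<Rightarrow> 'm gform set" where
  "coclosed_3 \<A> \<delta> = {\<gamma> \<in> Omega_total \<A>. \<delta> (\<gamma> 3) = 0}"

text \<open>Smoothness of \<open>(t, p) \<mapsto> \<gamma>\<^sub>t(p)\<close>, tested on vector fields and functions.\<close>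

definition smooth_curve ::
  "('m, 'n::finite) chart set \<Rightarrow> real \<Rightarrow> (real \<Rightarrow> 'm gform) \<Rightarrow> bool" where
  "smooth_curve \<A> \<epsilon> \<gamma> \<longleftrightarrow>
     (\<forall>k Xs. \<forall>f\<in>smooth_functions \<A>. \<forall>c\<in>\<A>.
        length Xs = k \<and> set Xs \<subseteq> vector_fields \<A> \<longrightarrow>
        smooth_on ({-\<epsilon><..<\<epsilon>} \<times> snd c ` fst c) (\<lambda>(t, x). \<gamma> t k Xs f (chart_inv c x)))"

definition critical_points ::
  "('m, 'n::finite) chart set \<Rightarrow> ('m gform \<Rightarrow> real) \<Rightarrow> 'm gform set \<Rightarrow> 'm gform set" where
  "critical_points \<A> F S =
     {\<gamma> \<in> S. \<forall>\<epsilon>>0. \<forall>c. smooth_curve \<A> \<epsilon> c \<and> c 0 = \<gamma> \<and> (\<forall>t\<in>{-\<epsilon><..<\<epsilon>}. c t \<in> S) \<longrightarrow>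
        ((\<lambda>t. F (c t)) has_real_derivative 0) (at 0)}"

end

theory Submission
  imports Defs
begin

text \<open>The degree-two component enters both functionals only through
  \<open>\<langle>\<langle>d\<^sup>\<nabla> \<gamma>\<^sub>1, \<gamma>\<^sub>2\<rangle>\<rangle>\<close>: the other term \<open>\<langle>\<langle>d\<^sup>\<nabla> \<gamma>\<^sub>2, \<gamma>\<^sub>3\<rangle>\<rangle> = \<langle>\<langle>\<gamma>\<^sub>2, \<delta> \<gamma>\<^sub>3\<rangle>\<rangle>\<close> is removed
  by the truncation or by \<open>\<delta> \<gamma>\<^sub>3 = 0\<close>. Varying \<open>\<gamma>\<^sub>2\<close> in the direction \<open>d\<^sup>\<nabla> \<gamma>\<^sub>1\<close> gives
  \<open>d\<^sup>\<nabla> \<gamma>\<^sub>1 = 0\<close> at a critical point. Conversely, if \<open>d\<^sup>\<nabla> A = 0\<close>, both factors of every term of the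
  functional vanish at the graded form concentrated in degree one with value \<open>A\<close>, so the functional is
  \<open>o(t)\<close> along every smooth curve through it. This needs estimates uniform on the manifold; they are
  available because integrability of all forms forces an almost complex manifold to be compact.
  For the Levi-Civita connection, \<open>T(X, Y, Z) = g((\<nabla>\<^sub>X A) Y, Z)\<close> is skew in its last two
  arguments, and each of the conditions \<open>d\<^sup>\<nabla> A = 0\<close> and Kaehler is equivalent to \<open>T = 0\<close>.\<close>

section \<open>Calculus of smooth functions and bump functions\<close>

text \<open>Two features of the setting shape the proof. Vector fields and tensors are operators on
  global objects, without values at a point, so every local argument passes through cut-off
  functions: fields and functions that look like coordinates on a small open set are extended to the
  whole manifold, and linearity over smooth functions makes the choice of extension irrelevant.
  Moreover a curve of forms is smooth only when evaluated on fixed arguments, while the integrand of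
  the functional uses orthonormal frames chosen independently at each point. So nothing is
  differentiated under the integral sign. Near each point the inner product is bounded through
  finitely many evaluations on a smooth frame; of the two factors that vanish at time 0, the first
  tends to 0 by continuity and the second is O(t) by a bound on its time derivative, whence o(t).
  Truncation in degree 0 is what makes this possible: it removes the pairing of
  \<open>d\<^sup>\<nabla> \<gamma>\<^sub>0\<close> with \<open>\<gamma>\<^sub>1\<close>, whose
  second factor is not zero at the form in question.\<close>

abbreviation "fderiv f x \<equiv> frechet_derivative f (at x)"

lemma Ck_on_subset: "Ck_on k T f \<Longrightarrow> S \<subseteq> T \<Longrightarrow> Ck_on k S f"
proof (induction k arbitrary: f)
  case 0 then show ?case by (auto intro: continuous_on_subset)
next
  case (Suc k) then show ?case by (auto simp: subset_iff)
qed

lemma frechet_derivative_eq_on_open: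
  assumes "open S" "x \<in> S" "\<And>y. y \<in> S \<Longrightarrow> f y = g y"
  shows "fderiv f x = fderiv g x"
proof -
  have "(f has_derivative D) (at x) \<longleftrightarrow> (g has_derivative D) (at x)" for D
    using assms has_derivative_transform_within_open[of f D x UNIV S g]
      has_derivative_transform_within_open[of g D x UNIV S f] by auto
  then show ?thesis unfolding frechet_derivative_def by simp
qed

lemma Ck_on_cong_imp:
  assumes "open S" "\<And>y. y \<in> S \<Longrightarrow> f y = g y" "Ck_on k S f"
  shows "Ck_on k S g"
  using assms(2,3)
proof (induction k arbitrary: f g)
  case 0 then show ?case by (metis Ck_on.simps(1) continuous_on_cong)
next
  case (Suc k)
  have "g differentiable (at x)" if "x \<in> S" for x
    using Suc.prems that assms(1) unfolding differentiable_def
    by (metis Ck_on.simps(2) differentiable_def has_derivative_transform_within_open)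
  moreover have "Ck_on k S (\<lambda>x. fderiv g x v)" for v
    by (rule Suc.IH[of "\<lambda>x. fderiv f x v"])
       (use Suc.prems frechet_derivative_eq_on_open[OF assms(1)] in \<open>auto, metis\<close>)
  ultimately show ?case by simp
qed

lemma Ck_on_Suc_D: "Ck_on (Suc k) S f \<Longrightarrow> Ck_on k S f"
proof (induction k arbitrary: f)
  case 0 then show ?case
    by (auto intro!: continuous_at_imp_continuous_on differentiable_imp_continuous_within)
next
  case (Suc k)
  then have "Ck_on k S (\<lambda>x. fderiv f x v)" for v
    by (metis Ck_on.simps(2))
  with Suc.prems show ?case by (metis Ck_on.simps(2))
qed

lemma Ck_on_const: "Ck_on k S (\<lambda>x. a)"
proof (induction k arbitrary: a)
  case (Suc k) then show ?case by (simp add: frechet_derivative_const)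
qed simp

lemma Ck_on_bounded_linear:
  assumes "bounded_linear L" shows "Ck_on k S L"
proof (cases k)
  case 0 then show ?thesis
    using assms by (simp add: linear_continuous_on)
next
  case (Suc m)
  have "(L has_derivative L) (at x)" for x
    using assms by (rule bounded_linear_imp_has_derivative)
  then have "fderiv L x = L" "L differentiable (at x)" for x
    by (auto intro: frechet_derivative_at[symmetric] simp: differentiable_def)
  then show ?thesis by (simp add: Suc Ck_on_const)
qed

lemma Ck_on_add:
  assumes "open S" "Ck_on k S f" "Ck_on k S g"
  shows "Ck_on k S (\<lambda>x. f x + g x)"
  using assms(2,3)
proof (induction k arbitrary: f g)
  case 0 then show ?case by (auto intro: continuous_intros)
next
  case (Suc k)
  have fd: "fderiv (\<lambda>x. f x + g x) x =
      (\<lambda>h. fderiv f x h + fderiv g x h)" if "x \<in> S" for x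
    using Suc.prems that
    by (intro frechet_derivative_at[symmetric] has_derivative_add) (auto simp: frechet_derivative_works[symmetric])
  have "Ck_on k S (\<lambda>x. fderiv f x v + fderiv g x v)" for v
    using Suc by auto
  then have "Ck_on k S (\<lambda>x. fderiv (\<lambda>x. f x + g x) x v)" for v
    by (rule Ck_on_cong_imp[OF assms(1), rotated]) (use Suc.prems in \<open>simp add: fd\<close>)
  with Suc.prems show ?case by (auto intro: differentiable_add)
qed

text \<open>By the Leibniz rule a directional derivative of the product is a sum of two products of
  the same bilinear map with one factor differentiated, so induction over arbitrary \<open>f\<close>
  and \<open>g\<close> closes. One proof serves scalar multiplication, multiplication of reals and
  the inner product.\<close>

lemma (in bounded_bilinear) Ck_on:
  assumes "open S" "Ck_on k S f" "Ck_on k S g"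
  shows "Ck_on k S (\<lambda>x. prod (f x) (g x))"
  using assms(2,3)
proof (induction k arbitrary: f g)
  case 0 then show ?case by (auto intro: continuous_on)
next
  case (Suc k)
  have D: "((\<lambda>x. prod (f x) (g x)) has_derivative
      (\<lambda>h. prod (f x) (fderiv g x h) + prod (fderiv f x h) (g x))) (at x)"
    if "x \<in> S" for x
    using Suc.prems that by (intro FDERIV) (auto simp: frechet_derivative_works[symmetric])
  have "Ck_on k S (\<lambda>x. prod (f x) (fderiv g x v) + prod (fderiv f x v) (g x))" for v
    using Suc.prems Ck_on_Suc_D[OF Suc.prems(1)] Ck_on_Suc_D[OF Suc.prems(2)]
    by (intro Ck_on_add[OF assms(1)] Suc.IH) auto
  then have "Ck_on k S (\<lambda>x. fderiv (\<lambda>x. prod (f x) (g x)) x v)" for v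
    by (rule Ck_on_cong_imp[OF assms(1), rotated]) (simp add: frechet_derivative_at[OF D, symmetric])
  with D show ?case by (auto simp: differentiable_def)
qed

lemma Ck_on_sum:
  assumes "open S" "\<And>i. i \<in> I \<Longrightarrow> Ck_on k S (f i)"
  shows "Ck_on k S (\<lambda>x. \<Sum>i\<in>I. f i x)"
  using assms(2)
proof (induction I rule: infinite_finite_induct)
  case (insert i I) then show ?case by (simp add: Ck_on_add[OF assms(1)])
qed (auto simp: Ck_on_const)

text \<open>The chain rule differentiates \<open>g\<close> in the direction
  \<open>fderiv f x v\<close>, which moves with \<open>x\<close>, whereas \<open>Ck_on\<close>
  speaks of fixed directions only. Expanding that direction in the basis of the Euclidean
  intermediate space leaves finitely many fixed directions with coefficients that are again
  regular.\<close>

lemma Ck_on_compose: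
  fixes f :: "'a::real_normed_vector \<Rightarrow> 'b::euclidean_space" and g :: "'b \<Rightarrow> 'c::real_normed_vector"
  assumes "open S" "open T" "f ` S \<subseteq> T" "Ck_on k T g" "Ck_on k S f"
  shows "Ck_on k S (\<lambda>x. g (f x))"
  using assms(4,5)
proof (induction k arbitrary: g)
  case 0 then show ?case using assms(3) by (auto intro: continuous_on_compose2)
next
  case (Suc k)
  have D: "((\<lambda>x. g (f x)) has_derivative
      (\<lambda>h. fderiv g (f x) (fderiv f x h))) (at x)"
    if "x \<in> S" for x
    using Suc.prems that assms(3)
    by (intro has_derivative_compose[of f _ x UNIV g]) (auto simp: frechet_derivative_works[symmetric])
  have lin: "linear (fderiv g (f x))" if "x \<in> S" for x
    using Suc.prems that assms(3) by (intro linear_frechet_derivative) auto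
  have "Ck_on k S (\<lambda>x. \<Sum>b\<in>Basis. (fderiv f x v \<bullet> b) *\<^sub>R fderiv g (f x) b)" for v
  proof (intro Ck_on_sum[OF assms(1)] bounded_bilinear.Ck_on[OF bounded_bilinear_scaleR assms(1)])
    show "Ck_on k S (\<lambda>x. fderiv f x v \<bullet> b)" for b
      using Suc.prems
      by (intro bounded_bilinear.Ck_on[OF bounded_bilinear_inner assms(1)] Ck_on_const) auto
    show "Ck_on k S (\<lambda>x. fderiv g (f x) b)" for b
      using Suc.prems Ck_on_Suc_D[OF Suc.prems(2)] by (intro Suc.IH) auto
  qed
  then have "Ck_on k S (\<lambda>x. fderiv (\<lambda>x. g (f x)) x v)" for v
  proof (rule Ck_on_cong_imp[OF assms(1), rotated])
    fix x assume x: "x \<in> S"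
    let ?w = "fderiv f x v"
    have "fderiv (\<lambda>x. g (f x)) x v = fderiv g (f x) ?w"
      by (simp add: frechet_derivative_at[OF D[OF x], symmetric])
    also have "\<dots> = fderiv g (f x) (\<Sum>b\<in>Basis. (?w \<bullet> b) *\<^sub>R b)"
      by (simp add: euclidean_representation)
    also have "\<dots> = (\<Sum>b\<in>Basis. (?w \<bullet> b) *\<^sub>R fderiv g (f x) b)"
      by (simp add: linear_sum[OF lin[OF x]] linear_cmul[OF lin[OF x]])
    finally show "(\<Sum>b\<in>Basis. (?w \<bullet> b) *\<^sub>R fderiv g (f x) b) =
      fderiv (\<lambda>x. g (f x)) x v" by simp
  qed
  with D show ?case by (auto simp: differentiable_def)
qed

lemma Ck_on_local:
  assumes "\<And>x. x \<in> S \<Longrightarrow> \<exists>T. open T \<and> x \<in> T \<and> Ck_on k T f"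
  shows "Ck_on k S f"
  using assms
proof (induction k arbitrary: f)
  case 0
  have "isCont f x" if x: "x \<in> S" for x
  proof -
    obtain T where "open T" "x \<in> T" "continuous_on T f" using 0[OF x] by auto
    then show ?thesis by (simp add: continuous_on_eq_continuous_at)
  qed
  then show ?case by (simp add: continuous_at_imp_continuous_on)
next
  case (Suc k)
  have "f differentiable (at x)" if "x \<in> S" for x
    using Suc.prems[OF that] by auto
  moreover have "Ck_on k S (\<lambda>x. fderiv f x v)" for v
  proof (rule Suc.IH)
    fix x assume "x \<in> S"
    then obtain T where "open T" "x \<in> T" "Ck_on (Suc k) T f" using Suc.prems by blast
    then show "\<exists>T. open T \<and> x \<in> T \<and> Ck_on k T (\<lambda>x. fderiv f x v)" by auto
  qed
  ultimately show ?case by simp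
qed

lemma smooth_on_subset: "smooth_on T f \<Longrightarrow> S \<subseteq> T \<Longrightarrow> smooth_on S f"
  unfolding smooth_on_def by (blast intro: Ck_on_subset)

lemma smooth_on_cong_imp:
  "smooth_on S f \<Longrightarrow> open S \<Longrightarrow> (\<And>y. y \<in> S \<Longrightarrow> f y = g y) \<Longrightarrow> smooth_on S g"
  unfolding smooth_on_def by (intro allI Ck_on_cong_imp[of S f g]) auto

lemma smooth_on_const: "smooth_on S (\<lambda>x. a)"
  by (simp add: smooth_on_def Ck_on_const)

lemma smooth_on_bounded_linear: "bounded_linear L \<Longrightarrow> smooth_on S L"
  by (simp add: smooth_on_def Ck_on_bounded_linear)

lemma smooth_on_add: "open S \<Longrightarrow> smooth_on S f \<Longrightarrow> smooth_on S g \<Longrightarrow> smooth_on S (\<lambda>x. f x + g x)"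
  unfolding smooth_on_def by (intro allI Ck_on_add) auto

lemma smooth_on_scaleR:
  "open S \<Longrightarrow> smooth_on S f \<Longrightarrow> smooth_on S g \<Longrightarrow> smooth_on S (\<lambda>x. f x *\<^sub>R g x)"
  unfolding smooth_on_def by (intro allI bounded_bilinear.Ck_on[OF bounded_bilinear_scaleR]) auto

lemma smooth_on_mult:
  fixes f g :: "_ \<Rightarrow> real"
  shows "open S \<Longrightarrow> smooth_on S f \<Longrightarrow> smooth_on S g \<Longrightarrow> smooth_on S (\<lambda>x. f x * g x)"
  using smooth_on_scaleR[of S f g] by simp

lemma smooth_on_inner:
  "open S \<Longrightarrow> smooth_on S f \<Longrightarrow> smooth_on S g \<Longrightarrow> smooth_on S (\<lambda>x. f x \<bullet> g x)"
  unfolding smooth_on_def by (intro allI bounded_bilinear.Ck_on[OF bounded_bilinear_inner]) auto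

lemma smooth_on_compose:
  fixes f :: "'a::real_normed_vector \<Rightarrow> 'b::euclidean_space" and g :: "'b \<Rightarrow> 'c::real_normed_vector"
  shows "smooth_on T g \<Longrightarrow> smooth_on S f \<Longrightarrow> open S \<Longrightarrow> open T \<Longrightarrow> f ` S \<subseteq> T \<Longrightarrow>
    smooth_on S (\<lambda>x. g (f x))"
  unfolding smooth_on_def by (intro allI Ck_on_compose[of S T f _ g]) auto

lemma smooth_on_local:
  assumes "\<And>x. x \<in> S \<Longrightarrow> \<exists>T. open T \<and> x \<in> T \<and> smooth_on T f"
  shows "smooth_on S f"
  unfolding smooth_on_def
proof
  fix k show "Ck_on k S f"
    by (rule Ck_on_local) (metis assms smooth_on_def)
qed

lemma smooth_on_imp_continuous_on: "smooth_on S f \<Longrightarrow> continuous_on S f"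
  unfolding smooth_on_def by (drule spec[of _ 0]) simp

lemma smooth_on_imp_differentiable: "smooth_on S f \<Longrightarrow> x \<in> S \<Longrightarrow> f differentiable (at x)"
  unfolding smooth_on_def by (drule spec[of _ 1]) simp

lemma smooth_on_frechet_derivative:
  "smooth_on S f \<Longrightarrow> smooth_on S (\<lambda>x. fderiv f x v)"
  unfolding smooth_on_def 
proof
  fix k assume "\<forall>k. Ck_on k S f"
  then have "Ck_on (Suc k) S f" by blast
  then show "Ck_on k S (\<lambda>x. fderiv f x v)" by simp
qed

lemma smooth_on_has_derivative:
  "smooth_on S f \<Longrightarrow> x \<in> S \<Longrightarrow> (f has_derivative fderiv f x) (at x)"
  using smooth_on_imp_differentiable[of S f x] by (simp add: frechet_derivative_works)

section \<open>Smooth functions of one real variable and bump functions\<close>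

lemma frechet_derivative_real:
  assumes "(f has_real_derivative d) (at x)"
  shows "fderiv f x v = d * v"
  using frechet_derivative_at[of f "(*) d" x] assms by (simp add: has_field_derivative_def)

lemma Ck_on_real_deriv:
  assumes "open S" "\<And>x. x \<in> S \<Longrightarrow> (f has_real_derivative d x) (at x)" "Ck_on k S d"
  shows "Ck_on (Suc k) S f"
proof -
  have "Ck_on k S (\<lambda>x. d x *\<^sub>R v)" for v
    by (intro bounded_bilinear.Ck_on[OF bounded_bilinear_scaleR] assms Ck_on_const)
  then have "Ck_on k S (\<lambda>x. fderiv f x v)" for v
  proof (rule Ck_on_cong_imp[OF assms(1), rotated])
    show "d x *\<^sub>R v = fderiv f x v" if "x \<in> S" for x
      by (simp add: frechet_derivative_real[OF assms(2)[OF that]])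
  qed
  then show ?thesis
    using assms(2) by (auto simp: differentiable_def has_field_derivative_def)
qed

text \<open>The derivative is minus the square of the function itself, so regularity of order
  \<open>k\<close> implies regularity of order \<open>Suc k\<close>.\<close>

lemma smooth_on_inverse: "smooth_on {0<..} (inverse :: real \<Rightarrow> real)"
proof -
  have "Ck_on k {0<..} (inverse :: real \<Rightarrow> real)" for k
  proof (induction k)
    case 0 show ?case by (auto intro!: continuous_intros)
  next
    case (Suc k)
    show ?case
    proof (rule Ck_on_real_deriv)
      show "(inverse has_real_derivative (-1) *\<^sub>R (inverse x *\<^sub>R inverse x)) (at x)" if "x \<in> {0<..}" for x :: real
        using that by (auto intro!: derivative_eq_intros)
      show "Ck_on k {0<..} (\<lambda>x::real. (-1) *\<^sub>R (inverse x *\<^sub>R inverse x))"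
        by (intro bounded_bilinear.Ck_on[OF bounded_bilinear_scaleR] Suc Ck_on_const) auto
    qed auto
  qed
  then show ?thesis by (simp add: smooth_on_def)
qed

text \<open>The factor \<open>inverse x ^ m\<close> is carried along because differentiating
  \<open>exp (- inverse x)\<close> produces such powers: over all \<open>m\<close> the family is
  closed under differentiation up to real linear combinations, so one induction makes all its
  members smooth.\<close>

definition flat :: "nat \<Rightarrow> real \<Rightarrow> real" where
  "flat m x = (if x > 0 then exp (- inverse x) * inverse x ^ m else 0)"

text \<open>This is the difference quotient of \<open>flat m\<close> at 0. From the right, the
  substitution \<open>y = inverse h\<close> turns it into \<open>y ^ Suc m / exp y\<close>; from the
  left it is zero.\<close>

lemma flat_div_tendsto: "((\<lambda>h. flat m h / h) \<longlongrightarrow> 0) (at 0)"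
proof -
  have "((\<lambda>y::real. y ^ Suc m / exp y) \<longlongrightarrow> 0) at_top"
    by (rule tendsto_power_div_exp_0)
  then have "((\<lambda>h::real. inverse h ^ Suc m / exp (inverse h)) \<longlongrightarrow> 0) (at_right 0)"
    by (rule filterlim_compose) (rule filterlim_inverse_at_top_right)
  then have "((\<lambda>h. flat m h / h) \<longlongrightarrow> 0) (at_right 0)"
    by (rule Lim_transform_eventually)
       (auto simp: flat_def exp_minus field_simps eventually_at intro!: exI[of _ 1])
  moreover have "((\<lambda>h. flat m h / h) \<longlongrightarrow> 0) (at_left 0)"
    by (rule Lim_transform_eventually[of "\<lambda>_. 0"])
       (auto simp: flat_def eventually_at intro!: exI[of _ 1])
  ultimately show ?thesis by (simp add: filterlim_at_split)
qed

lemma flat_deriv: "(flat m has_real_derivative (flat (m + 2) x + (- real m) * flat (m + 1) x)) (at x)"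
proof (cases x "0::real" rule: linorder_cases)
  case less
  have "((\<lambda>_. 0) has_real_derivative 0) (at x)" by simp
  then have "(flat m has_real_derivative 0) (at x)"
    by (rule has_field_derivative_transform_within_open[of _ _ _ "{..<0}"]) (use less in \<open>auto simp: flat_def\<close>)
  then show ?thesis using less by (simp add: flat_def)
next
  case equal
  have "(flat m has_real_derivative 0) (at 0)"
    using flat_div_tendsto[of m] by (simp add: DERIV_def) (simp add: flat_def)
  then show ?thesis by (simp add: equal flat_def)
next
  case greater
  have "((\<lambda>x. exp (- inverse x) * inverse x ^ m) has_real_derivative
      (flat (m + 2) x + (- real m) * flat (m + 1) x)) (at x)"
    using greater
    apply (auto intro!: derivative_eq_intros simp: flat_def)
    apply (cases m; simp add: field_simps)
    done
  then show ?thesis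
    by (rule has_field_derivative_transform_within_open[of _ _ _ "{0<..}"]) (use greater in \<open>auto simp: flat_def\<close>)
qed

lemma smooth_on_flat: "smooth_on UNIV (flat m)"
proof -
  have "Ck_on k UNIV (flat m)" for k m
  proof (induction k arbitrary: m)
    case 0
    show ?case
      using flat_deriv[of m] by (auto intro!: DERIV_continuous_on intro: has_field_derivative_at_within)
  next
    case (Suc k)
    show ?case
    proof (rule Ck_on_real_deriv)
      have "Ck_on k UNIV (\<lambda>x. flat (m + 2) x + (- real m) *\<^sub>R flat (m + 1) x)"
        by (intro Ck_on_add bounded_bilinear.Ck_on[OF bounded_bilinear_scaleR] Suc Ck_on_const) auto
      then show "Ck_on k UNIV (\<lambda>x. flat (m + 2) x + (- real m) * flat (m + 1) x)" by simp
    qed (auto intro: flat_deriv[simplified])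
  qed
  then show ?thesis by (simp add: smooth_on_def)
qed

lemma smooth_bump_exists:
  fixes x0 :: "'a::euclidean_space"
  assumes "r > 0"
  obtains b :: "'a \<Rightarrow> real" where "smooth_on UNIV b" "\<And>x. 0 \<le> b x"
    "\<And>x. x \<in> ball x0 (r/2) \<Longrightarrow> b x = 1" "\<And>x. x \<notin> cball x0 r \<Longrightarrow> b x = 0"
proof -
  \<comment> \<open>\<open>s\<close> is positive exactly inside the ball of radius \<open>r\<close>;
    \<open>l\<close> is the squared distance minus \<open>(r/2)\<^sup>2\<close>, hence positive
    exactly outside the closed ball of radius \<open>r/2\<close>. Their sum is the positive constant
    \<open>(3/4) * r\<^sup>2\<close>, so at least one of them is positive and the denominator of
    \<open>b\<close> does not vanish.\<close>
  define s where "s x = r\<^sup>2 + (-1) * ((x - x0) \<bullet> (x - x0))" for x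
  define l where "l x = (3/4) * r\<^sup>2 + (-1) * s x" for x
  define b where "b x = flat 0 (s x) * inverse (flat 0 (s x) + flat 0 (l x))" for x
  have lin: "smooth_on UNIV (\<lambda>x. x - x0)"
    using smooth_on_add[of UNIV "\<lambda>x. x" "\<lambda>_. - x0"]
    by (simp add: smooth_on_bounded_linear smooth_on_const bounded_linear_ident)
  have s: "smooth_on UNIV s"
    unfolding s_def by (intro smooth_on_add smooth_on_mult smooth_on_inner smooth_on_const lin) auto
  have l: "smooth_on UNIV l"
    unfolding l_def by (intro smooth_on_add smooth_on_mult smooth_on_const s) auto
  have fs: "smooth_on UNIV (\<lambda>x. flat 0 (s x))" and fl: "smooth_on UNIV (\<lambda>x. flat 0 (l x))"
    by (rule smooth_on_compose[OF smooth_on_flat]; use s l in simp)+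
  have pos: "flat 0 (s x) + flat 0 (l x) > 0" for x
  proof (cases "s x > 0")
    case True then show ?thesis by (auto simp: flat_def add_pos_nonneg)
  next
    case False
    moreover have "0 < (3/4) * r\<^sup>2" using assms by simp
    ultimately have "l x > 0" unfolding l_def by linarith
    then show ?thesis by (auto simp: flat_def add_nonneg_pos)
  qed
  have "smooth_on UNIV (\<lambda>x. inverse (flat 0 (s x) + flat 0 (l x)))"
    by (rule smooth_on_compose[OF smooth_on_inverse]) (use pos in \<open>auto intro!: smooth_on_add fs fl\<close>)
  then have "smooth_on UNIV b"
    unfolding b_def by (intro smooth_on_mult fs) auto
  moreover have "0 \<le> b x" for x
    using pos[of x] by (simp add: b_def flat_def)
  moreover have "b x = 1" if "x \<in> ball x0 (r/2)" for x
  proof -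
    have "(x - x0) \<bullet> (x - x0) < (r/2)\<^sup>2"
      using that by (simp add: dist_norm norm_minus_commute dot_square_norm power_strict_mono)
    then have "l x \<le> 0" by (simp add: l_def s_def power2_eq_square)
    then show ?thesis using pos[of x] by (simp add: b_def flat_def split: if_splits)
  qed
  moreover have "b x = 0" if "x \<notin> cball x0 r" for x
  proof -
    have "r\<^sup>2 \<le> (x - x0) \<bullet> (x - x0)"
      using that assms by (simp add: dist_norm norm_minus_commute dot_square_norm power_mono)
    then show ?thesis by (simp add: b_def s_def flat_def)
  qed
  ultimately show thesis by (rule that)
qed

section \<open>Functions, vector fields and tensoriality\<close>

lemma frechet_derivative_linear_simps:
  assumes "f differentiable (at x)"
  shows "fderiv f x (v + w) = fderiv f x v + fderiv f x w"
    and "fderiv f x (a *\<^sub>R v) = a *\<^sub>R fderiv f x v"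
    and "fderiv f x 0 = 0"
  using linear_frechet_derivative[OF assms] by (auto simp: linear_add linear_cmul linear_0)

lemma sum_fun_apply: "(\<Sum>i\<in>I. f i) x = (\<Sum>i\<in>I. f i x)"
  by (induction I rule: infinite_finite_induct) auto

locale manifold =
  fixes \<A> :: "('m::{t2_space,second_countable_topology}, 'n::finite) chart set"
  assumes atlas: "smooth_atlas \<A>"
begin

abbreviation "SF \<equiv> smooth_functions \<A>"
abbreviation "VF \<equiv> vector_fields \<A>"

lemma ex_chart: "\<exists>c\<in>\<A>. p \<in> fst c"
  using atlas unfolding smooth_atlas_def by blast

lemma chart:
  assumes "c \<in> \<A>"
  shows open_dom: "open (fst c)" and open_img: "open (snd c ` fst c)"
    and chart_homeo: "homeomorphism (fst c) (snd c ` fst c) (snd c) (chart_inv c)"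
    and transition: "c' \<in> \<A> \<Longrightarrow> smooth_on (snd c ` (fst c \<inter> fst c')) (snd c' \<circ> chart_inv c)"
  using atlas assms unfolding smooth_atlas_def by blast+

lemma chart_inv_chart [simp]: "c \<in> \<A> \<Longrightarrow> p \<in> fst c \<Longrightarrow> chart_inv c (snd c p) = p"
  using chart_homeo by (auto simp: homeomorphism_def)

lemma chart_chart_inv [simp]: "c \<in> \<A> \<Longrightarrow> x \<in> snd c ` fst c \<Longrightarrow> snd c (chart_inv c x) = x"
  by auto

lemma chart_inv_in [simp]: "c \<in> \<A> \<Longrightarrow> x \<in> snd c ` fst c \<Longrightarrow> chart_inv c x \<in> fst c"
  by auto

lemma continuous_chart: "c \<in> \<A> \<Longrightarrow> continuous_on (fst c) (snd c)"
  using chart_homeo by (auto simp: homeomorphism_def)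

lemma continuous_chart_inv: "c \<in> \<A> \<Longrightarrow> continuous_on (snd c ` fst c) (chart_inv c)"
  using chart_homeo by (auto simp: homeomorphism_def)

lemma open_chart_image:
  assumes "c \<in> \<A>" "open U" "U \<subseteq> fst c" shows "open (snd c ` U)"
proof -
  have "open ((snd c ` fst c) \<inter> chart_inv c -` U)"
    using continuous_open_preimage[OF continuous_chart_inv open_img] assms by blast
  also have "(snd c ` fst c) \<inter> chart_inv c -` U = snd c ` U"
    using assms by force
  finally show ?thesis .
qed

lemma open_chart_preimage:
  assumes "c \<in> \<A>" "open V" shows "open (fst c \<inter> snd c -` V)"
  using continuous_open_preimage[OF continuous_chart open_dom] assms by blast

lemma SF_chart: "f \<in> SF \<Longrightarrow> c \<in> \<A> \<Longrightarrow> smooth_on (snd c ` fst c) (f \<circ> chart_inv c)"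
  by (auto simp: smooth_functions_def)

text \<open>Smooth transition maps carry smoothness from a single chart near each point to all
  charts of the atlas, which makes membership in \<open>SF\<close> a local condition.\<close>

lemma SF_local_chart:
  assumes "\<And>p. \<exists>c\<in>\<A>. \<exists>U. open U \<and> p \<in> U \<and> U \<subseteq> fst c \<and> smooth_on (snd c ` U) (f \<circ> chart_inv c)"
  shows "f \<in> SF"
  unfolding smooth_functions_def
proof (intro CollectI ballI)
  fix c' assume c': "c' \<in> \<A>"
  show "smooth_on (snd c' ` fst c') (f \<circ> chart_inv c')"
  proof (rule smooth_on_local)
    fix x assume x: "x \<in> snd c' ` fst c'"
    define p where "p = chart_inv c' x"
    have p: "p \<in> fst c'" "snd c' p = x"
      using x chart_inv_in[OF c'] chart_chart_inv[OF c'] by (simp_all add: p_def)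
    obtain c U where c: "c \<in> \<A>" and U: "open U" "p \<in> U" "U \<subseteq> fst c"
      and s: "smooth_on (snd c ` U) (f \<circ> chart_inv c)"
      using assms by blast
    define T where "T = snd c' ` (U \<inter> fst c')"
    have "open T" unfolding T_def using c' U open_dom[OF c'] by (intro open_chart_image) auto
    moreover have "x \<in> T" using p U by (auto simp: T_def)
    moreover have "smooth_on T (f \<circ> chart_inv c')"
    proof (rule smooth_on_cong_imp)
      show "smooth_on T (\<lambda>x. (f \<circ> chart_inv c) ((snd c \<circ> chart_inv c') x))"
      proof (rule smooth_on_compose[OF s])
        show "smooth_on T (snd c \<circ> chart_inv c')"
          by (rule smooth_on_subset[OF transition[OF c' c]]) (use U in \<open>auto simp: T_def\<close>)
        show "open (snd c ` U)" using open_chart_image c U by blast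
        show "(snd c \<circ> chart_inv c') ` T \<subseteq> snd c ` U" using c' by (auto simp: T_def)
      qed fact
      show "(f \<circ> chart_inv c) ((snd c \<circ> chart_inv c') y) = (f \<circ> chart_inv c') y" if "y \<in> T" for y
        using that c' c U by (auto simp: T_def subset_iff)
    qed fact
    ultimately show "\<exists>T. open T \<and> x \<in> T \<and> smooth_on T (f \<circ> chart_inv c')" by blast
  qed
qed

lemma SF_local:
  assumes "\<And>p. \<exists>U f'. open U \<and> p \<in> U \<and> f' \<in> SF \<and> (\<forall>q\<in>U. f q = f' q)"
  shows "f \<in> SF"
proof (rule SF_local_chart)
  fix p
  obtain U f' where U: "open U" "p \<in> U" "f' \<in> SF" "\<forall>q\<in>U. f q = f' q" using assms by blast
  obtain c where c: "c \<in> \<A>" "p \<in> fst c" using ex_chart by blast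
  let ?U = "U \<inter> fst c"
  have o: "open ?U" using U open_dom[OF c(1)] by blast
  have "smooth_on (snd c ` ?U) (f' \<circ> chart_inv c)"
    by (rule smooth_on_subset[OF SF_chart[OF U(3) c(1)]]) auto
  then have "smooth_on (snd c ` ?U) (f \<circ> chart_inv c)"
    by (rule smooth_on_cong_imp) (use c U o open_chart_image in auto)
  then show "\<exists>c\<in>\<A>. \<exists>U. open U \<and> p \<in> U \<and> U \<subseteq> fst c \<and> smooth_on (snd c ` U) (f \<circ> chart_inv c)"
    using c U o by (intro bexI[of _ c] exI[of _ ?U]) auto
qed

text \<open>The part of the manifold corresponding to \<open>K\<close> is compact, hence closed in a
  Hausdorff space. A point outside the chart domain therefore has a neighbourhood on which the
  extension by zero is identically zero.\<close>

lemma SF_extend: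
  assumes c: "c \<in> \<A>" and u: "smooth_on (snd c ` fst c) u" and K: "compact K" "K \<subseteq> snd c ` fst c"
    and 0: "\<And>x. x \<in> snd c ` fst c \<Longrightarrow> x \<notin> K \<Longrightarrow> u x = 0"
  shows "(\<lambda>p. if p \<in> fst c then u (snd c p) else 0) \<in> SF" (is "?f \<in> SF")
proof (rule SF_local_chart)
  fix p
  show "\<exists>c\<in>\<A>. \<exists>U. open U \<and> p \<in> U \<and> U \<subseteq> fst c \<and> smooth_on (snd c ` U) (?f \<circ> chart_inv c)"
  proof (cases "p \<in> fst c")
    case True
    have "smooth_on (snd c ` fst c) (?f \<circ> chart_inv c)"
      by (rule smooth_on_cong_imp[OF u open_img[OF c]]) (use c in auto)
    with True c open_dom show ?thesis by blast
  next
    case False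
    obtain c' where c': "c' \<in> \<A>" "p \<in> fst c'" using ex_chart by blast
    let ?K = "chart_inv c ` K" and ?U = "fst c' \<inter> - (chart_inv c ` K)"
    have "compact ?K"
      using K continuous_chart_inv[OF c] by (metis compact_continuous_image continuous_on_subset)
    then have o: "open ?U" using open_dom[OF c'(1)] compact_imp_closed by blast
    have "p \<notin> ?K" using False K c chart_inv_in by blast
    have z: "?f q = 0" if "q \<in> ?U" for q
      using that 0[of "snd c q"] c by (force simp: image_iff)
    have "smooth_on (snd c' ` ?U) (\<lambda>_. 0)" by (rule smooth_on_const)
    then have "smooth_on (snd c' ` ?U) (?f \<circ> chart_inv c')"
    proof (rule smooth_on_cong_imp)
      show "open (snd c' ` ?U)" using o c' open_chart_image by blast
      fix y assume "y \<in> snd c' ` ?U"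
      then have "chart_inv c' y \<in> ?U" using c' by auto
      from z[OF this] show "0 = (?f \<circ> chart_inv c') y" by simp
    qed
    then show ?thesis using c' o \<open>p \<notin> ?K\<close> by blast
  qed
qed

lemma SF_const: "(\<lambda>p. a) \<in> SF"
  by (auto simp: smooth_functions_def comp_def smooth_on_const)

lemma SF_add: "f \<in> SF \<Longrightarrow> g \<in> SF \<Longrightarrow> (\<lambda>p. f p + g p) \<in> SF"
  by (simp add: smooth_functions_def comp_def smooth_on_add open_img)

lemma SF_mult: "f \<in> SF \<Longrightarrow> g \<in> SF \<Longrightarrow> (\<lambda>p. f p * g p) \<in> SF"
  by (simp add: smooth_functions_def comp_def smooth_on_mult open_img)

lemma SF_sum: "(\<And>i. i \<in> I \<Longrightarrow> f i \<in> SF) \<Longrightarrow> (\<lambda>p. \<Sum>i\<in>I. f i p) \<in> SF"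
  by (induction I rule: infinite_finite_induct)
     (simp_all add: SF_const SF_add)

lemma SF_zero: "0 \<in> SF"
  using SF_const[of 0] by (simp add: zero_fun_def)

lemma SF_continuous:
  assumes "f \<in> SF" shows "continuous_on UNIV f"
proof -
  have "isCont f p" for p
  proof -
    obtain c where c: "c \<in> \<A>" "p \<in> fst c" using ex_chart by blast
    have "continuous_on (fst c) (\<lambda>q. (f \<circ> chart_inv c) (snd c q))"
      by (rule continuous_on_compose2[OF smooth_on_imp_continuous_on[OF SF_chart[OF assms c(1)]]])
         (use c continuous_chart in auto)
    then have "continuous_on (fst c) f"
      by (rule continuous_on_eq) (use c in auto)
    then show ?thesis using c open_dom by (auto simp: continuous_on_eq_continuous_at)
  qed
  then show ?thesis by (simp add: continuous_at_imp_continuous_on)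
qed

lemma SF_differentiable:
  "f \<in> SF \<Longrightarrow> c \<in> \<A> \<Longrightarrow> p \<in> fst c \<Longrightarrow> (f \<circ> chart_inv c) differentiable (at (snd c p))"
  using smooth_on_imp_differentiable[OF SF_chart] by blast

text \<open>Fields and forms are global operators, so an identity is localised by multiplying it
  with such a \<phi>. That \<phi> is 1 on a whole neighbourhood \<open>V\<close>, and not just at
  \<open>p\<close>, makes its derivatives at \<open>p\<close> vanish. Nonnegativity serves the sum
  of bumps in \<open>compact_manifold\<close>.\<close>

lemma bump_function:
  assumes "open U" "p \<in> U"
  obtains \<phi> V where "\<phi> \<in> SF" "open V" "p \<in> V" "V \<subseteq> U" "\<And>q. q \<in> V \<Longrightarrow> \<phi> q = 1"
    "\<And>q. q \<notin> U \<Longrightarrow> \<phi> q = 0" "\<And>q. 0 \<le> \<phi> q"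
proof -
  obtain c where c: "c \<in> \<A>" "p \<in> fst c" using ex_chart by blast
  have "open (snd c ` (U \<inter> fst c))"
    using assms c open_dom open_chart_image by blast
  then obtain r where r: "r > 0" "cball (snd c p) r \<subseteq> snd c ` (U \<inter> fst c)"
    unfolding open_contains_cball using assms c by blast
  obtain b :: "real^'n \<Rightarrow> real" where b: "smooth_on UNIV b" "\<And>x. 0 \<le> b x"
    "\<And>x. x \<in> ball (snd c p) (r/2) \<Longrightarrow> b x = 1" "\<And>x. x \<notin> cball (snd c p) r \<Longrightarrow> b x = 0"
    using smooth_bump_exists[OF r(1), of "snd c p"] by blast
  define \<phi> where "\<phi> = (\<lambda>p. if p \<in> fst c then b (snd c p) else 0)"
  define V where "V = U \<inter> (fst c \<inter> snd c -` ball (snd c p) (r/2))"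
  show thesis
  proof
    show "\<phi> \<in> SF" unfolding \<phi>_def
      by (rule SF_extend[OF c(1) _ compact_cball[of "snd c p" r]])
         (use r b smooth_on_subset[OF b(1)] in auto)
    show "open V" unfolding V_def using open_chart_preimage[OF c(1)] assms by blast
    show "\<phi> q = 0" if "q \<notin> U" for q
    proof -
      have "snd c q \<notin> cball (snd c p) r" if "q \<in> fst c"
      proof
        assume "snd c q \<in> cball (snd c p) r"
        then obtain q' where "q' \<in> U" "q' \<in> fst c" "snd c q = snd c q'" using r by blast
        then have "q = q'" using chart_inv_chart[OF c(1)] that by metis
        then show False using \<open>q \<notin> U\<close> \<open>q' \<in> U\<close> by simp
      qed
      then show ?thesis by (auto simp: \<phi>_def b)
    qed
  qed (use assms c r b in \<open>auto simp: V_def \<phi>_def\<close>)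
qed

section \<open>Vector fields and their expressions in local coordinates\<close>

lemma VF_smooth: "X \<in> VF \<Longrightarrow> f \<in> SF \<Longrightarrow> X f \<in> SF"
  by (auto simp: vector_fields_def)

lemma VF_nonsmooth: "X \<in> VF \<Longrightarrow> f \<notin> SF \<Longrightarrow> X f = 0"
  unfolding vector_fields_def by blast

lemma VF_coords: "X \<in> VF \<Longrightarrow> c \<in> \<A> \<Longrightarrow> p \<in> fst c \<Longrightarrow> \<exists>w. has_coords \<A> c p X w"
  unfolding vector_fields_def by blast

lemma VF_eqI:
  assumes "X \<in> VF" "Y \<in> VF" "\<And>f p. f \<in> SF \<Longrightarrow> X f p = Y f p" shows "X = Y"
proof
  fix f show "X f = Y f"
    using assms by (cases "f \<in> SF") (auto simp: VF_nonsmooth)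
qed

lemma has_coords_add:
  "has_coords \<A> c p X v \<Longrightarrow> has_coords \<A> c p Y w \<Longrightarrow> c \<in> \<A> \<Longrightarrow> p \<in> fst c \<Longrightarrow>
    has_coords \<A> c p (X + Y) (v + w)"
  by (auto simp: has_coords_def frechet_derivative_linear_simps SF_differentiable)

lemma has_coords_fscale:
  "has_coords \<A> c p X v \<Longrightarrow> c \<in> \<A> \<Longrightarrow> p \<in> fst c \<Longrightarrow> has_coords \<A> c p (fscale h X) (h p *\<^sub>R v)"
  by (auto simp: has_coords_def fscale_def frechet_derivative_linear_simps SF_differentiable)

lemma VF_add: assumes "X \<in> VF" "Y \<in> VF" shows "X + Y \<in> VF"
proof -
  have "\<exists>w. has_coords \<A> c p (X + Y) w" if "c \<in> \<A>" "p \<in> fst c" for c p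
    using VF_coords[OF assms(1) that] VF_coords[OF assms(2) that]
      has_coords_add[OF _ _ that] by blast
  then show ?thesis
    using assms SF_add unfolding vector_fields_def by (auto simp: plus_fun_def)
qed

lemma VF_fscale: assumes "X \<in> VF" "h \<in> SF" shows "fscale h X \<in> VF"
proof -
  have "\<exists>w. has_coords \<A> c p (fscale h X) w" if "c \<in> \<A>" "p \<in> fst c" for c p
    using VF_coords[OF assms(1) that] has_coords_fscale[OF _ that] by blast
  moreover have "fscale h X f = 0" if "f \<notin> SF" for f
    using VF_nonsmooth[OF assms(1) that] by (auto simp: fscale_def)
  moreover have "fscale h X f \<in> SF" if "f \<in> SF" for f
    using SF_mult[OF assms(2) VF_smooth[OF assms(1) that]] by (simp add: fscale_def)
  ultimately show ?thesis unfolding vector_fields_def by auto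
qed

lemma fscale_one [simp]: "fscale (\<lambda>_. 1) X = X"
  by (auto simp: fscale_def)

lemma fscale_minus_one: "fscale (\<lambda>_. -1) X = - X"
  by (auto simp: fscale_def fun_eq_iff)

lemma fscale_zero [simp]: "fscale (\<lambda>_. 0) X = 0"
  by (auto simp: fscale_def fun_eq_iff)

lemma fscale_zero_right [simp]: "fscale h 0 = 0"
  by (auto simp: fscale_def fun_eq_iff)

lemma VF_zero: "0 \<in> VF"
proof -
  have "has_coords \<A> c p 0 0" if "c \<in> \<A>" "p \<in> fst c" for c p
    using that by (auto simp: has_coords_def frechet_derivative_linear_simps SF_differentiable)
  then show ?thesis using SF_zero unfolding vector_fields_def by auto
qed

lemma VF_uminus: "X \<in> VF \<Longrightarrow> - X \<in> VF"
  using VF_fscale[OF _ SF_const[of "-1"]] by (simp add: fscale_minus_one)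

lemma VF_diff: "X \<in> VF \<Longrightarrow> Y \<in> VF \<Longrightarrow> X - Y \<in> VF"
  using VF_add[OF _ VF_uminus] by (metis add_uminus_conv_diff)

lemma VF_sum: "(\<And>i. i \<in> I \<Longrightarrow> X i \<in> VF) \<Longrightarrow> (\<Sum>i\<in>I. X i) \<in> VF"
  by (induction I rule: infinite_finite_induct) (auto intro: VF_zero VF_add)

lemma VF_local:
  assumes "X \<in> VF" "f \<in> SF" "f' \<in> SF" "open U" "p \<in> U" "\<And>q. q \<in> U \<Longrightarrow> f q = f' q"
  shows "X f p = X f' p"
proof -
  obtain c where c: "c \<in> \<A>" "p \<in> fst c" using ex_chart by blast
  obtain w where w: "has_coords \<A> c p X w" using VF_coords assms c by blast
  have "fderiv (f \<circ> chart_inv c) (snd c p) = fderiv (f' \<circ> chart_inv c) (snd c p)"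
  proof (rule frechet_derivative_eq_on_open)
    show "open (snd c ` (U \<inter> fst c))" using assms c open_dom open_chart_image by blast
    show "snd c p \<in> snd c ` (U \<inter> fst c)" using assms c by blast
  qed (use c assms in auto)
  then show ?thesis using w assms by (simp add: has_coords_def)
qed

lemma
  assumes X: "X \<in> VF"
  shows VF_apply_mult: "f \<in> SF \<Longrightarrow> f' \<in> SF \<Longrightarrow> X (\<lambda>q. f q * f' q) p = f p * X f' p + X f p * f' p"
    and VF_apply_const: "X (\<lambda>q. a) p = 0"
proof -
  obtain c where c: "c \<in> \<A>" "p \<in> fst c" using ex_chart by blast
  obtain w where w: "has_coords \<A> c p X w" using VF_coords X c by blast
  have D: "(f \<circ> chart_inv c has_derivative fderiv (f \<circ> chart_inv c) (snd c p)) (at (snd c p))"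
    if "f \<in> SF" for f using SF_differentiable[OF that c] frechet_derivative_works by blast
  have X': "X f p = fderiv (f \<circ> chart_inv c) (snd c p) w" if "f \<in> SF" for f
    using w that by (simp add: has_coords_def)
  show "X (\<lambda>q. f q * f' q) p = f p * X f' p + X f p * f' p" if "f \<in> SF" "f' \<in> SF"
    using frechet_derivative_at[OF has_derivative_mult[OF D[OF that(1)] D[OF that(2)]]] that c
    by (simp add: X' SF_mult comp_def fun_eq_iff)
  show "X (\<lambda>q. a) p = 0" by (simp add: X' SF_const comp_def)
qed

lemma VF_apply_zero: "X \<in> VF \<Longrightarrow> X 0 = 0"
  using VF_apply_const[of X 0] by (auto simp: zero_fun_def fun_eq_iff)

text \<open>\<open>E\<close> and \<open>h\<close> are global extensions of the coordinate fields and
  of the coordinate functions, correct on \<open>U\<close> only. The functions are needed because a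
  vector field acts on global functions alone: its components at a point \<open>p\<close> of
  \<open>U\<close> are the numbers \<open>X (h i) p\<close>.\<close>

definition local_frame :: "('m, 'n) chart \<Rightarrow> 'm set \<Rightarrow> ('n \<Rightarrow> 'm vfield) \<Rightarrow> ('n \<Rightarrow> 'm \<Rightarrow> real) \<Rightarrow> bool" where
  "local_frame c U E h \<longleftrightarrow> c \<in> \<A> \<and> open U \<and> U \<subseteq> fst c \<and> (\<forall>i. E i \<in> VF \<and> h i \<in> SF) \<and>
     (\<forall>p\<in>U. \<forall>i. has_coords \<A> c p (E i) (axis i 1) \<and> h i p = snd c p $ i)"

text \<open>This is the constant coordinate field \<open>v\<close>, cut off by \<open>b\<close>.
  Membership in \<open>VF\<close> asks for coordinates in every chart; by the chain rule they are
  the multiple by \<open>b\<close> of the differential of the transition map applied to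
  \<open>v\<close>, and zero outside the domain of \<open>c\<close>.\<close>

lemma VF_extend:
  assumes c: "c \<in> \<A>" and b: "smooth_on UNIV b" and K: "compact K" "K \<subseteq> snd c ` fst c"
    and 0: "\<And>x. x \<notin> K \<Longrightarrow> b x = 0"
  shows "(\<lambda>f p. if f \<in> SF \<and> p \<in> fst c
      then b (snd c p) * fderiv (f \<circ> chart_inv c) (snd c p) v else 0) \<in> VF" (is "?X \<in> VF")
proof -
  have "?X f \<in> SF" if f: "f \<in> SF" for f
  proof -
    have "(\<lambda>p. if p \<in> fst c then (\<lambda>x. b x * fderiv (f \<circ> chart_inv c) x v) (snd c p) else 0) \<in> SF"
      by (rule SF_extend[OF c _ K])
         (use 0 in \<open>auto intro!: smooth_on_mult open_img[OF c] smooth_on_frechet_derivative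
            smooth_on_subset[OF b] SF_chart[OF f c, unfolded comp_def] simp: comp_def\<close>)
    then show ?thesis using f by (simp cong: if_cong)
  qed
  moreover have "?X f = 0" if "f \<notin> SF" for f using that by auto
  moreover have "\<exists>w. has_coords \<A> c' p ?X w" if c': "c' \<in> \<A>" "p \<in> fst c'" for c' p
  proof (cases "p \<in> fst c")
    case False
    then have "has_coords \<A> c' p ?X 0"
      using c' by (auto simp: has_coords_def frechet_derivative_linear_simps SF_differentiable)
    then show ?thesis by blast
  next
    case True
    let ?\<tau> = "snd c' \<circ> chart_inv c" and ?x = "snd c p"
    let ?w = "frechet_derivative ?\<tau> (at ?x) v"
    have \<tau>: "(?\<tau> has_derivative frechet_derivative ?\<tau> (at ?x)) (at ?x)"
      by (rule smooth_on_has_derivative[OF transition[OF c c'(1)]]) (use True c' in auto)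
    have \<tau>x: "?\<tau> ?x = snd c' p" using True c by simp
    have eq: "fderiv (f \<circ> chart_inv c) (?x) v = fderiv (f \<circ> chart_inv c') (snd c' p) ?w"
      if f: "f \<in> SF" for f
    proof -
      have "(f \<circ> chart_inv c' has_derivative fderiv (f \<circ> chart_inv c') (?\<tau> ?x)) (at (?\<tau> ?x))"
        unfolding \<tau>x using SF_differentiable[OF f c'] frechet_derivative_works by blast
      from has_derivative_compose[OF \<tau> this]
      have "((\<lambda>x. (f \<circ> chart_inv c') (?\<tau> x)) has_derivative
        (\<lambda>v. fderiv (f \<circ> chart_inv c') (?\<tau> ?x) (frechet_derivative ?\<tau> (at ?x) v))) (at ?x)" .
      then have "(f \<circ> chart_inv c has_derivative
        (\<lambda>v. fderiv (f \<circ> chart_inv c') (?\<tau> ?x) (frechet_derivative ?\<tau> (at ?x) v))) (at ?x)"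
      proof (rule has_derivative_transform_within_open)
        show "open (snd c ` (fst c \<inter> fst c'))"
          using open_chart_image[OF c] open_dom c c'(1) by blast
        show "?x \<in> snd c ` (fst c \<inter> fst c')" using True c' by blast
      qed (use c c' in auto)
      from frechet_derivative_at[OF this, symmetric] show ?thesis
        by (simp only: \<tau>x)
    qed
    then have "has_coords \<A> c' p ?X (b ?x *\<^sub>R ?w)"
      using c' True by (auto simp: has_coords_def frechet_derivative_linear_simps SF_differentiable)
    then show ?thesis by blast
  qed
  ultimately show ?thesis unfolding vector_fields_def by blast
qed

lemma local_frame_exists:
  assumes c: "c \<in> \<A>" and p: "p \<in> fst c"
  obtains U E h where "local_frame c U E h" "p \<in> U"
proof -
  obtain r where r: "r > 0" "cball (snd c p) r \<subseteq> snd c ` fst c"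
    using open_img[OF c] p unfolding open_contains_cball by blast
  obtain b :: "real^'n \<Rightarrow> real" where b: "smooth_on UNIV b" "\<And>x. 0 \<le> b x"
    "\<And>x. x \<in> ball (snd c p) (r/2) \<Longrightarrow> b x = 1" "\<And>x. x \<notin> cball (snd c p) r \<Longrightarrow> b x = 0"
    using smooth_bump_exists[OF r(1), of "snd c p"] by blast
  define E where "E i = (\<lambda>f p. if f \<in> SF \<and> p \<in> fst c
      then b (snd c p) * fderiv (f \<circ> chart_inv c) (snd c p) (axis i 1) else 0)" for i
  define h where "h i = (\<lambda>p. if p \<in> fst c then (\<lambda>x. b x * (x $ i)) (snd c p) else 0)" for i
  define U where "U = fst c \<inter> snd c -` ball (snd c p) (r/2)"
  have "E i \<in> VF" for i
    unfolding E_def by (rule VF_extend[OF c b(1) compact_cball r(2)]) (use b in auto)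
  moreover have "h i \<in> SF" for i
    unfolding h_def
    by (rule SF_extend[OF c _ compact_cball r(2)])
       (use b in \<open>auto intro!: smooth_on_mult open_img[OF c] smooth_on_subset[OF b(1)]
          smooth_on_bounded_linear[OF bounded_linear_vec_nth]\<close>)
  moreover have "open U" unfolding U_def using open_chart_preimage[OF c] by blast
  ultimately have "local_frame c U E h"
    using c b by (auto simp: local_frame_def U_def h_def E_def has_coords_def)
  moreover have "p \<in> U" using p r by (auto simp: U_def)
  ultimately show thesis by (rule that)
qed

lemma local_frame_function:
  assumes "local_frame c U E h" "p \<in> U" "has_coords \<A> c p X w"
  shows "X (h i) p = w $ i"
proof -
  have c: "c \<in> \<A>" and p: "p \<in> fst c" using assms by (auto simp: local_frame_def)
  have "((\<lambda>x. x $ i) has_derivative (\<lambda>x. x $ i)) (at (snd c p))"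
    by (simp add: bounded_linear_imp_has_derivative bounded_linear_vec_nth)
  then have "(h i \<circ> chart_inv c has_derivative (\<lambda>x. x $ i)) (at (snd c p))"
  proof (rule has_derivative_transform_within_open)
    show "open (snd c ` U)" using assms open_chart_image by (auto simp: local_frame_def)
  qed (use assms c in \<open>auto simp: local_frame_def subset_iff\<close>)
  then show ?thesis
    using frechet_derivative_at assms by (metis has_coords_def local_frame_def)
qed

text \<open>Testing on the functions \<open>h i\<close> determines a coordinate vector uniquely,
  which gives the definite description in \<open>coords\<close> its meaning.\<close>

lemma local_frame_coords:
  assumes "local_frame c U E h" "p \<in> U" "X \<in> VF"
  shows "has_coords \<A> c p X (\<chi> i. X (h i) p)" "coords \<A> c p X = (\<chi> i. X (h i) p)"
proof -
  have "c \<in> \<A>" "p \<in> fst c" using assms by (auto simp: local_frame_def)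
  then obtain w where w: "has_coords \<A> c p X w" using VF_coords assms(3) by blast
  have eq: "w' = (\<chi> i. X (h i) p)" if "has_coords \<A> c p X w'" for w'
    using local_frame_function[OF assms(1,2) that] by (simp add: vec_eq_iff)
  show "has_coords \<A> c p X (\<chi> i. X (h i) p)" using w eq by simp
  then show "coords \<A> c p X = (\<chi> i. X (h i) p)" unfolding coords_def using eq by blast
qed

lemma local_frame_expand:
  assumes "local_frame c U E h" "p \<in> U" "X \<in> VF" "f \<in> SF"
  shows "X f p = (\<Sum>i\<in>UNIV. X (h i) p * E i f p)"
proof -
  have c: "c \<in> \<A>" and p: "p \<in> fst c" using assms by (auto simp: local_frame_def)
  let ?D = "fderiv (f \<circ> chart_inv c) (snd c p)"
  have lin: "linear ?D" using SF_differentiable assms c p linear_frechet_derivative by blast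
  have "X f p = ?D (\<chi> i. X (h i) p)"
    using local_frame_coords(1)[OF assms(1-3)] assms(4) by (simp add: has_coords_def)
  also have "(\<chi> i. X (h i) p) = (\<Sum>i\<in>UNIV. X (h i) p *\<^sub>R axis i 1)"
    by (simp add: vec_eq_iff axis_def if_distrib cong: if_cong)
  also have "?D \<dots> = (\<Sum>i\<in>UNIV. X (h i) p * ?D (axis i 1))"
    by (simp add: linear_sum[OF lin] linear_cmul[OF lin])
  finally show ?thesis using assms by (simp add: local_frame_def has_coords_def)
qed

text \<open>Linearity over smooth functions of a map on vector fields, after evaluation at
  \<open>p\<close>. It forces dependence on the value of the field at \<open>p\<close> alone, as
  \<open>tensorial_cong\<close> shows.\<close>

definition tensorial :: "'m \<Rightarrow> ('m vfield \<Rightarrow> real) \<Rightarrow> bool" where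
  "tensorial p T \<longleftrightarrow> (\<forall>f\<in>SF. \<forall>h\<in>SF. \<forall>X\<in>VF. \<forall>Y\<in>VF.
     T (fscale f X + fscale h Y) = f p * T X + h p * T Y)"

lemma tensorial_lincomb:
  assumes T: "tensorial p T" and f: "\<And>i. i \<in> I \<Longrightarrow> f i \<in> SF" and X: "\<And>i. i \<in> I \<Longrightarrow> X i \<in> VF"
  shows "T (\<Sum>i\<in>I. fscale (f i) (X i)) = (\<Sum>i\<in>I. f i p * T (X i))"
proof -
  have T0: "T 0 = 0"
  proof -
    have "T (fscale (\<lambda>_. 0) 0 + fscale (\<lambda>_. 0) 0) = 0 * T 0 + 0 * T 0"
      using T SF_const VF_zero unfolding tensorial_def by blast
    then show ?thesis by simp
  qed
  from f X show ?thesis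
  proof (induction I rule: infinite_finite_induct)
    case (insert i I)
    have "T (fscale (f i) (X i) + fscale (\<lambda>_. 1) (\<Sum>i\<in>I. fscale (f i) (X i))) =
      f i p * T (X i) + 1 * T (\<Sum>i\<in>I. fscale (f i) (X i))"
      using T insert.prems SF_const[of 1] VF_sum[of I] VF_fscale
      unfolding tensorial_def by (metis (no_types, lifting) insertI1 insertI2)
    then have "T (\<Sum>i\<in>insert i I. fscale (f i) (X i)) = f i p * T (X i) + T (\<Sum>i\<in>I. fscale (f i) (X i))"
      by (simp only: sum.insert[OF insert.hyps] fscale_one mult_1)
    also have "T (\<Sum>i\<in>I. fscale (f i) (X i)) = (\<Sum>i\<in>I. f i p * T (X i))"
      using insert by blast
    finally show ?case by (simp only: sum.insert[OF insert.hyps])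
  qed (simp_all add: T0)
qed

text \<open>The frame expansion is valid on \<open>U\<close> only. Multiplied by a function
  vanishing off \<open>U\<close> it becomes an identity of global vector fields with smooth
  coefficients, to which a map on \<open>VF\<close> can be applied.\<close>

lemma local_frame_globalize:
  assumes F: "local_frame c U E h" and \<phi>: "\<phi> \<in> SF" "\<And>q. q \<notin> U \<Longrightarrow> \<phi> q = 0" and X: "X \<in> VF"
  shows "(\<lambda>q. \<phi> q * X (h i) q) \<in> SF"
    and "fscale \<phi> X = (\<Sum>i\<in>UNIV. fscale (\<lambda>q. \<phi> q * X (h i) q) (E i))"
proof -
  have E: "E i \<in> VF" and h: "h i \<in> SF" for i
    using F by (auto simp: local_frame_def)
  show s: "(\<lambda>q. \<phi> q * X (h i) q) \<in> SF" for i
    by (rule SF_mult[OF \<phi>(1) VF_smooth[OF X h]])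
  show "fscale \<phi> X = (\<Sum>i\<in>UNIV. fscale (\<lambda>q. \<phi> q * X (h i) q) (E i))"
  proof (rule VF_eqI)
    fix f q assume f: "f \<in> SF"
    have "(\<Sum>i\<in>UNIV. fscale (\<lambda>q. \<phi> q * X (h i) q) (E i)) f q = (\<Sum>i\<in>UNIV. \<phi> q * X (h i) q * E i f q)"
      by (simp add: sum_fun_apply) (simp add: fscale_def)
    also have "\<dots> = \<phi> q * X f q"
      using \<phi>(2) local_frame_expand[OF F _ X f] by (cases "q \<in> U") (auto simp: sum_distrib_left mult.assoc)
    finally show "fscale \<phi> X f q = (\<Sum>i\<in>UNIV. fscale (\<lambda>q. \<phi> q * X (h i) q) (E i)) f q"
      by (simp add: fscale_def)
  qed (use \<phi> X s E in \<open>auto intro!: VF_fscale VF_sum\<close>)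
qed

text \<open>Since \<phi> is 1 at \<open>p\<close>, the fields \<open>X\<close> and
  \<open>fscale \<phi> X\<close> have the same image under \<open>T\<close>, and the latter is a
  global combination of the frame fields.\<close>

lemma tensorial_expand:
  assumes T: "tensorial p T" and F: "local_frame c U E h" and p: "p \<in> U" and X: "X \<in> VF"
  shows "T X = (\<Sum>i\<in>UNIV. X (h i) p * T (E i))"
proof -
  have U: "open U" and E: "E i \<in> VF" for i
    using F by (auto simp: local_frame_def)
  obtain \<phi> V where \<phi>: "\<phi> \<in> SF" "p \<in> V" "\<And>q. q \<in> V \<Longrightarrow> \<phi> q = 1" "\<And>q. q \<notin> U \<Longrightarrow> \<phi> q = 0"
    by (rule bump_function[OF U p]) blast
  note G = local_frame_globalize[OF F \<phi>(1,4) X]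
  have "T (\<Sum>i\<in>UNIV. fscale (\<lambda>q. \<phi> q * X (h i) q) (E i)) = (\<Sum>i\<in>UNIV. X (h i) p * T (E i))"
    by (subst tensorial_lincomb[OF T G(1) E]) (use \<phi> in auto)
  moreover have "T (\<Sum>i\<in>{()}. fscale \<phi> X) = (\<Sum>i\<in>{()}. \<phi> p * T X)"
    by (rule tensorial_lincomb[OF T]) (use \<phi> X in auto)
  ultimately show ?thesis using \<phi> G(2) by simp
qed

lemma tensorial_cong:
  assumes "tensorial p T" "X \<in> VF" "Y \<in> VF" "\<And>f. f \<in> SF \<Longrightarrow> X f p = Y f p"
  shows "T X = T Y"
proof -
  obtain c where c: "c \<in> \<A>" "p \<in> fst c" using ex_chart by blast
  then obtain U E h where F: "local_frame c U E h" "p \<in> U" using local_frame_exists by blast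
  then have "h i \<in> SF" for i by (auto simp: local_frame_def)
  then show ?thesis
    using tensorial_expand[OF assms(1) F assms(2)] tensorial_expand[OF assms(1) F assms(3)] assms(4) by simp
qed

end

section \<open>Orthonormal frames and the volume measure\<close>

lemma nths_singleton_index: "i < length xs \<Longrightarrow> nths xs {i} = [xs ! i]"
proof (induction xs arbitrary: i)
  case (Cons x xs)
  have "{j. Suc j \<in> {i}} = (case i of 0 \<Rightarrow> {} | Suc k \<Rightarrow> {k})"
    by (auto split: nat.splits)
  with Cons show ?case by (auto simp: nths_Cons split: nat.splits)
qed simp

lemma nths_pair_index: "i < j \<Longrightarrow> j < length xs \<Longrightarrow> nths xs {i, j} = [xs ! i, xs ! j]"
proof (induction xs arbitrary: i j)
  case (Cons x xs)
  obtain m where j: "j = Suc m" using Cons.prems by (cases j) auto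
  have "{k. Suc k \<in> {i, j}} = (case i of 0 \<Rightarrow> {m} | Suc k \<Rightarrow> {k, m})"
    by (auto simp: j split: nat.splits)
  with Cons j show ?case by (auto simp: nths_Cons nths_singleton_index split: nat.splits)
qed simp

context manifold
begin

lemma tensorial_apply: "f \<in> SF \<Longrightarrow> tensorial p (\<lambda>X. X f p)"
  by (auto simp: tensorial_def fscale_def)

lemma tensorial_eval:
  assumes F: "\<And>f h X Y. f \<in> SF \<Longrightarrow> h \<in> SF \<Longrightarrow> X \<in> VF \<Longrightarrow> Y \<in> VF \<Longrightarrow>
    F (fscale f X + fscale h Y) = fscale f (F X) + fscale h (F Y)"
  shows "tensorial p (\<lambda>X. F X f p)"
  unfolding tensorial_def using F by (auto simp: fscale_def)

lemma Omega_linear: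
  "\<alpha> \<in> Omega \<A> k \<Longrightarrow> length Xs = k \<Longrightarrow> set Xs \<subseteq> VF \<Longrightarrow> i < k \<Longrightarrow> f \<in> SF \<Longrightarrow> h \<in> SF \<Longrightarrow>
    X \<in> VF \<Longrightarrow> Y \<in> VF \<Longrightarrow>
    \<alpha> (Xs[i := fscale f X + fscale h Y]) = fscale f (\<alpha> (Xs[i := X])) + fscale h (\<alpha> (Xs[i := Y]))"
  unfolding Omega_def by blast

lemma Omega_alternating:
  "\<alpha> \<in> Omega \<A> k \<Longrightarrow> length Xs = k \<Longrightarrow> set Xs \<subseteq> VF \<Longrightarrow> i < j \<Longrightarrow> j < k \<Longrightarrow> Xs ! i = Xs ! j \<Longrightarrow> \<alpha> Xs = 0"
  unfolding Omega_def by blast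

lemma Omega_tensorial:
  assumes "\<alpha> \<in> Omega \<A> k" "length Xs = k" "set Xs \<subseteq> VF" "i < k"
  shows "tensorial p (\<lambda>X. \<alpha> (Xs[i := X]) f p)"
  by (rule tensorial_eval) (rule Omega_linear[OF assms])

lemma Omega_vector_field: "\<alpha> \<in> Omega \<A> k \<Longrightarrow> set Xs \<subseteq> VF \<Longrightarrow> \<alpha> Xs \<in> VF"
  unfolding Omega_def using VF_zero by (cases "length Xs = k") auto

lemma tensorial_zero: "tensorial p T \<Longrightarrow> T 0 = 0"
  using tensorial_lincomb[of p T "{}"] by simp

lemma local_frame_delta:
  assumes "local_frame c U E h" "p \<in> U"
  shows "E j (h i) p = (if i = j then 1 else 0)"
proof -
  have "has_coords \<A> c p (E j) (axis j 1)" using assms by (auto simp: local_frame_def)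
  from local_frame_function[OF assms this] show ?thesis by (auto simp: axis_def)
qed

end

locale riemannian_manifold = manifold \<A>
  for \<A> :: "('m::{t2_space,second_countable_topology}, 'n::finite) chart set" +
  fixes g :: "'m vfield \<Rightarrow> 'm vfield \<Rightarrow> 'm \<Rightarrow> real"
  assumes metric: "riemannian_metric \<A> g"
begin

lemma
  assumes "X \<in> VF" "Y \<in> VF"
  shows metric_smooth: "g X Y \<in> SF" and metric_sym: "g X Y = g Y X"
  using metric assms unfolding riemannian_metric_def by blast+

lemma metric_linear_left:
  "f \<in> SF \<Longrightarrow> h \<in> SF \<Longrightarrow> X \<in> VF \<Longrightarrow> Y \<in> VF \<Longrightarrow> Z \<in> VF \<Longrightarrow>
    g (fscale f X + fscale h Y) Z = (\<lambda>p. f p * g X Z p + h p * g Y Z p)"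
  using metric unfolding riemannian_metric_def by blast

lemma tensorial_metric_left: "Z \<in> VF \<Longrightarrow> tensorial p (\<lambda>X. g X Z p)"
  by (auto simp: tensorial_def metric_linear_left)

lemma tensorial_metric_right: "Z \<in> VF \<Longrightarrow> tensorial p (\<lambda>X. g Z X p)"
  by (auto simp: tensorial_def metric_sym[of Z] metric_linear_left VF_add VF_fscale)

lemma metric_nonneg: "X \<in> VF \<Longrightarrow> 0 \<le> g X X p"
  using metric unfolding riemannian_metric_def by blast

lemma metric_zero_imp: "X \<in> VF \<Longrightarrow> g X X p = 0 \<Longrightarrow> X f p = 0"
  using metric unfolding riemannian_metric_def by blast

lemma metric_frame:
  assumes "local_frame c U E h" "p \<in> U" "X \<in> VF" "Y \<in> VF"
  shows "g X Y p = (\<Sum>i\<in>UNIV. \<Sum>j\<in>UNIV. X (h i) p * Y (h j) p * g (E i) (E j) p)"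
proof -
  have E: "E i \<in> VF" for i using assms by (auto simp: local_frame_def)
  have "g X Y p = (\<Sum>i\<in>UNIV. X (h i) p * g (E i) Y p)"
    by (rule tensorial_expand[OF tensorial_metric_left]) (use assms in auto)
  also have "\<dots> = (\<Sum>i\<in>UNIV. X (h i) p * (\<Sum>j\<in>UNIV. Y (h j) p * g (E i) (E j) p))"
    by (intro sum.cong refl arg_cong2[where f = times] tensorial_expand[OF tensorial_metric_right])
       (use assms E in auto)
  finally show ?thesis by (simp add: sum_distrib_left mult.assoc)
qed

abbreviation "onframe \<equiv> orthonormal_frame \<A> g"
abbreviation "vinner \<equiv> vform_inner \<A> g"

definition orthonormal_at :: "'m \<Rightarrow> nat \<Rightarrow> 'm vfield list \<Rightarrow> bool" where
  "orthonormal_at p m e \<longleftrightarrow> length e = m \<and> set e \<subseteq> VF \<and>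
     (\<forall>i<m. \<forall>j<m. g (e ! i) (e ! j) p = (if i = j then 1 else 0))"

text \<open>The induction adds a vector by counting dimensions. The pairings of the \<open>m\<close>
  given fields with a coordinate frame are \<open>m\<close> vectors \<open>v k\<close> of a space of
  larger dimension, so some nonzero \<open>w\<close> is orthogonal to all of them; the combination
  of the frame fields with coefficients \<open>w\<close> is then orthogonal to the given fields for
  \<open>g\<close> at \<open>p\<close> and is normalised. This gives the choice in
  \<open>orthonormal_frame\<close> its meaning.\<close>

lemma orthonormal_at_exists: "m \<le> CARD('n) \<Longrightarrow> \<exists>e. orthonormal_at p m e"
proof (induction m)
  case 0 show ?case by (auto simp: orthonormal_at_def)
next
  case (Suc m)
  then obtain e where e: "orthonormal_at p m e" by auto
  have eV: "e ! k \<in> VF" if "k < m" for k using e that by (auto simp: orthonormal_at_def)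
  obtain c where c: "c \<in> \<A>" "p \<in> fst c" using ex_chart by blast
  then obtain U E h where F: "local_frame c U E h" and p: "p \<in> U" using local_frame_exists by blast
  have E: "E i \<in> VF" and h: "h i \<in> SF" for i using F by (auto simp: local_frame_def)
  define v where "v k = (\<chi> i. g (E i) (e ! k) p)" for k
  have "dim (v ` {..<m}) \<le> card (v ` {..<m})" by (rule dim_le_card) (auto simp: span_superset)
  also have "\<dots> \<le> m" using card_image_le[of "{..<m}" v] by simp
  also have "m < DIM(real ^ 'n)" using Suc by simp
  finally obtain w where w: "w \<noteq> 0" "\<And>y. y \<in> span (v ` {..<m}) \<Longrightarrow> orthogonal w y"
    using orthogonal_to_subspace_exists by blast
  define W where "W = (\<Sum>i\<in>UNIV. fscale (\<lambda>_. w $ i) (E i))"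
  have WV: "W \<in> VF" unfolding W_def by (intro VF_sum VF_fscale E SF_const)
  have TW: "T W = (\<Sum>i\<in>UNIV. w $ i * T (E i))" if "tensorial p T" for T
    unfolding W_def by (rule tensorial_lincomb[OF that]) (auto intro: E SF_const)
  have We: "g W (e ! k) p = 0" if "k < m" for k
  proof -
    have "g W (e ! k) p = w \<bullet> v k"
      using TW[OF tensorial_metric_left[OF eV[OF that]]] by (simp add: inner_vec_def v_def)
    also have "\<dots> = 0" using w(2)[of "v k"] that by (auto simp: orthogonal_def span_base)
    finally show ?thesis .
  qed
  obtain i where i: "w $ i \<noteq> 0" using w(1) by (auto simp: vec_eq_iff)
  have "W (h i) p = w $ i"
    using TW[OF tensorial_apply[OF h[of i]]] by (simp add: local_frame_delta[OF F p] if_distrib cong: if_cong)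
  then have "g W W p \<noteq> 0" using metric_zero_imp[OF WV] i by metis
  then have pos: "g W W p > 0" using metric_nonneg[OF WV, of p] by simp
  define a where "a = 1 / sqrt (g W W p)"
  have a: "a * a * g W W p = 1" using pos by (simp add: a_def)
  define N where "N = fscale (\<lambda>_. a) W"
  have NV: "N \<in> VF" unfolding N_def by (intro VF_fscale WV SF_const)
  have TN: "T N = a * T W" if "tensorial p T" for T
    using tensorial_lincomb[OF that, of "{()}" "\<lambda>_ _. a" "\<lambda>_. W"]
    by (simp add: N_def WV SF_const)
  have NN: "g N N p = 1"
    using TN[OF tensorial_metric_left[OF NV]] TN[OF tensorial_metric_right[OF WV]] a by simp
  have Ne: "g N (e ! k) p = 0" if "k < m" for k
    using TN[OF tensorial_metric_left[OF eV[OF that]]] We[OF that] by simp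
  have eN: "g (e ! k) N p = 0" if "k < m" for k
    using Ne[OF that] metric_sym[OF NV eV[OF that]] by simp
  have "orthonormal_at p (Suc m) (e @ [N])"
    using e NV NN Ne eN by (auto simp: orthonormal_at_def nth_append less_Suc_eq)
  then show ?case by blast
qed

lemma orthonormal_frame: "orthonormal_at p CARD('n) (onframe p)"
  unfolding orthonormal_frame_def using someI_ex[OF orthonormal_at_exists[OF order_refl, unfolded orthonormal_at_def]]
  unfolding orthonormal_at_def by blast

lemma set_orthonormal_nths: "set (nths (onframe p) K) \<subseteq> VF"
  using orthonormal_frame[of p] set_nths_subset[of "onframe p" K]
  by (auto simp: orthonormal_at_def)

lemma length_orthonormal_nths:
  assumes "K \<subseteq> {..<CARD('n)}" shows "length (nths (onframe p) K) = card K"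
proof -
  have "{i. i < CARD('n) \<and> i \<in> K} = K" using assms by auto
  then show ?thesis using orthonormal_frame[of p] by (simp add: orthonormal_at_def length_nths)
qed

text \<open>With \<open>P\<close> the matrix of coordinates of an orthonormal basis and \<open>G\<close> the Gram matrix of the
  coordinate frame, \<open>P G P\<^sup>T = 1\<close>.\<close>

lemma orthonormal_basis_inverse:
  assumes F: "local_frame c U E h" and p: "p \<in> U"
  shows "\<exists>e. (\<forall>a. e a \<in> VF) \<and>
     (\<chi> a i. e a (h i) p) ** (\<chi> i b. g (E i) (e b) p) = (mat 1 :: real^'n^'n) \<and>
     (\<forall>t :: 'm vfield \<Rightarrow> real. (\<Sum>k<CARD('n). t (onframe p ! k)) = (\<Sum>a\<in>UNIV. t (e a)))"
proof -
  obtain b where b: "bij_betw b {..<CARD('n)} (UNIV :: 'n set)"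
    using ex_bij_betw_nat_finite[of "UNIV :: 'n set"] by (auto simp: atLeast0LessThan)
  define b' where "b' = inv_into {..<CARD('n)} b"
  have b': "bij_betw b' (UNIV :: 'n set) {..<CARD('n)}"
    unfolding b'_def by (rule bij_betw_inv_into[OF b])
  define e where "e a = onframe p ! b' a" for a
  note on = orthonormal_frame[of p]
  have b'l: "b' a < CARD('n)" for a using b' by (auto simp: bij_betw_def)
  have b'i: "b' a = b' d \<longleftrightarrow> a = d" for a d using b' by (auto simp: bij_betw_def inj_eq)
  have eV: "e a \<in> VF" for a using on b'l[of a] by (auto simp: orthonormal_at_def e_def)
  have "(\<Sum>i\<in>UNIV. e a (h i) p * g (E i) (e d) p) = (if a = d then 1 else 0)" for a d
  proof -
    have "(\<Sum>i\<in>UNIV. e a (h i) p * g (E i) (e d) p) = g (e a) (e d) p"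
      by (rule tensorial_expand[OF tensorial_metric_left[OF eV] F p eV, symmetric])
    also have "\<dots> = (if a = d then 1 else 0)"
      using on b'l b'i by (simp add: orthonormal_at_def e_def)
    finally show ?thesis .
  qed
  then have "(\<chi> a i. e a (h i) p) ** (\<chi> i b. g (E i) (e b) p) = (mat 1 :: real^'n^'n)"
    by (simp add: matrix_matrix_mult_def mat_def)
  moreover have "(\<Sum>k<CARD('n). t (onframe p ! k)) = (\<Sum>a\<in>UNIV. t (e a))" for t :: "_ \<Rightarrow> real"
    using sum.reindex_bij_betw[OF b', of "\<lambda>k. t (onframe p ! k)"] by (simp add: e_def)
  ultimately show ?thesis using eV by blast
qed

text \<open>The coordinates of an orthonormal basis form a left inverse of its matrix of pairings
  with the coordinate frame. For square matrices this is also a right inverse, and that relation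
  expresses the coordinate fields through the orthonormal ones.\<close>

lemma orthonormal_expand:
  assumes T: "tensorial p T" and X: "X \<in> VF"
  shows "T X = (\<Sum>k<CARD('n). g X (onframe p ! k) p * T (onframe p ! k))"
proof -
  obtain c where c: "c \<in> \<A>" "p \<in> fst c" using ex_chart by blast
  then obtain U E h where F: "local_frame c U E h" and p: "p \<in> U" using local_frame_exists by blast
  have E: "E i \<in> VF" for i using F by (auto simp: local_frame_def)
  obtain e where eV: "\<And>a. e a \<in> VF"
    and M: "(\<chi> a i. e a (h i) p) ** (\<chi> i b. g (E i) (e b) p) = (mat 1 :: real^'n^'n)"
    and s: "\<And>t :: 'm vfield \<Rightarrow> real. (\<Sum>k<CARD('n). t (onframe p ! k)) = (\<Sum>a\<in>UNIV. t (e a))"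
    using orthonormal_basis_inverse[OF F p] by blast
  have M': "(\<chi> i b. g (E i) (e b) p) ** (\<chi> a i. e a (h i) p) = (mat 1 :: real^'n^'n)"
    using M matrix_left_right_inverse by blast
  have \<delta>: "(\<Sum>a\<in>UNIV. g (E i) (e a) p * e a (h j) p) = (if i = j then 1 else 0)" for i j
    using arg_cong[OF M', of "\<lambda>m. m $ i $ j"] by (simp add: matrix_matrix_mult_def mat_def)
  have TE: "T (E i) = (\<Sum>a\<in>UNIV. g (E i) (e a) p * T (e a))" for i
  proof -
    have "(\<Sum>a\<in>UNIV. g (E i) (e a) p * T (e a)) = (\<Sum>a\<in>UNIV. \<Sum>j\<in>UNIV. g (E i) (e a) p * e a (h j) p * T (E j))"
      by (subst tensorial_expand[OF T F p eV]) (simp add: sum_distrib_left mult.assoc)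
    also have "\<dots> = (\<Sum>j\<in>UNIV. (\<Sum>a\<in>UNIV. g (E i) (e a) p * e a (h j) p) * T (E j))"
      by (subst sum.swap) (simp add: sum_distrib_right)
    also have "\<dots> = T (E i)" by (simp add: \<delta> if_distrib[of "\<lambda>x. x * _"] cong: if_cong)
    finally show ?thesis ..
  qed
  have "T X = (\<Sum>i\<in>UNIV. X (h i) p * T (E i))" by (rule tensorial_expand[OF T F p X])
  also have "\<dots> = (\<Sum>a\<in>UNIV. (\<Sum>i\<in>UNIV. X (h i) p * g (E i) (e a) p) * T (e a))"
    by (simp add: TE sum_distrib_left sum_distrib_right mult.assoc) (rule sum.swap)
  also have "\<dots> = (\<Sum>a\<in>UNIV. g X (e a) p * T (e a))"
    by (simp add: tensorial_expand[OF tensorial_metric_left[OF eV] F p X])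
  finally show ?thesis by (simp add: s[of "\<lambda>Y. g X Y p * T Y"])
qed

text \<open>Tensoriality of \<open>g\<close> makes the arbitrary extensions chosen in
  \<open>coord_field\<close> irrelevant. This replaces a choice made separately at every point by
  fields that are smooth near \<open>p\<close>.\<close>

lemma metric_coeffs_frame:
  assumes F: "local_frame c U E h" and p: "p \<in> U"
  shows "metric_coeffs \<A> g c p = (\<chi> i j. g (E i) (E j) p)"
proof -
  have E: "E i \<in> VF" for i using F by (auto simp: local_frame_def)
  have "coord_field \<A> c p i \<in> VF \<and> has_coords \<A> c p (coord_field \<A> c p i) (axis i 1)" for i
    unfolding coord_field_def by (rule someI[of _ "E i"]) (use F p in \<open>auto simp: local_frame_def\<close>)
  moreover have "has_coords \<A> c p (E i) (axis i 1)" for i using F p by (auto simp: local_frame_def)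
  ultimately have C: "coord_field \<A> c p i \<in> VF"
    and eq: "f \<in> SF \<Longrightarrow> coord_field \<A> c p i f p = E i f p" for i f
    by (auto simp: has_coords_def)
  have "g (coord_field \<A> c p i) (coord_field \<A> c p j) p = g (E i) (E j) p" for i j
    using tensorial_cong[OF tensorial_metric_left[OF C] C E eq, of i j]
      tensorial_cong[OF tensorial_metric_right[OF E] C E eq, of i j] by simp
  then show ?thesis by (simp add: metric_coeffs_def)
qed

text \<open>Taking determinants in the identity for the Gram matrix gives
  \<open>(det P)\<^sup>2 * det G = 1\<close>.\<close>

lemma det_metric_pos:
  assumes F: "local_frame c U E h" and p: "p \<in> U"
  shows "det (\<chi> i j. g (E i) (E j) p) > 0"
proof -
  have E: "E i \<in> VF" for i using F by (auto simp: local_frame_def)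
  obtain e where eV: "\<And>a. e a \<in> VF"
    and M: "(\<chi> a i. e a (h i) p) ** (\<chi> i b. g (E i) (e b) p) = (mat 1 :: real^'n^'n)"
    using orthonormal_basis_inverse[OF F p] by blast
  let ?P = "(\<chi> a i. e a (h i) p) :: real^'n^'n" and ?G = "(\<chi> i j. g (E i) (E j) p) :: real^'n^'n"
  have "g (E i) (e b) p = (\<Sum>j\<in>UNIV. g (E i) (E j) p * e b (h j) p)" for i b
    using tensorial_expand[OF tensorial_metric_right[OF E] F p eV] by (simp add: mult.commute)
  then have "(\<chi> i b. g (E i) (e b) p) = ?G ** transpose ?P"
    by (simp add: matrix_matrix_mult_def transpose_def)
  with M have PGP: "?P ** (?G ** transpose ?P) = mat 1" by simp
  have "det ?P * (det ?G * det ?P) = 1"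
    using arg_cong[OF PGP, of det] by (simp only: det_mul det_transpose det_I)
  then have "(det ?P)\<^sup>2 * det ?G = 1" by (simp add: power2_eq_square algebra_simps)
  then show ?thesis
    using mult_nonneg_nonpos[of "(det ?P)\<^sup>2" "det ?G"] by (cases "det ?G > 0") auto
qed

text \<open>Summing the coordinate components against the Gram matrix rebuilds \<open>g\<close> on
  the values. The assumptions ask for values in \<open>VF\<close> and not for membership in
  \<open>Omega\<close>, so that the formula also applies to \<open>d w\<close> in every
  degree.\<close>

lemma vform_inner_orthonormal:
  assumes "\<And>Xs. length Xs = k \<Longrightarrow> set Xs \<subseteq> VF \<Longrightarrow> \<alpha> Xs \<in> VF"
    and "\<And>Xs. length Xs = k \<Longrightarrow> set Xs \<subseteq> VF \<Longrightarrow> \<beta> Xs \<in> VF"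
  shows "vinner k \<alpha> \<beta> p = (\<Sum>K | K \<subseteq> {..<CARD('n)} \<and> card K = k.
    g (\<alpha> (nths (onframe p) K)) (\<beta> (nths (onframe p) K)) p)"
proof -
  define c where "c = (SOME c. c \<in> \<A> \<and> p \<in> fst c)"
  have c: "c \<in> \<A>" "p \<in> fst c"
    using someI_ex[of "\<lambda>c. c \<in> \<A> \<and> p \<in> fst c"] ex_chart[of p] unfolding c_def by blast+
  then obtain U E h where F: "local_frame c U E h" and p: "p \<in> U" using local_frame_exists by blast
  let ?e = "onframe p"
  let ?S = "{K. K \<subseteq> {..<CARD('n)} \<and> card K = k}"
  have V: "\<alpha> (nths ?e K) \<in> VF" "\<beta> (nths ?e K) \<in> VF" if "K \<in> ?S" for K
    using that by (auto intro!: assms simp: length_orthonormal_nths set_orthonormal_nths[THEN subsetD])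
  have "vinner k \<alpha> \<beta> p = (\<Sum>i\<in>UNIV. \<Sum>j\<in>UNIV. \<Sum>K\<in>?S.
      coords \<A> c p (\<alpha> (nths ?e K)) $ i * coords \<A> c p (\<beta> (nths ?e K)) $ j * g (E i) (E j) p)"
    by (simp add: vform_inner_def c_def[symmetric] form_inner_def metric_coeffs_frame[OF F p] sum_distrib_right)
  also have "\<dots> = (\<Sum>i\<in>UNIV. \<Sum>K\<in>?S. \<Sum>j\<in>UNIV.
      coords \<A> c p (\<alpha> (nths ?e K)) $ i * coords \<A> c p (\<beta> (nths ?e K)) $ j * g (E i) (E j) p)"
    by (intro sum.cong refl sum.swap)
  also have "\<dots> = (\<Sum>K\<in>?S. \<Sum>i\<in>UNIV. \<Sum>j\<in>UNIV.
      coords \<A> c p (\<alpha> (nths ?e K)) $ i * coords \<A> c p (\<beta> (nths ?e K)) $ j * g (E i) (E j) p)"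
    by (rule sum.swap)
  also have "\<dots> = (\<Sum>K\<in>?S. g (\<alpha> (nths ?e K)) (\<beta> (nths ?e K)) p)"
    by (intro sum.cong refl) (simp add: metric_frame[OF F p V] local_frame_coords(2)[OF F p V(1)] local_frame_coords(2)[OF F p V(2)])
  finally show ?thesis .
qed

lemma vform_inner_Omega:
  assumes "\<alpha> \<in> Omega \<A> k" "\<beta> \<in> Omega \<A> k"
  shows "vinner k \<alpha> \<beta> p = (\<Sum>K | K \<subseteq> {..<CARD('n)} \<and> card K = k.
    g (\<alpha> (nths (onframe p) K)) (\<beta> (nths (onframe p) K)) p)"
  using assms Omega_vector_field by (intro vform_inner_orthonormal) auto

lemma vform_inner_nonneg: "\<alpha> \<in> Omega \<A> k \<Longrightarrow> 0 \<le> vinner k \<alpha> \<alpha> p"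
  by (auto simp: vform_inner_Omega intro!: sum_nonneg metric_nonneg Omega_vector_field[OF _ set_orthonormal_nths])

lemma vform_inner_zero_imp_frame:
  assumes a: "\<alpha> \<in> Omega \<A> k" and 0: "vinner k \<alpha> \<alpha> p = 0"
    and K: "K \<subseteq> {..<CARD('n)}" "card K = k"
  shows "\<alpha> (nths (onframe p) K) f p = 0"
proof -
  let ?e = "onframe p"
  have V: "\<alpha> (nths ?e K) \<in> VF" for K by (rule Omega_vector_field[OF a set_orthonormal_nths])
  have "finite {K. K \<subseteq> {..<CARD('n)} \<and> card K = k}"
    by (rule finite_subset[of _ "Pow {..<CARD('n)}"]) auto
  then have "g (\<alpha> (nths ?e K)) (\<alpha> (nths ?e K)) p = 0"
    using 0 K by (subst (asm) vform_inner_Omega[OF a a], subst (asm) sum_nonneg_eq_0_iff)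
      (auto intro: metric_nonneg V)
  then show ?thesis by (rule metric_zero_imp[OF V])
qed

lemma vform_inner_definite_1:
  assumes a: "\<alpha> \<in> Omega \<A> 1" and 0: "vinner 1 \<alpha> \<alpha> p = 0" and X: "X \<in> VF"
  shows "\<alpha> [X] f p = 0"
proof -
  let ?e = "onframe p"
  have T: "tensorial p (\<lambda>X. \<alpha> [X] f p)"
    using Omega_tensorial[OF a, of "[0]" 0 p f] VF_zero by simp
  have "\<alpha> [?e ! i] f p = 0" if "i < CARD('n)" for i
    using vform_inner_zero_imp_frame[OF a 0, of "{i}" f] orthonormal_frame[of p] that
    by (simp add: nths_singleton_index orthonormal_at_def)
  then show ?thesis by (simp add: orthonormal_expand[OF T X])
qed

text \<open>The inner product sees only the pairs of frame vectors with increasing indices.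
  Alternation, polarised with the sum of two frame vectors, supplies the other pairs, and
  tensoriality all other arguments.\<close>

lemma vform_inner_definite_2:
  assumes a: "\<alpha> \<in> Omega \<A> 2" and 0: "vinner 2 \<alpha> \<alpha> p = 0" and X: "X \<in> VF" and Y: "Y \<in> VF"
  shows "\<alpha> [X, Y] f p = 0"
proof -
  let ?e = "onframe p"
  have eV: "?e ! i \<in> VF" if "i < CARD('n)" for i
    using orthonormal_frame[of p] that by (auto simp: orthonormal_at_def)
  have T1: "tensorial p (\<lambda>X. \<alpha> [X, Z] f p)" if "Z \<in> VF" for Z
    using Omega_tensorial[OF a, of "[0, Z]" 0 p f] VF_zero that by simp
  have T2: "tensorial p (\<lambda>X. \<alpha> [Z, X] f p)" if "Z \<in> VF" for Z
    using Omega_tensorial[OF a, of "[Z, 0]" 1 p f] VF_zero that by simp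
  have diag: "\<alpha> [Z, Z] = 0" if "Z \<in> VF" for Z
    by (rule Omega_alternating[OF a, of _ 0 1]) (use that in auto)
  have add: "T (V + W) = T V + T W" if "tensorial p T" "V \<in> VF" "W \<in> VF" for T V W
  proof -
    have "T (fscale (\<lambda>_. 1) V + fscale (\<lambda>_. 1) W) = 1 * T V + 1 * T W"
      using that SF_const[of 1] unfolding tensorial_def by blast
    then show ?thesis by simp
  qed
  have less: "\<alpha> [?e ! i, ?e ! j] f p = 0" if "i < j" "j < CARD('n)" for i j
    using vform_inner_zero_imp_frame[OF a 0, of "{i, j}" f] orthonormal_frame[of p] that
    by (simp add: nths_pair_index orthonormal_at_def)
  have ee: "\<alpha> [?e ! i, ?e ! j] f p = 0" if ij: "i < CARD('n)" "j < CARD('n)" for i j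
  proof (cases i j rule: linorder_cases)
    case greater
    have V: "?e ! i \<in> VF" "?e ! j \<in> VF" using ij eV by auto
    define S where "S = ?e ! i + ?e ! j"
    have S: "S \<in> VF" unfolding S_def using V VF_add by blast
    have "0 = \<alpha> [S, S] f p" using diag S by simp
    also have "\<dots> = \<alpha> [?e ! i, S] f p + \<alpha> [?e ! j, S] f p"
      using add[OF T1[OF S] V] by (simp only: S_def)
    also have "\<dots> = \<alpha> [?e ! i, ?e ! j] f p + \<alpha> [?e ! j, ?e ! i] f p"
      using add[OF T2[OF V(1)] V] add[OF T2[OF V(2)] V] diag V by (simp add: S_def[symmetric])
    finally show ?thesis using less[OF greater] ij by simp
  qed (use less ij diag eV in auto)
  have "\<alpha> [?e ! i, Y] f p = 0" if "i < CARD('n)" for i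
    using that by (simp add: orthonormal_expand[OF T2[OF eV[OF that]] Y] ee)
  then show ?thesis by (simp add: orthonormal_expand[OF T1[OF Y] X])
qed

text \<open>On a small coordinate ball the determinant of the metric is continuous and lies between
  half and twice its positive value at \<open>p\<close>, so the volume is comparable to Lebesgue
  measure. Positivity makes nonempty open sets visible to \<mu>; finiteness yields a finite total
  volume in the compact case.\<close>

lemma small_neighbourhood:
  assumes vol: "riemannian_volume \<A> g \<mu>" and V: "open V" "p \<in> V"
  obtains B where "open B" "p \<in> B" "B \<subseteq> V" "0 < emeasure \<mu> B" "emeasure \<mu> B < \<infinity>"
proof -
  obtain c where c: "c \<in> \<A>" "p \<in> fst c" using ex_chart by blast
  then obtain U E h where F: "local_frame c U E h" and p: "p \<in> U" using local_frame_exists by blast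
  have U: "open U" "U \<subseteq> fst c" and E: "E i \<in> VF" for i using F by (auto simp: local_frame_def)
  define d where "d q = det (\<chi> i j. g (E i) (E j) q)" for q
  have cg: "continuous_on UNIV (\<lambda>q. g (E i) (E j) q)" for i j
    using SF_continuous[OF metric_smooth[OF E E]] by simp
  have "continuous_on UNIV d"
    unfolding d_def det_def by (simp add: cg continuous_on_sum continuous_on_prod continuous_on_mult continuous_on_const)
  then have "open {q. d p / 2 < d q}" "open {q. d q < 2 * d p}"
    by (auto intro!: open_Collect_less continuous_intros)
  moreover have dp: "d p > 0" unfolding d_def by (rule det_metric_pos[OF F p])
  moreover define W where "W = U \<inter> V \<inter> {q. d p / 2 < d q} \<inter> {q. d q < 2 * d p}"
  ultimately have W: "open W" "p \<in> W" "W \<subseteq> U" "W \<subseteq> V"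
    using U V p by auto
  have "open (snd c ` W)" using W c U by (intro open_chart_image) auto
  then obtain r where r: "r > 0" "ball (snd c p) r \<subseteq> snd c ` W"
    using W(2) unfolding open_contains_ball by blast
  define B where "B = fst c \<inter> snd c -` ball (snd c p) r"
  have B: "open B" "p \<in> B" using open_chart_preimage[OF c(1)] c r by (auto simp: B_def)
  have BW: "B \<subseteq> W"
  proof
    fix q assume q: "q \<in> B"
    then have "snd c q \<in> snd c ` W" using r by (auto simp: B_def)
    then obtain q' where q': "q' \<in> W" "snd c q = snd c q'" by blast
    have "q = q'"
      using chart_inv_chart[OF c(1), of q] chart_inv_chart[OF c(1), of q'] q q' U W by (auto simp: B_def)
    then show "q \<in> W" using q' by simp
  qed
  have im: "snd c ` B = ball (snd c p) r"
  proof
    show "ball (snd c p) r \<subseteq> snd c ` B"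
    proof
      fix x assume x: "x \<in> ball (snd c p) r"
      then obtain q where "q \<in> W" "x = snd c q" using r by blast
      then show "x \<in> snd c ` B" using x U W by (intro image_eqI[of _ _ q]) (auto simp: B_def)
    qed
  qed (auto simp: B_def)
  let ?f = "\<lambda>x. ennreal (sqrt (det (metric_coeffs \<A> g c (chart_inv c x))))"
  have em: "emeasure \<mu> B = (\<integral>\<^sup>+x. ?f x * indicator (ball (snd c p) r) x \<partial>lborel)"
    using vol c B unfolding riemannian_volume_def im[symmetric] by (auto simp: B_def)
  have f: "?f x = ennreal (sqrt (d (chart_inv c x)))" "d p / 2 < d (chart_inv c x)" "d (chart_inv c x) < 2 * d p"
    if "x \<in> ball (snd c p) r" for x
  proof -
    have "x \<in> snd c ` B" using that by (simp only: im)
    then obtain q where q: "q \<in> B" "x = snd c q" by blast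
    then have "chart_inv c x = q" using c(1) by (simp add: B_def)
    then have "chart_inv c x \<in> W" using BW q by blast
    with W_def show "?f x = ennreal (sqrt (d (chart_inv c x)))" "d p / 2 < d (chart_inv c x)" "d (chart_inv c x) < 2 * d p"
      by (auto simp: metric_coeffs_frame[OF F] d_def)
  qed
  have pos: "emeasure lborel (ball (snd c p) r) > 0"
    using content_ball_pos[OF r(1), of "snd c p"] by (auto simp: measure_def enn2real_positive_iff)
  have "0 < ennreal (sqrt (d p / 2)) * emeasure lborel (ball (snd c p) r)"
    using dp pos by (simp add: ennreal_zero_less_mult_iff)
  also have "\<dots> = (\<integral>\<^sup>+x. ennreal (sqrt (d p / 2)) * indicator (ball (snd c p) r) x \<partial>lborel)"
    by (rule nn_integral_cmult_indicator[symmetric]) simp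
  also have "\<dots> \<le> emeasure \<mu> B"
    unfolding em by (intro nn_integral_mono) (auto simp: indicator_def f(1) intro!: ennreal_leI real_sqrt_le_mono less_imp_le[OF f(2)] less_imp_le[OF f(3)])
  finally have "0 < emeasure \<mu> B" .
  moreover have "emeasure \<mu> B < \<infinity>"
  proof -
    have "emeasure \<mu> B \<le> (\<integral>\<^sup>+x. ennreal (sqrt (2 * d p)) * indicator (ball (snd c p) r) x \<partial>lborel)"
      unfolding em by (intro nn_integral_mono) (auto simp: indicator_def f(1) intro!: ennreal_leI real_sqrt_le_mono less_imp_le[OF f(2)] less_imp_le[OF f(3)])
    also have "\<dots> = ennreal (sqrt (2 * d p)) * emeasure lborel (ball (snd c p) r)"
      by (rule nn_integral_cmult_indicator) simp
    also have "\<dots> < \<infinity>" using emeasure_lborel_ball_finite[of "snd c p" r] by (simp add: ennreal_mult_less_top)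
    finally show ?thesis .
  qed
  ultimately show thesis using B BW W by (intro that[of B]) auto
qed

end

section \<open>The covariant exterior derivative\<close>

lemma length_del_nth: "i < length xs \<Longrightarrow> length (del_nth i xs) = length xs - 1"
  by (simp add: del_nth_def)

lemma nth_del_nth:
  "i < length xs \<Longrightarrow> k < length xs - 1 \<Longrightarrow> del_nth i xs ! k = (if k < i then xs ! k else xs ! Suc k)"
  by (auto simp: del_nth_def nth_append min_def)

lemma set_del_nth_subset: "set (del_nth i xs) \<subseteq> set xs"
  by (auto simp: del_nth_def dest: in_set_takeD in_set_dropD)

lemma del_nth_update_same [simp]: "del_nth m (xs[m := z]) = del_nth m xs"
  by (simp add: del_nth_def)

lemma del_nth_update_less:
  "i < m \<Longrightarrow> m < length xs \<Longrightarrow> del_nth i (xs[m := z]) = (del_nth i xs)[m - 1 := z]"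
  by (rule nth_equalityI) (auto simp: length_del_nth nth_del_nth nth_list_update)

lemma del_nth_update_greater:
  "m < i \<Longrightarrow> i < length xs \<Longrightarrow> del_nth i (xs[m := z]) = (del_nth i xs)[m := z]"
  by (rule nth_equalityI) (auto simp: length_del_nth nth_del_nth nth_list_update)

lemma del_nth_commute:
  "j < m \<Longrightarrow> m < length xs \<Longrightarrow> del_nth j (del_nth m xs) = del_nth (m - 1) (del_nth j xs)"
  by (rule nth_equalityI) (auto simp: length_del_nth nth_del_nth)

lemma alt_sign_apply: "alt_sign i (Y :: 'a \<Rightarrow> 'b \<Rightarrow> real) f p = (-1) ^ i * Y f p"
  by (simp add: alt_sign_def)

lemma alt_sign_zero [simp]: "alt_sign i 0 = 0"
  by (simp add: alt_sign_def)

text \<open>Serves the linearity of \<open>d\<close> in the slot \<open>m\<close>: the bracket terms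
  not involving that slot are linear already, so the defect is supported on pairs that contain
  \<open>m\<close>, one for each other index.\<close>

lemma sum_pairs_one_index:
  fixes D :: "nat \<Rightarrow> nat \<Rightarrow> 'a::comm_monoid_add"
  assumes m: "m < N" and 0: "\<And>i j. i < j \<Longrightarrow> j < N \<Longrightarrow> i \<noteq> m \<Longrightarrow> j \<noteq> m \<Longrightarrow> D i j = 0"
  shows "(\<Sum>j<N. \<Sum>i<j. D i j) = (\<Sum>j\<in>{..<N} - {m}. if m < j then D m j else D j m)"
proof -
  have "(\<Sum>i<j. D i j) = (if m < j then D m j else 0)" if "j < N" "j \<noteq> m" for j
  proof (cases "m < j")
    case True
    then have "(\<Sum>i<j. D i j) = (\<Sum>i\<in>{m}. D i j)"
      by (intro sum.mono_neutral_right) (use 0 that in auto)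
    then show ?thesis using True by simp
  qed (use 0 that in \<open>auto intro!: sum.neutral\<close>)
  then have "(\<Sum>j<N. \<Sum>i<j. D i j) = (\<Sum>i<m. D i m) + (\<Sum>j\<in>{..<N} - {m}. if m < j then D m j else 0)"
    using m by (subst sum.remove[of _ m]) (auto intro!: sum.cong)
  also have "(\<Sum>i<m. D i m) = (\<Sum>j\<in>{..<N} - {m}. if m < j then 0 else D j m)"
    by (rule sum.mono_neutral_cong_left) (use m in auto)
  finally show ?thesis
    by (simp add: sum.distrib[symmetric]) (intro sum.cong, auto)
qed

context manifold
begin

lemma tensorial_add:
  assumes "tensorial p T" "V \<in> VF" "W \<in> VF" shows "T (V + W) = T V + T W"
proof -
  have "T (fscale (\<lambda>_. 1) V + fscale (\<lambda>_. 1) W) = 1 * T V + 1 * T W"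
    using assms SF_const[of 1] unfolding tensorial_def by blast
  then show ?thesis by simp
qed

lemma tensorial_fscale:
  assumes "tensorial p T" "V \<in> VF" "h \<in> SF" shows "T (fscale h V) = h p * T V"
  using tensorial_lincomb[OF assms(1), of "{()}" "\<lambda>_. h" "\<lambda>_. V"] assms by simp

lemma tensorial_uminus:
  assumes "tensorial p T" "V \<in> VF" shows "T (- V) = - T V"
  using tensorial_fscale[OF assms SF_const[of "-1"]] by (simp add: fscale_minus_one)

lemma tensorial_diff:
  assumes "tensorial p T" "V \<in> VF" "W \<in> VF" shows "T (V - W) = T V - T W"
proof -
  have "T (V + - W) = T V + T (- W)"
    using tensorial_add[OF assms(1,2) VF_uminus[OF assms(3)]] .
  then show ?thesis using tensorial_uminus[OF assms(1,3)] by (metis add_uminus_conv_diff)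
qed

section \<open>Sign rules and closure properties of alternating forms\<close>

lemma Omega_tensorial_middle:
  assumes "w \<in> Omega \<A> k" "set as \<subseteq> VF" "set bs \<subseteq> VF" "length as + length bs + 1 = k"
  shows "tensorial p (\<lambda>X. w (as @ X # bs) f p)"
  using Omega_tensorial[of w k "as @ 0 # bs" "length as" p f] assms VF_zero
  by (simp add: list_update_append)

lemma Omega_swap:
  assumes w: "w \<in> Omega \<A> k" and V: "set as \<subseteq> VF" "set bs \<subseteq> VF" "X \<in> VF" "Y \<in> VF"
    and k: "length as + length bs + 2 = k"
  shows "w (as @ X # Y # bs) f p = - w (as @ Y # X # bs) f p"
proof -
  have T1: "tensorial p (\<lambda>X. w (as @ X # Z # bs) f p)" if "Z \<in> VF" for Z
    by (rule Omega_tensorial_middle[OF w]) (use V k that in auto)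
  have T2: "tensorial p (\<lambda>X. w (as @ Z # X # bs) f p)" if "Z \<in> VF" for Z
    using Omega_tensorial_middle[OF w, of "as @ [Z]" bs p f] V k that by simp
  have diag: "w (as @ Z # Z # bs) = 0" if "Z \<in> VF" for Z
    by (rule Omega_alternating[OF w, of _ "length as" "Suc (length as)"])
       (use V k that in \<open>auto simp: nth_append\<close>)
  define S where "S = X + Y"
  have S: "S \<in> VF" unfolding S_def using V VF_add by blast
  have "0 = w (as @ S # S # bs) f p" using diag S by simp
  also have "\<dots> = w (as @ X # S # bs) f p + w (as @ Y # S # bs) f p"
    using tensorial_add[OF T1[OF S] V(3,4)] by (simp only: S_def)
  also have "\<dots> = w (as @ X # Y # bs) f p + w (as @ Y # X # bs) f p"
    using tensorial_add[OF T2[OF V(3)] V(3,4)] tensorial_add[OF T2[OF V(4)] V(3,4)] diag V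
    by (simp add: S_def[symmetric])
  finally show ?thesis by simp
qed

lemma Omega_move:
  assumes "w \<in> Omega \<A> k" "set pre \<subseteq> VF" "set as \<subseteq> VF" "set bs \<subseteq> VF" "Z \<in> VF"
    "length pre + length as + length bs + 1 = k"
  shows "w (pre @ Z # as @ bs) f p = (-1) ^ length as * w (pre @ as @ Z # bs) f p"
  using assms(2-)
proof (induction as arbitrary: pre)
  case (Cons a as)
  have "w (pre @ Z # a # (as @ bs)) f p = - w (pre @ a # Z # (as @ bs)) f p"
    by (rule Omega_swap[OF assms(1)]) (use Cons.prems in auto)
  also have "w ((pre @ [a]) @ Z # as @ bs) f p = (-1) ^ length as * w ((pre @ [a]) @ as @ Z # bs) f p"
    by (rule Cons.IH) (use Cons.prems in auto)
  then have "w (pre @ a # Z # (as @ bs)) f p = (-1) ^ length as * w (pre @ a # as @ Z # bs) f p"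
    by simp
  finally show ?case by simp
qed simp

text \<open>Moving \<open>Z\<close> from the head to slot \<open>m\<close> passes \<open>m\<close>
  entries. It reconciles the two kinds of terms of \<open>d\<close>: brackets are inserted at the
  head, while in the derivative terms the varied argument stays in its own slot.\<close>

lemma Omega_rotate:
  assumes "w \<in> Omega \<A> k" "length W = k" "set W \<subseteq> VF" "Z \<in> VF" "m < k"
  shows "w (Z # del_nth m W) f p = (-1) ^ m * w (W[m := Z]) f p"
proof -
  have "w ([] @ Z # take m W @ drop (Suc m) W) f p =
      (-1) ^ length (take m W) * w ([] @ take m W @ Z # drop (Suc m) W) f p"
    by (rule Omega_move[OF assms(1)]) (use assms in \<open>auto dest: in_set_takeD in_set_dropD\<close>)
  then show ?thesis using assms by (simp add: del_nth_def upd_conv_take_nth_drop)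
qed

lemma Omega_invalid: "w \<in> Omega \<A> k \<Longrightarrow> length Xs \<noteq> k \<or> \<not> set Xs \<subseteq> VF \<Longrightarrow> w Xs = 0"
  unfolding Omega_def by blast

lemma Omega_zero: "0 \<in> Omega \<A> k"
  unfolding Omega_def using VF_zero by (auto simp: fun_eq_iff fscale_def)

lemma Omega_lincomb:
  assumes \<Omega>: "w \<in> Omega \<A> k" "\<beta> \<in> Omega \<A> k" and \<phi>: "\<phi> \<in> SF" "\<psi> \<in> SF"
  shows "(\<lambda>Xs. fscale \<phi> (w Xs) + fscale \<psi> (\<beta> Xs)) \<in> Omega \<A> k"
  unfolding Omega_def
proof (intro CollectI conjI allI ballI impI; (elim conjE)?)
  fix Xs i X Y f h
  assume *: "f \<in> SF" "h \<in> SF" "length Xs = k" "set Xs \<subseteq> VF" "i < k" "X \<in> VF" "Y \<in> VF"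
  show "fscale \<phi> (w (Xs[i := fscale f X + fscale h Y])) + fscale \<psi> (\<beta> (Xs[i := fscale f X + fscale h Y])) =
     fscale f (fscale \<phi> (w (Xs[i := X])) + fscale \<psi> (\<beta> (Xs[i := X]))) +
     fscale h (fscale \<phi> (w (Xs[i := Y])) + fscale \<psi> (\<beta> (Xs[i := Y])))"
    unfolding Omega_linear[OF \<Omega>(1) *(3,4,5,1,2,6,7)] Omega_linear[OF \<Omega>(2) *(3,4,5,1,2,6,7)]
    by (simp add: fscale_def fun_eq_iff algebra_simps)
next
  fix Xs assume "length Xs = k" "set Xs \<subseteq> VF"
  then show "fscale \<phi> (w Xs) + fscale \<psi> (\<beta> Xs) \<in> VF"
    using \<Omega> \<phi> by (intro VF_add VF_fscale Omega_vector_field)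
next
  fix Xs assume "\<not> (length Xs = k \<and> set Xs \<subseteq> VF)"
  then have "w Xs = 0" "\<beta> Xs = 0" using Omega_invalid[OF \<Omega>(1)] Omega_invalid[OF \<Omega>(2)] by blast+
  then show "fscale \<phi> (w Xs) + fscale \<psi> (\<beta> Xs) = 0" by simp
next
  fix Xs i j assume "length Xs = k" "set Xs \<subseteq> VF" "i < j" "j < k" "Xs ! i = Xs ! j"
  then show "fscale \<phi> (w Xs) + fscale \<psi> (\<beta> Xs) = 0"
    using Omega_alternating[OF \<Omega>(1)] Omega_alternating[OF \<Omega>(2)] by simp
qed

lemma Omega_fscale: "w \<in> Omega \<A> k \<Longrightarrow> \<phi> \<in> SF \<Longrightarrow> (\<lambda>Xs. fscale \<phi> (w Xs)) \<in> Omega \<A> k"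
  using Omega_lincomb[of w k w \<phi> "\<lambda>_. 0"] SF_const[of 0] by simp

lemma Omega_add: "w \<in> Omega \<A> k \<Longrightarrow> \<beta> \<in> Omega \<A> k \<Longrightarrow> (\<lambda>Xs. w Xs + \<beta> Xs) \<in> Omega \<A> k"
  using Omega_lincomb[of w k \<beta> "\<lambda>_. 1" "\<lambda>_. 1"] SF_const[of 1] by simp

end

locale torsion_free_manifold = manifold \<A>
  for \<A> :: "('m::{t2_space,second_countable_topology}, 'n::finite) chart set" +
  fixes nabla :: "'m vfield \<Rightarrow> 'm vfield \<Rightarrow> 'm vfield"
  assumes symmetric: "symmetric_connection \<A> nabla"
begin

lemma connection: "connection \<A> nabla"
  using symmetric by (simp add: symmetric_connection_def)

lemma nabla_vector_field: "X \<in> VF \<Longrightarrow> Y \<in> VF \<Longrightarrow> nabla X Y \<in> VF"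
  using connection unfolding connection_def by blast

lemma nabla_linear:
  "f \<in> SF \<Longrightarrow> h \<in> SF \<Longrightarrow> X \<in> VF \<Longrightarrow> Y \<in> VF \<Longrightarrow> Z \<in> VF \<Longrightarrow>
    nabla (fscale f X + fscale h Y) Z = fscale f (nabla X Z) + fscale h (nabla Y Z)"
  using connection unfolding connection_def by blast

lemma nabla_add: "X \<in> VF \<Longrightarrow> Y \<in> VF \<Longrightarrow> Z \<in> VF \<Longrightarrow> nabla X (Y + Z) = nabla X Y + nabla X Z"
  using connection unfolding connection_def by blast

lemma nabla_fscale:
  "f \<in> SF \<Longrightarrow> X \<in> VF \<Longrightarrow> Y \<in> VF \<Longrightarrow> nabla X (fscale f Y) = fscale (X f) Y + fscale f (nabla X Y)"
  using connection unfolding connection_def by blast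

lemma torsion_free: "X \<in> VF \<Longrightarrow> Y \<in> VF \<Longrightarrow> lie_bracket X Y = nabla X Y - nabla Y X"
  using symmetric by (simp add: symmetric_connection_def)

text \<open>Torsion-freeness presents the bracket as a difference of two vector fields, which avoids
  cancelling second derivatives in coordinates.\<close>

lemma lie_bracket_vector_field: "X \<in> VF \<Longrightarrow> Y \<in> VF \<Longrightarrow> lie_bracket X Y \<in> VF"
  by (simp add: torsion_free nabla_vector_field VF_diff)

lemma nabla_zero: "X \<in> VF \<Longrightarrow> nabla X 0 = 0"
  using nabla_add[of X 0 0] VF_zero by simp

lemma nabla_lincomb:
  assumes "f \<in> SF" "h \<in> SF" "X \<in> VF" "Y \<in> VF" "Z \<in> VF"
  shows "nabla Z (fscale f X + fscale h Y) u p =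
    f p * nabla Z X u p + h p * nabla Z Y u p + Z f p * X u p + Z h p * Y u p"
  using assms by (simp add: nabla_add nabla_fscale VF_fscale) (simp add: fscale_def)

text \<open>Both rules are read off from \<open>nabla\<close>: the bracket is a difference of two
  covariant derivatives, one linear over functions in the varied field and the other obeying the
  Leibniz rule.\<close>

lemma lie_bracket_lincomb:
  assumes "f \<in> SF" "h \<in> SF" "X \<in> VF" "Y \<in> VF" "Z \<in> VF"
  shows "lie_bracket (fscale f X + fscale h Y) Z =
      (fscale f (lie_bracket X Z) + fscale h (lie_bracket Y Z)) - (fscale (Z f) X + fscale (Z h) Y)"
    and "lie_bracket Z (fscale f X + fscale h Y) =
      (fscale f (lie_bracket Z X) + fscale h (lie_bracket Z Y)) + (fscale (Z f) X + fscale (Z h) Y)"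
proof -
  have V: "fscale f X + fscale h Y \<in> VF" using assms VF_add VF_fscale by blast
  note n = nabla_lincomb[OF assms]
  have m: "nabla (fscale f X + fscale h Y) Z u p = f p * nabla X Z u p + h p * nabla Y Z u p" for u p
    using nabla_linear[OF assms] by (simp add: fscale_def)
  show "lie_bracket (fscale f X + fscale h Y) Z =
      (fscale f (lie_bracket X Z) + fscale h (lie_bracket Y Z)) - (fscale (Z f) X + fscale (Z h) Y)"
    unfolding torsion_free[OF V assms(5)] torsion_free[OF assms(3,5)] torsion_free[OF assms(4,5)] fun_eq_iff minus_apply n m
    by (simp add: fscale_def algebra_simps)
  show "lie_bracket Z (fscale f X + fscale h Y) =
      (fscale f (lie_bracket Z X) + fscale h (lie_bracket Z Y)) + (fscale (Z f) X + fscale (Z h) Y)"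
    unfolding torsion_free[OF assms(5) V] torsion_free[OF assms(5,3)] torsion_free[OF assms(5,4)] fun_eq_iff minus_apply n m
    by (simp add: fscale_def algebra_simps)
qed

section \<open>The covariant exterior derivative and its tensoriality\<close>

abbreviation "d \<equiv> ext_deriv \<A> nabla"

lemma ext_deriv_apply:
  assumes "set Xs \<subseteq> VF"
  shows "d w Xs f p =
     (\<Sum>i<length Xs. (-1) ^ i * nabla (Xs ! i) (w (del_nth i Xs)) f p) +
     (\<Sum>j<length Xs. \<Sum>i<j. (-1) ^ (i + j) * w (lie_bracket (Xs ! i) (Xs ! j) # del_nth i (del_nth j Xs)) f p)"
  using assms by (simp add: ext_deriv_def sum_fun_apply alt_sign_apply)

lemma alt_sign_vector_field: "X \<in> VF \<Longrightarrow> alt_sign i X \<in> VF"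
  by (simp add: alt_sign_def VF_uminus)

lemma ext_deriv_vector_field:
  assumes "\<And>Ys. set Ys \<subseteq> VF \<Longrightarrow> w Ys \<in> VF" "set Xs \<subseteq> VF"
  shows "d w Xs \<in> VF"
proof -
  have n: "Xs ! i \<in> VF" if "i < length Xs" for i using assms that by auto
  have s: "set (del_nth i Xs) \<subseteq> VF" "set (del_nth i (del_nth j Xs)) \<subseteq> VF" for i j
    using assms(2) set_del_nth_subset[of i Xs] set_del_nth_subset[of j Xs] set_del_nth_subset[of i "del_nth j Xs"] by blast+
  show ?thesis
    unfolding ext_deriv_def using assms(2) s
    by (auto intro!: VF_add VF_sum alt_sign_vector_field nabla_vector_field n assms(1)
        lie_bracket_vector_field dest: subsetD[OF s(1)] subsetD[OF s(2)])
qed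

text \<open>Replacing the argument in slot \<open>m\<close> by a combination with function
  coefficients produces derivatives of the coefficients in two places: from
  \<open>nabla (Xs ! j)\<close> through the Leibniz rule, and from the bracket of
  \<open>Xs ! j\<close> with the new argument. For each \<open>j\<close> other than \<open>m\<close>
  the two contributions cancel.\<close>

lemma ext_deriv_tensorial:
  assumes w: "w \<in> Omega \<A> k" and Xs: "length Xs = Suc k" "set Xs \<subseteq> VF" and m: "m < Suc k"
  shows "tensorial p (\<lambda>X. d w (Xs[m := X]) u p)"
  unfolding tensorial_def
proof (intro ballI)
  fix f h X Y assume fh: "f \<in> SF" "h \<in> SF" and XY: "X \<in> VF" "Y \<in> VF"
  define Z where "Z = fscale f X + fscale h Y"
  have Z: "Z \<in> VF" unfolding Z_def using fh XY VF_add VF_fscale by blast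
  define S where "S W i = (-1) ^ i * nabla ((Xs[m := W]) ! i) (w (del_nth i (Xs[m := W]))) u p" for W i
  define Q where "Q W i j = (-1) ^ (i + j) *
     w (lie_bracket ((Xs[m := W]) ! i) ((Xs[m := W]) ! j) # del_nth i (del_nth j (Xs[m := W]))) u p" for W i j
  have eq: "d w (Xs[m := W]) u p = (\<Sum>i<Suc k. S W i) + (\<Sum>j<Suc k. \<Sum>i<j. Q W i j)" if "W \<in> VF" for W
    using Xs that set_update_subset_insert[of Xs m W]
    by (subst ext_deriv_apply) (auto simp: S_def Q_def)
  \<comment> \<open>\<open>S'\<close> and \<open>Q'\<close> measure how far each derivative term and
    each bracket term is from being linear over functions; the goal is that they add up to
    zero.\<close>
  define S' where "S' i = S Z i - (f p * S X i + h p * S Y i)" for i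
  define Q' where "Q' i j = Q Z i j - (f p * Q X i j + h p * Q Y i j)" for i j
  have n: "Xs ! i \<in> VF" if "i < Suc k" for i using Xs that by auto
  have s: "set (del_nth i Xs) \<subseteq> VF" "set (del_nth i (del_nth j Xs)) \<subseteq> VF" for i j
    using Xs(2) set_del_nth_subset[of i Xs] set_del_nth_subset[of j Xs] set_del_nth_subset[of i "del_nth j Xs"] by blast+
  have l: "length (del_nth i Xs) = k" if "i < Suc k" for i using that Xs by (simp add: length_del_nth)
  have l2: "length (del_nth i (del_nth j Xs)) = k - 1" if "i < j" "j < Suc k" for i j
    using that Xs by (simp add: length_del_nth)
  \<comment> \<open>The position of the former slot \<open>m\<close> in the list from which entry
    \<open>i\<close> has been deleted.\<close>
  define c where "c i = (if i < m then m - 1 else m)" for i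
  have dn: "del_nth i (Xs[m := W]) = (del_nth i Xs)[c i := W]" if "i < Suc k" "i \<noteq> m" for i W
    using that m Xs by (auto simp: c_def del_nth_update_less del_nth_update_greater)
  have ck: "c i < k" if "i < Suc k" "i \<noteq> m" for i using that m by (auto simp: c_def)
  have S'm: "S' m = 0"
    using nabla_linear[OF fh XY, of "w (del_nth m Xs)"] Omega_vector_field[OF w s(1)] m Xs
    by (simp add: S'_def S_def Z_def[symmetric]) (simp add: fscale_def algebra_simps)
  have S'i: "S' i = (-1) ^ i * ((Xs ! i) f p * w ((del_nth i Xs)[c i := X]) u p
      + (Xs ! i) h p * w ((del_nth i Xs)[c i := Y]) u p)" if i: "i < Suc k" "i \<noteq> m" for i
  proof -
    have V: "w ((del_nth i Xs)[c i := W]) \<in> VF" if "W \<in> VF" for W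
      using Omega_vector_field[OF w] set_update_subset_insert[of "del_nth i Xs" "c i" W] s(1)[of i] that by blast
    have e: "w ((del_nth i Xs)[c i := Z]) =
        fscale f (w ((del_nth i Xs)[c i := X])) + fscale h (w ((del_nth i Xs)[c i := Y]))"
      unfolding Z_def by (rule Omega_linear[OF w l[OF i(1)] s(1) ck[OF i] fh XY])
    have e2: "nabla (Xs ! i) (w ((del_nth i Xs)[c i := Z])) u p =
      f p * nabla (Xs ! i) (w ((del_nth i Xs)[c i := X])) u p + h p * nabla (Xs ! i) (w ((del_nth i Xs)[c i := Y])) u p
      + (Xs ! i) f p * w ((del_nth i Xs)[c i := X]) u p + (Xs ! i) h p * w ((del_nth i Xs)[c i := Y]) u p"
      unfolding e by (rule nabla_lincomb[OF fh V[OF XY(1)] V[OF XY(2)] n[OF i(1)]])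
    show ?thesis using i by (simp add: S'_def S_def dn e2 algebra_simps)
  qed
  have Q'0: "Q' i j = 0" if ij: "i < j" "j < Suc k" "i \<noteq> m" "j \<noteq> m" for i j
  proof -
    \<comment> \<open>The position of the former slot \<open>m\<close> after entries
      \<open>j\<close> and \<open>i\<close> are both gone. Prepending the bracket then moves it to
      \<open>Suc c'\<close>.\<close>
    define c' where "c' = (if i < c j then c j - 1 else c j)"
    have c'k: "c' < k - 1" using ij m by (auto simp: c'_def c_def split: if_splits)
    have "del_nth i (del_nth j (Xs[m := W])) = (del_nth i (del_nth j Xs))[c' := W]" for W
    proof -
      have "i \<noteq> c j" using ij by (auto simp: c_def)
      then show ?thesis using ij ck[of j] l[of j]
        by (auto simp: dn c'_def del_nth_update_less del_nth_update_greater)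
    qed
    then have dd: "B # del_nth i (del_nth j (Xs[m := W])) = (B # del_nth i (del_nth j Xs))[Suc c' := W]" for B W
      by simp
    have B: "lie_bracket (Xs ! i) (Xs ! j) \<in> VF" using ij n lie_bracket_vector_field by simp
    have "w ((lie_bracket (Xs ! i) (Xs ! j) # del_nth i (del_nth j Xs))[Suc c' := Z]) =
      fscale f (w ((lie_bracket (Xs ! i) (Xs ! j) # del_nth i (del_nth j Xs))[Suc c' := X])) +
      fscale h (w ((lie_bracket (Xs ! i) (Xs ! j) # del_nth i (del_nth j Xs))[Suc c' := Y]))"
      unfolding Z_def
      by (rule Omega_linear[OF w _ _ _ fh XY]) (use l2[OF ij(1,2)] s B c'k ij in auto)
    then show ?thesis using ij by (simp only: Q'_def Q_def dd) (simp add: fscale_def algebra_simps)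
  qed
  have lin: "T (fscale a V + fscale b W) = a p * T V + b p * T W"
    if "tensorial p T" "a \<in> SF" "b \<in> SF" "V \<in> VF" "W \<in> VF" for T a b V W
    using that unfolding tensorial_def by blast
  have Q'mj: "Q' m j = - ((-1) ^ (m + j)) * ((Xs ! j) f p * w (X # del_nth m (del_nth j Xs)) u p
      + (Xs ! j) h p * w (Y # del_nth m (del_nth j Xs)) u p)" if j: "m < j" "j < Suc k" for j
  proof -
    let ?W = "del_nth m (del_nth j Xs)"
    have T: "tensorial p (\<lambda>V. w (V # ?W) u p)"
      using Omega_tensorial_middle[OF w, of "[]" ?W p u] s l2[OF j] j by simp
    have cj: "del_nth m (del_nth j (Xs[m := W])) = ?W" for W using dn[of j] j by (simp add: c_def)
    have V: "fscale f (lie_bracket X (Xs ! j)) + fscale h (lie_bracket Y (Xs ! j)) \<in> VF"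
      "fscale ((Xs ! j) f) X + fscale ((Xs ! j) h) Y \<in> VF"
      "lie_bracket X (Xs ! j) \<in> VF" "lie_bracket Y (Xs ! j) \<in> VF" "(Xs ! j) f \<in> SF" "(Xs ! j) h \<in> SF"
      by (intro VF_add VF_fscale lie_bracket_vector_field XY n[OF j(2)] fh
          VF_smooth[OF n[OF j(2)] fh(1)] VF_smooth[OF n[OF j(2)] fh(2)])+
    have e: "w (lie_bracket Z (Xs ! j) # ?W) u p =
      f p * w (lie_bracket X (Xs ! j) # ?W) u p + h p * w (lie_bracket Y (Xs ! j) # ?W) u p
      - ((Xs ! j) f p * w (X # ?W) u p + (Xs ! j) h p * w (Y # ?W) u p)"
      unfolding Z_def lie_bracket_lincomb(1)[OF fh XY n[OF j(2)]] tensorial_diff[OF T V(1,2)]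
        lin[OF T fh V(3,4)] lin[OF T V(5,6) XY] by simp
    show ?thesis using j m Xs by (simp add: Q'_def Q_def cj e) (simp add: algebra_simps)
  qed
  have Q'im: "Q' i m = (-1) ^ (i + m) * ((Xs ! i) f p * w (X # del_nth i (del_nth m Xs)) u p
      + (Xs ! i) h p * w (Y # del_nth i (del_nth m Xs)) u p)" if i: "i < m" for i
  proof -
    let ?W = "del_nth i (del_nth m Xs)"
    have T: "tensorial p (\<lambda>V. w (V # ?W) u p)"
      using Omega_tensorial_middle[OF w, of "[]" ?W p u] s l2[OF i m] i m by simp
    have i': "i < Suc k" using i m by simp
    have V: "fscale f (lie_bracket (Xs ! i) X) + fscale h (lie_bracket (Xs ! i) Y) \<in> VF"
      "fscale ((Xs ! i) f) X + fscale ((Xs ! i) h) Y \<in> VF"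
      "lie_bracket (Xs ! i) X \<in> VF" "lie_bracket (Xs ! i) Y \<in> VF" "(Xs ! i) f \<in> SF" "(Xs ! i) h \<in> SF"
      by (intro VF_add VF_fscale lie_bracket_vector_field XY n[OF i'] fh
          VF_smooth[OF n[OF i'] fh(1)] VF_smooth[OF n[OF i'] fh(2)])+
    have e: "w (lie_bracket (Xs ! i) Z # ?W) u p =
      f p * w (lie_bracket (Xs ! i) X # ?W) u p + h p * w (lie_bracket (Xs ! i) Y # ?W) u p
      + ((Xs ! i) f p * w (X # ?W) u p + (Xs ! i) h p * w (Y # ?W) u p)"
      unfolding Z_def lie_bracket_lincomb(2)[OF fh XY n[OF i']] tensorial_add[OF T V(1,2)]
        lin[OF T fh V(3,4)] lin[OF T V(5,6) XY] by simp
    show ?thesis using i m Xs by (simp add: Q'_def Q_def e) (simp add: algebra_simps)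
  qed
  have ring1: "- s * (a * (t * x) + b * (t * y)) = - (s * t) * (a * x + b * y)"
    and ring2: "s * (a * (t * x) + b * (t * y)) = (s * t) * (a * x + b * y)" for s t a b x y :: real
    by (simp_all add: algebra_simps)
  \<comment> \<open>The derivative term \<open>j\<close> carries the sign of \<open>j\<close>. The
    bracket term of the pair \<open>j\<close>, \<open>m\<close> must be rotated back into the varied
    slot to be compared with it, and then carries the opposite sign.\<close>
  have cancel: "S' j + (if m < j then Q' m j else Q' j m) = 0" if j: "j < Suc k" "j \<noteq> m" for j
  proof (cases "m < j")
    case True
    have r: "w (W # del_nth m (del_nth j Xs)) u p = (-1) ^ m * w ((del_nth j Xs)[m := W]) u p" if "W \<in> VF" for W
      by (rule Omega_rotate[OF w l[OF j(1)] s(1) that]) (use True j in simp)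
    define A B where "A = (Xs ! j) f p * w ((del_nth j Xs)[m := X]) u p"
      and "B = (Xs ! j) h p * w ((del_nth j Xs)[m := Y]) u p"
    have "Q' m j = - ((-1) ^ (m + j) * (-1) ^ m) * (A + B)"
      unfolding Q'mj[OF True j(1)] r[OF XY(1)] r[OF XY(2)] A_def B_def by (rule ring1)
    also have "(-1) ^ (m + j) * (-1) ^ m = ((-1) ^ j :: real)"
      by (simp add: power_add flip: power_mult_distrib)
    finally have "Q' m j = - ((-1) ^ j) * (A + B)" .
    moreover have "S' j = (-1) ^ j * (A + B)"
      unfolding S'i[OF j] A_def B_def using True by (simp add: c_def)
    ultimately show ?thesis using True by simp
  next
    case False
    then have jm: "j < m" using j by simp
    \<comment> \<open>After deletion of the earlier entry \<open>j\<close> the varied slot is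
      \<open>m' = m - 1\<close>. The rotation thus has one sign less than in the other case, which
      makes up for the opposite order of the two fields in the bracket.\<close>
    then obtain m' where m': "m = Suc m'" by (cases m) auto
    have r: "w (W # del_nth j (del_nth m Xs)) u p = (-1) ^ m' * w ((del_nth j Xs)[m' := W]) u p" if "W \<in> VF" for W
      using Omega_rotate[OF w l[OF j(1)] s(1) that, of m' u p] jm m Xs m' by (simp add: del_nth_commute)
    define A B where "A = (Xs ! j) f p * w ((del_nth j Xs)[m' := X]) u p"
      and "B = (Xs ! j) h p * w ((del_nth j Xs)[m' := Y]) u p"
    have "Q' j m = ((-1) ^ (j + m) * (-1) ^ m') * (A + B)"
      unfolding Q'im[OF jm] r[OF XY(1)] r[OF XY(2)] A_def B_def by (rule ring2)
    also have "(-1) ^ (j + m) * (-1) ^ m' = (- ((-1) ^ j) :: real)"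
      by (simp add: m' power_add flip: power_mult_distrib)
    finally have "Q' j m = - ((-1) ^ j) * (A + B)" .
    moreover have "S' j = (-1) ^ j * (A + B)"
      unfolding S'i[OF j] A_def B_def using jm m' by (simp add: c_def)
    ultimately show ?thesis using False by simp
  qed
  have "d w (Xs[m := Z]) u p - (f p * d w (Xs[m := X]) u p + h p * d w (Xs[m := Y]) u p) =
     (\<Sum>i<Suc k. S' i) + (\<Sum>j<Suc k. \<Sum>i<j. Q' i j)"
    by (simp only: eq Z XY S'_def Q'_def sum_subtractf sum.distrib flip: sum_distrib_left) (simp only: algebra_simps)
  also have "\<dots> = (\<Sum>j\<in>{..<Suc k} - {m}. S' j + (if m < j then Q' m j else Q' j m))"
  proof -
    have "(\<Sum>i<Suc k. S' i) = (\<Sum>i\<in>{..<Suc k} - {m}. S' i)"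
      by (subst sum.remove[of _ m]) (use m S'm in auto)
    moreover have "(\<Sum>j<Suc k. \<Sum>i<j. Q' i j) = (\<Sum>j\<in>{..<Suc k} - {m}. if m < j then Q' m j else Q' j m)"
      by (rule sum_pairs_one_index[OF m Q'0])
    ultimately show ?thesis by (simp only: sum.distrib)
  qed
  also have "\<dots> = 0" by (rule sum.neutral) (use cancel in auto)
  finally show "d w (Xs[m := fscale f X + fscale h Y]) u p = f p * d w (Xs[m := X]) u p + h p * d w (Xs[m := Y]) u p"
    by (simp only: Z_def)
qed

lemma ext_deriv_1: "X \<in> VF \<Longrightarrow> Y \<in> VF \<Longrightarrow>
    d w [X, Y] = nabla X (w [Y]) - nabla Y (w [X]) - w [lie_bracket X Y]"
  by (simp add: ext_deriv_def numeral_2_eq_2 lessThan_Suc del_nth_def alt_sign_def)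

lemma ext_deriv_zero: "d 0 = 0"
proof
  fix Xs show "d 0 Xs = 0 Xs"
  proof (cases "set Xs \<subseteq> VF")
    case True
    then have "Xs ! i \<in> VF" if "i < length Xs" for i using that by auto
    then show ?thesis by (simp add: ext_deriv_def nabla_zero)
  qed (simp add: ext_deriv_def)
qed

text \<open>Full membership in \<open>Omega\<close> is required here because \<open>d w\<close>
  serves as a direction in which the degree-two component is varied.\<close>

lemma ext_deriv_Omega_1:
  assumes w: "w \<in> Omega \<A> 1" shows "d w \<in> Omega \<A> 2"
  unfolding Omega_def
proof (intro CollectI conjI allI ballI impI; (elim conjE)?)
  fix Xs f h X Y and i :: nat
  assume *: "f \<in> SF" "h \<in> SF" "length Xs = 2" "set Xs \<subseteq> VF" "i < 2" "X \<in> VF" "Y \<in> VF"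
  have "d w (Xs[i := fscale f X + fscale h Y]) u p = f p * d w (Xs[i := X]) u p + h p * d w (Xs[i := Y]) u p" for u p
    using ext_deriv_tensorial[OF w, of Xs i p u] * unfolding tensorial_def by simp
  then show "d w (Xs[i := fscale f X + fscale h Y]) = fscale f (d w (Xs[i := X])) + fscale h (d w (Xs[i := Y]))"
    by (simp add: fscale_def fun_eq_iff)
next
  fix Xs assume "length Xs = 2" "set Xs \<subseteq> VF"
  then show "d w Xs \<in> VF" using ext_deriv_vector_field Omega_vector_field[OF w] by blast
next
  fix Xs assume i: "\<not> (length Xs = 2 \<and> set Xs \<subseteq> VF)"
  show "d w Xs = 0"
  proof (cases "set Xs \<subseteq> VF")
    case True
    then have l: "length Xs \<noteq> 2" using i by simp
    have n: "Xs ! i \<in> VF" if "i < length Xs" for i using True that by auto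
    have "w (del_nth i Xs) = 0" if "i < length Xs" for i
      by (rule Omega_invalid[OF w]) (use that l in \<open>auto simp: length_del_nth\<close>)
    moreover have "w (B # del_nth i (del_nth j Xs)) = 0" if "i < j" "j < length Xs" for B i j
      by (rule Omega_invalid[OF w]) (use that l in \<open>auto simp: length_del_nth\<close>)
    ultimately show ?thesis
      using n by (simp add: ext_deriv_def nabla_zero)
  qed (simp add: ext_deriv_def)
next
  fix Xs i j assume "length Xs = 2" "set Xs \<subseteq> VF" "i < j" "j < 2" "Xs ! i = Xs ! j"
  moreover from this have "i = 0" "j = 1" by auto
  ultimately obtain X where X: "Xs = [X, X]" "X \<in> VF"
    by (auto simp: length_Suc_conv numeral_2_eq_2)
  have "lie_bracket X X = 0" by (simp add: lie_bracket_def fun_eq_iff)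
  moreover have "w [0] f p = 0" for f p
    using tensorial_zero[OF Omega_tensorial_middle[OF w, of "[]" "[]" p f]] by simp
  ultimately have "d w Xs f p = 0" for f p using X by (simp add: ext_deriv_1)
  then show "d w Xs = 0" by (simp add: fun_eq_iff)
qed

end

section \<open>The inner product and compactness\<close>

locale variational_manifold = riemannian_manifold \<A> g + torsion_free_manifold \<A> nabla
  for \<A> :: "('m::{t2_space,second_countable_topology}, 'n::finite) chart set"
    and g :: "'m vfield \<Rightarrow> 'm vfield \<Rightarrow> 'm \<Rightarrow> real"
    and nabla :: "'m vfield \<Rightarrow> 'm vfield \<Rightarrow> 'm vfield" +
  fixes \<mu> :: "'m measure" and \<delta> :: "'m vform \<Rightarrow> 'm vform"
  assumes volume: "riemannian_volume \<A> g \<mu>"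
    and integrals: "integrals_defined \<A> g \<mu>"
    and adjoint: "formal_adjoint \<A> g \<mu> nabla \<delta>"
begin

abbreviation "L2 \<equiv> L2_degree \<A> g \<mu>"

lemma sets_volume: "sets \<mu> = sets borel"
  using volume by (simp add: riemannian_volume_def)

lemma space_volume: "space \<mu> = UNIV"
  using sets_eq_imp_space_eq[OF sets_volume] by simp

lemma open_in_sets: "open N \<Longrightarrow> N \<in> sets \<mu>"
  by (simp add: sets_volume)

lemma open_AE_empty:
  assumes N: "open N" and AE: "AE p in \<mu>. p \<notin> N"
  shows "N = {}"
proof (rule ccontr)
  assume "N \<noteq> {}"
  then obtain p where "p \<in> N" by blast
  then obtain B where B: "B \<subseteq> N" "0 < emeasure \<mu> B"
    using small_neighbourhood[OF volume N] by blast
  have "N \<in> null_sets \<mu>" using AE_iff_null_sets[OF open_in_sets[OF N]] AE by blast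
  then have "emeasure \<mu> N = 0" by (rule null_setsD1)
  moreover have "emeasure \<mu> B \<le> emeasure \<mu> N" using B N open_in_sets by (intro emeasure_mono) auto
  ultimately show False using B by simp
qed

lemma integrable_inner: "\<alpha> \<in> Omega \<A> k \<Longrightarrow> \<beta> \<in> Omega \<A> k \<Longrightarrow> integrable \<mu> (vinner k \<alpha> \<beta>)"
  using integrals by (simp add: integrals_defined_def)

text \<open>The square norm is nonnegative with integral zero, hence zero almost everywhere. Each
  coefficient of the form is continuous and nonempty open sets are not null, so the form vanishes
  everywhere.\<close>

lemma L2_definite:
  assumes a: "\<alpha> \<in> Omega \<A> 2" and 0: "L2 2 \<alpha> \<alpha> = 0"
  shows "\<alpha> = 0"
proof
  have AE: "AE p in \<mu>. vinner 2 \<alpha> \<alpha> p = 0"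
    using 0 integral_nonneg_eq_0_iff_AE[OF integrable_inner[OF a a]] vform_inner_nonneg[OF a]
    by (simp add: L2_degree_def)
  fix Xs
  show "\<alpha> Xs = 0 Xs"
  proof (cases "length Xs = 2 \<and> set Xs \<subseteq> VF")
    case True
    then obtain X Y where Xs: "Xs = [X, Y]" "X \<in> VF" "Y \<in> VF"
      by (auto simp: length_Suc_conv numeral_2_eq_2)
    have V: "\<alpha> Xs \<in> VF" using Omega_vector_field[OF a] True by blast
    have "\<alpha> Xs f p = 0" if f: "f \<in> SF" for f p
    proof -
      have "continuous_on UNIV (\<alpha> Xs f)"
        by (rule SF_continuous[OF VF_smooth[OF V f]])
      then have "open {p. \<alpha> Xs f p \<noteq> 0}"
        by (intro open_Collect_neq continuous_on_const) 
      moreover have "AE p in \<mu>. p \<notin> {p. \<alpha> Xs f p \<noteq> 0}"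
        using AE by eventually_elim (use vform_inner_definite_2[OF a _ Xs(2,3)] Xs in auto)
      ultimately have "{p. \<alpha> Xs f p \<noteq> 0} = {}" by (rule open_AE_empty)
      then show ?thesis by blast
    qed
    then have "\<alpha> Xs = 0" by (intro VF_eqI[OF V VF_zero]) auto
    then show ?thesis by simp
  next
    case False
    then have "\<alpha> Xs = 0" using Omega_invalid[OF a] by blast
    then show ?thesis by simp
  qed
qed

lemma vform_inner_fscale:
  assumes a: "\<alpha> \<in> Omega \<A> k" and \<phi>: "\<phi> \<in> SF"
  shows "vinner k (\<lambda>Xs. fscale \<phi> (\<alpha> Xs)) (\<lambda>Xs. fscale \<phi> (\<alpha> Xs)) p =
    \<phi> p * \<phi> p * vinner k \<alpha> \<alpha> p"
proof -
  note V = Omega_vector_field[OF a set_orthonormal_nths]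
  note \<phi>a = Omega_fscale[OF a \<phi>]
  show ?thesis
    unfolding vform_inner_Omega[OF \<phi>a \<phi>a] vform_inner_Omega[OF a a] sum_distrib_left
    by (intro sum.cong refl)
       (simp add: tensorial_fscale[OF tensorial_metric_left] tensorial_fscale[OF tensorial_metric_right]
          V \<phi> VF_fscale)
qed

lemma vform_inner_add_right:
  assumes "\<alpha> \<in> Omega \<A> k" "\<beta> \<in> Omega \<A> k" "\<eta> \<in> Omega \<A> k"
  shows "vinner k \<alpha> (\<lambda>Xs. \<beta> Xs + fscale (\<lambda>_. t) (\<eta> Xs)) p =
    vinner k \<alpha> \<beta> p + t * vinner k \<alpha> \<eta> p"
proof -
  let ?e = "nths (onframe p)"
  note V = Omega_vector_field[OF _ set_orthonormal_nths]
  note c = SF_const[of t]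
  have "g (\<alpha> (?e K)) (\<beta> (?e K) + fscale (\<lambda>_. t) (\<eta> (?e K))) p =
    g (\<alpha> (?e K)) (\<beta> (?e K)) p + t * g (\<alpha> (?e K)) (\<eta> (?e K)) p" for K
    using tensorial_add[OF tensorial_metric_right[OF V[OF assms(1)]] V[OF assms(2)] VF_fscale[OF V[OF assms(3)] c]]
      tensorial_fscale[OF tensorial_metric_right[OF V[OF assms(1)]] V[OF assms(3)] c] by metis
  then show ?thesis
    unfolding vform_inner_Omega[OF assms(1) Omega_add[OF assms(2) Omega_fscale[OF assms(3) c]]]
      vform_inner_Omega[OF assms(1,2)] vform_inner_Omega[OF assms(1,3)] sum_distrib_left
    by (simp only: sum.distrib)
qed

lemma L2_add_right:
  assumes "\<alpha> \<in> Omega \<A> k" "\<beta> \<in> Omega \<A> k" "\<eta> \<in> Omega \<A> k"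
  shows "L2 k \<alpha> (\<lambda>Xs. \<beta> Xs + fscale (\<lambda>_. t) (\<eta> Xs)) =
    L2 k \<alpha> \<beta> + t * L2 k \<alpha> \<eta>"
  unfolding L2_degree_def vform_inner_add_right[OF assms]
  using integrable_inner[OF assms(1,2)] integrable_inner[OF assms(1,3)] by simp

lemma
  assumes "\<And>Xs. length Xs = k \<Longrightarrow> set Xs \<subseteq> VF \<Longrightarrow> \<alpha> Xs \<in> VF"
  shows vform_inner_zero_right: "vinner k \<alpha> 0 p = 0"
    and vform_inner_zero_left: "vinner k 0 \<alpha> p = 0"
proof -
  have "g (\<alpha> (nths (onframe p) K)) 0 p = 0" "g 0 (\<alpha> (nths (onframe p) K)) p = 0"
    if "K \<subseteq> {..<CARD('n)} \<and> card K = k" for K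
    using that
    by (auto intro!: tensorial_zero[OF tensorial_metric_right] tensorial_zero[OF tensorial_metric_left] assms
        simp: length_orthonormal_nths set_orthonormal_nths[THEN subsetD])
  then show "vinner k \<alpha> 0 p = 0" "vinner k 0 \<alpha> p = 0"
    by (subst vform_inner_orthonormal; auto intro!: sum.neutral VF_zero assms)+
qed

text \<open>If the norm of \<open>A\<close> vanished at \<open>p\<close>, then
  \<open>A [A [X]] = - X\<close> would make every vector field zero at \<open>p\<close>, which a
  coordinate frame excludes. So \<open>A\<close> is a nowhere vanishing form whose square norm can
  be rescaled at will.\<close>

lemma almost_complex_inner_pos:
  assumes A: "A \<in> AC \<A>" shows "0 < vinner 1 A A p"
proof (rule ccontr)
  have a: "A \<in> Omega \<A> 1" and sq: "A [A [X]] = - X" if "X \<in> VF" for X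
    using A that by (auto simp: AC_def)
  have a: "A \<in> Omega \<A> 1" using A by (simp add: AC_def)
  assume "\<not> 0 < vinner 1 A A p"
  then have 0: "vinner 1 A A p = 0" using vform_inner_nonneg[OF a, of p] by simp
  have z: "X f p = 0" if X: "X \<in> VF" for X f
  proof -
    have "A [X] \<in> VF" using Omega_vector_field[OF a, of "[X]"] X by simp
    from vform_inner_definite_1[OF a 0 this, of f] show ?thesis by (simp add: sq[OF X])
  qed
  obtain c where c: "c \<in> \<A>" "p \<in> fst c" using ex_chart by blast
  then obtain U E h where F: "local_frame c U E h" "p \<in> U" using local_frame_exists by blast
  then have "E i \<in> VF" for i by (auto simp: local_frame_def)
  from z[OF this[of undefined], of "h undefined"] show False
    using local_frame_delta[OF F, of undefined undefined] by simp
qed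

lemma compact_neighbourhood:
  fixes p :: 'm
  obtains W K where "open W" "p \<in> W" "W \<subseteq> K" "compact K"
proof -
  obtain c where c: "c \<in> \<A>" "p \<in> fst c" using ex_chart by blast
  obtain r where r: "r > 0" "cball (snd c p) r \<subseteq> snd c ` fst c"
    using open_img[OF c(1)] c unfolding open_contains_cball by blast
  show thesis
  proof
    show "open (fst c \<inter> snd c -` ball (snd c p) r)" by (rule open_chart_preimage[OF c(1)]) simp
    show "compact (chart_inv c ` cball (snd c p) r)"
      by (rule compact_continuous_image[OF continuous_on_subset[OF continuous_chart_inv[OF c(1)] r(2)] compact_cball])
    show "fst c \<inter> snd c -` ball (snd c p) r \<subseteq> chart_inv c ` cball (snd c p) r"
    proof
      fix q assume "q \<in> fst c \<inter> snd c -` ball (snd c p) r"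
      then show "q \<in> chart_inv c ` cball (snd c p) r"
        using c(1) by (intro image_eqI[of _ _ "snd c q"]) auto
    qed
  qed (use c r in auto)
qed

text \<open>On a non-compact manifold a sum of bumps escaping to infinity, with large coefficients, rescales
  a nowhere vanishing form to one whose square norm is not integrable.\<close>

lemma compact_manifold:
  assumes A: "A \<in> AC \<A>" shows "compact (UNIV :: 'm set)"
proof (rule ccontr)
  assume nc: "\<not> compact (UNIV :: 'm set)"
  have a: "A \<in> Omega \<A> 1" using A by (simp add: AC_def)
  define \<G> where "\<G> = {W :: 'm set. open W \<and> (\<exists>K. compact K \<and> W \<subseteq> K)}"
  have \<G>: "\<And>S. S \<in> \<G> \<Longrightarrow> open S" by (simp add: \<G>_def)
  obtain \<F> where \<F>: "\<F> \<subseteq> \<G>" "countable \<F>" "\<Union>\<F> = \<Union>\<G>"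
    by (rule Lindelof[OF \<G>]) (simp, rule that)
  have cov: "\<Union>\<F> = UNIV"
  proof -
    have "p \<in> \<Union>\<F>" for p
    proof -
      obtain W K where "open W" "p \<in> W" "W \<subseteq> K" "compact K" by (rule compact_neighbourhood)
      then have "W \<in> \<G>" by (auto simp: \<G>_def)
      with \<open>p \<in> W\<close> show ?thesis unfolding \<F>(3) by blast
    qed
    then show ?thesis by blast
  qed
  then have ne: "\<F> \<noteq> {}" by auto
  define B where "B = from_nat_into \<F>"
  have BF: "B n \<in> \<F>" for n unfolding B_def by (rule from_nat_into[OF ne])
  have Bcov: "\<exists>n. p \<in> B n" for p
  proof -
    have "p \<in> \<Union>\<F>" by (simp add: cov)
    then obtain W where "W \<in> \<F>" "p \<in> W" by (rule UnionE)
    moreover obtain n where "from_nat_into \<F> n = W"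
      using from_nat_into_surj[OF \<F>(2) \<open>W \<in> \<F>\<close>] by blast
    ultimately show ?thesis unfolding B_def by blast
  qed
  have "\<forall>n. \<exists>K. compact K \<and> B n \<subseteq> K" using BF \<F>(1) unfolding \<G>_def by blast
  then obtain K where K: "\<And>n. compact (K n)" "\<And>n. B n \<subseteq> K n" by metis
  have Bo: "open (B n)" for n using BF \<F>(1) \<G> by blast
  \<comment> \<open>The bump \<open>\<phi> n\<close> will vanish off \<open>V n\<close>, hence on
    \<open>B m\<close> for all \<open>m \<le> n\<close>. On each \<open>B m\<close> only finitely
    many bumps remain, so their sum is smooth.\<close>
  define V where "V n = - (\<Union>i\<le>n. K i)" for n
  have Vo: "open (V n)" for n
    unfolding V_def using K(1) by (intro open_Compl compact_imp_closed compact_UN) auto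
  have Vne: "V n \<noteq> {}" for n
  proof
    assume "V n = {}"
    then have "(\<Union>i\<le>n. K i) = UNIV" by (auto simp: V_def)
    moreover have "compact (\<Union>i\<le>n. K i)" using K(1) by (intro compact_UN) auto
    ultimately show False using nc by simp
  qed
  have "\<exists>\<phi> W. \<phi> \<in> SF \<and> open W \<and> W \<noteq> {} \<and> W \<subseteq> V n \<and> (\<forall>q\<in>W. \<phi> q = 1) \<and> (\<forall>q. q \<notin> V n \<longrightarrow> \<phi> q = 0) \<and> (\<forall>q. 0 \<le> \<phi> q)" for n
  proof -
    obtain p where p: "p \<in> V n" using Vne by blast
    show ?thesis by (rule bump_function[OF Vo p]) blast
  qed
  then obtain \<phi> W where \<phi>: "\<And>n. \<phi> n \<in> SF" "\<And>n q. q \<in> W n \<Longrightarrow> \<phi> n q = 1" "\<And>n q. q \<notin> V n \<Longrightarrow> \<phi> n q = 0" "\<And>n q. 0 \<le> \<phi> n q"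
    and W: "\<And>n. open (W n)" "\<And>n. W n \<noteq> {}" "\<And>n. W n \<subseteq> V n"
    by metis
  define I where "I = vinner 1 A A"
  have Ii: "integrable \<mu> I" unfolding I_def by (rule integrable_inner[OF a a])
  have Ipos: "0 < I p" for p unfolding I_def by (rule almost_complex_inner_pos[OF A])
  define s where "s n = (LINT q|\<mu>. indicator (W n) q * I q)" for n
  have si: "integrable \<mu> (\<lambda>q. indicator (W n) q * I q)" for n
    by (rule integrable_real_mult_indicator[OF open_in_sets[OF W(1)] Ii, THEN Bochner_Integration.integrable_cong[THEN iffD1, rotated 2]])
       (auto simp: mult.commute)
  have spos: "0 < s n" for n
  proof (rule ccontr)
    assume "\<not> 0 < s n"
    moreover have "0 \<le> s n" unfolding s_def using Ipos by (intro integral_nonneg_AE) (auto simp: less_imp_le)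
    ultimately have "s n = 0" by simp
    then have "AE q in \<mu>. indicator (W n) q * I q = 0"
      using integral_nonneg_eq_0_iff_AE[OF si[of n]] Ipos by (simp add: s_def less_imp_le)
    then have "AE q in \<mu>. q \<notin> W n"
      by eventually_elim (use Ipos in \<open>auto simp: less_le indicator_def split: if_splits\<close>)
    then show False using open_AE_empty[OF W(1)] W(2) by blast
  qed
  \<comment> \<open>Chosen so that \<open>C n * C n * s n = n\<close>: since \<open>f\<close> is at
    least \<open>C n\<close> on \<open>W n\<close>, the square norm of the rescaled form has
    integral at least \<open>n\<close>, for every \<open>n\<close>.\<close>
  define C where "C n = sqrt (real n / s n)" for n
  have C0: "0 \<le> C n" for n using spos[of n] by (simp add: C_def)
  have Cs: "C n * C n * s n = n" for n using spos[of n] by (simp add: C_def)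
  define f where "f q = (\<Sum>n. C n * \<phi> n q)" for q
  have \<phi>B: "\<phi> n q = 0" if "q \<in> B m" "m \<le> n" for n m q
    using that K(2) by (intro \<phi>(3)) (auto simp: V_def)
  have fB: "f q = (\<Sum>n<m. C n * \<phi> n q)" if "q \<in> B m" for q m
    unfolding f_def using that by (intro suminf_finite) (auto simp: \<phi>B)
  have f: "f \<in> SF"
  proof (rule SF_local)
    fix p
    obtain m where m: "p \<in> B m" using Bcov by blast
    have "(\<lambda>q. \<Sum>n<m. C n * \<phi> n q) \<in> SF"
      by (intro SF_sum SF_mult SF_const \<phi>(1))
    then show "\<exists>U f'. open U \<and> p \<in> U \<and> f' \<in> SF \<and> (\<forall>q\<in>U. f q = f' q)"
      using m Bo fB by (intro exI[of _ "B m"] exI[of _ "\<lambda>q. \<Sum>n<m. C n * \<phi> n q"]) auto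
  qed
  have fW: "C n \<le> f q" if q: "q \<in> W n" for n q
  proof -
    obtain m where m: "q \<in> B m" using Bcov by blast
    have "n < m"
      using \<phi>B[OF m, of n] \<phi>(2)[OF q] by (cases "n < m") auto
    then have "C n * \<phi> n q \<le> (\<Sum>n<m. C n * \<phi> n q)"
      by (intro member_le_sum) (use C0 \<phi>(4) in auto)
    then show ?thesis using fB[OF m] \<phi>(2)[OF q] by simp
  qed
  have "vinner 1 (\<lambda>Xs. fscale f (A Xs)) (\<lambda>Xs. fscale f (A Xs)) = (\<lambda>q. f q * f q * I q)"
    unfolding I_def by (rule ext) (rule vform_inner_fscale[OF a f])
  then have J: "integrable \<mu> (\<lambda>q. f q * f q * I q)"
    using integrable_inner[OF Omega_fscale[OF a f] Omega_fscale[OF a f]] by simp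
  have "real n \<le> (LINT q|\<mu>. f q * f q * I q)" for n
  proof -
    have "real n = (LINT q|\<mu>. (C n * C n) * (indicator (W n) q * I q))"
      using Cs[of n] by (simp add: s_def)
    also have "\<dots> \<le> (LINT q|\<mu>. f q * f q * I q)"
    proof (rule integral_mono)
      show "integrable \<mu> (\<lambda>q. (C n * C n) * (indicator (W n) q * I q))" using si by simp
      show "(C n * C n) * (indicator (W n) q * I q) \<le> f q * f q * I q" for q
      proof (cases "q \<in> W n")
        case True
        then have "C n * C n \<le> f q * f q" using fW C0 by (intro mult_mono) (auto intro: order_trans)
        then show ?thesis using True Ipos[of q] by (simp add: mult_right_mono)
      next
        case False
        then show ?thesis using Ipos[of q] by simp
      qed
    qed (rule J)
    finally show ?thesis .
  qed
  then show False using reals_Archimedean2[of "LINT q|\<mu>. f q * f q * I q"] by (meson not_less)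
qed

lemma finite_volume:
  assumes "compact (UNIV :: 'm set)" shows "emeasure \<mu> UNIV < \<infinity>"
proof -
  define \<B> where "\<B> = {B. open B \<and> emeasure \<mu> B < \<infinity>}"
  have cov: "UNIV \<subseteq> \<Union>\<B>"
  proof
    fix p :: 'm
    obtain B where "open B" "p \<in> B" "emeasure \<mu> B < \<infinity>" by (rule small_neighbourhood[OF volume open_UNIV UNIV_I[of p]])
    then show "p \<in> \<Union>\<B>" by (auto simp: \<B>_def)
  qed
  have op: "\<And>B. B \<in> \<B> \<Longrightarrow> open B" by (simp add: \<B>_def)
  obtain \<D> where \<D>: "\<D> \<subseteq> \<B>" "finite \<D>" "UNIV \<subseteq> \<Union>\<D>"
    by (rule compactE[OF assms cov op]) (simp, rule that)
  have "emeasure \<mu> (\<Union>B\<in>\<D>. B) \<le> (\<Sum>B\<in>\<D>. emeasure \<mu> B)"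
    by (rule emeasure_subadditive_finite) (use \<D> open_in_sets in \<open>auto simp: \<B>_def\<close>)
  also have "\<dots> < \<infinity>" using \<D> by (auto simp: \<B>_def ennreal_sum_less_top)
  also have "(\<Union>B\<in>\<D>. B) = UNIV" using \<D> by auto
  finally show ?thesis .
qed

end

section \<open>Uniform bounds on the inner product\<close>

context manifold
begin

text \<open>The part of membership in \<open>Omega\<close> that the estimates use: values in
  \<open>VF\<close> and tensoriality in each slot at one point. It is available for
  \<open>d w\<close> in every degree, where alternation is established for \<open>w\<close> of
  degree one only.\<close>

definition tensorial_form :: "nat \<Rightarrow> 'm \<Rightarrow> 'm vform \<Rightarrow> bool" where
  "tensorial_form k p \<alpha> \<longleftrightarrow>
     (\<forall>Xs. length Xs = k \<longrightarrow> set Xs \<subseteq> VF \<longrightarrow> \<alpha> Xs \<in> VF) \<and>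
     (\<forall>Xs m f. length Xs = k \<longrightarrow> set Xs \<subseteq> VF \<longrightarrow> m < k \<longrightarrow> tensorial p (\<lambda>X. \<alpha> (Xs[m := X]) f p))"

lemma Omega_tensorial_form: "\<alpha> \<in> Omega \<A> k \<Longrightarrow> tensorial_form k p \<alpha>"
  by (simp add: tensorial_form_def Omega_vector_field Omega_tensorial)

text \<open>The first \<open>l\<close> arguments are arbitrary with components bounded by
  \<open>C\<close>, the others belong to the frame. Expanding one argument in the frame costs a
  factor \<open>CARD('n) * C\<close>.\<close>

lemma tensorial_form_bound:
  assumes F: "local_frame c U E h" and p: "p \<in> U" and \<alpha>: "tensorial_form k p \<alpha>" and C: "0 \<le> C"
    and a: "\<And>Es. length Es = k \<Longrightarrow> set Es \<subseteq> range E \<Longrightarrow> \<bar>\<alpha> Es f p\<bar> \<le> a"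
    and "l \<le> k" "length Xs = k" "set Xs \<subseteq> VF"
    and "\<And>m i. m < l \<Longrightarrow> \<bar>(Xs ! m) (h i) p\<bar> \<le> C"
    and "\<And>m. l \<le> m \<Longrightarrow> m < k \<Longrightarrow> Xs ! m \<in> range E"
  shows "\<bar>\<alpha> Xs f p\<bar> \<le> (real CARD('n) * C) ^ l * a"
  using assms(6-)
proof (induction l arbitrary: Xs)
  case 0
  then have "set Xs \<subseteq> range E" by (auto simp: in_set_conv_nth)
  then show ?case using a 0 by simp
next
  case (Suc l)
  have E: "E i \<in> VF" for i using F by (auto simp: local_frame_def)
  have T: "tensorial p (\<lambda>X. \<alpha> (Xs[l := X]) f p)"
    using \<alpha> Suc.prems unfolding tensorial_form_def by simp
  have Xl: "Xs ! l \<in> VF" using Suc.prems by auto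
  have IH: "\<bar>\<alpha> (Xs[l := E i]) f p\<bar> \<le> (real CARD('n) * C) ^ l * a" for i
  proof (rule Suc.IH)
    show "set (Xs[l := E i]) \<subseteq> VF"
      using set_update_subset_insert[of Xs l "E i"] Suc.prems(3) E by blast
    show "\<bar>(Xs[l := E i] ! m) (h j) p\<bar> \<le> C" if "m < l" for m j using Suc.prems(4)[of m j] that by simp
    show "Xs[l := E i] ! m \<in> range E" if "l \<le> m" "m < k" for m
      using Suc.prems(1,2,5) that by (cases "m = l") auto
  qed (use Suc.prems in auto)
  have "\<alpha> Xs f p = (\<Sum>i\<in>UNIV. (Xs ! l) (h i) p * \<alpha> (Xs[l := E i]) f p)"
    using tensorial_expand[OF T F p Xl] by simp
  also have "\<bar>\<dots>\<bar> \<le> (\<Sum>i\<in>(UNIV :: 'n set). C * ((real CARD('n) * C) ^ l * a))"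
    by (rule order_trans[OF sum_abs]) (intro sum_mono, unfold abs_mult, intro mult_mono IH Suc.prems(4), use C in auto)
  finally show ?case by (simp add: mult.assoc mult.left_commute)
qed

end

context riemannian_manifold
begin

text \<open>The quadratic form \<open>q p0\<close> has a positive minimum \<open>m\<close> on the
  unit sphere. Where the coefficients of \<open>g\<close> differ from those at \<open>p0\<close> by
  less than \<open>m / 2\<close> in total, the form is still at least \<open>m / 2\<close> times the
  squared Euclidean norm, so a unit vector for \<open>g\<close> has components at most
  \<open>sqrt (2 / m)\<close>.\<close>

lemma metric_frame_bound:
  assumes F: "local_frame c U E h" and p0: "p0 \<in> U"
  obtains W C G where "open W" "p0 \<in> W" "W \<subseteq> U" "0 \<le> C" "0 \<le> G"
    "\<And>p i j. p \<in> W \<Longrightarrow> \<bar>g (E i) (E j) p\<bar> \<le> G"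
    "\<And>p X i. p \<in> W \<Longrightarrow> X \<in> VF \<Longrightarrow> g X X p = 1 \<Longrightarrow> \<bar>X (h i) p\<bar> \<le> C"
proof -
  have E: "E i \<in> VF" and h: "h i \<in> SF" and U: "open U" for i using F by (auto simp: local_frame_def)
  define q where "q p w = (\<Sum>i\<in>UNIV. \<Sum>j\<in>UNIV. w $ i * w $ j * g (E i) (E j) p)" for p and w :: "real ^ 'n"
  have scale: "q p (r *\<^sub>R w) = r * r * q p w" for p r w
    by (simp add: q_def sum_distrib_left algebra_simps)
  have pos: "0 < q p0 w" if "w \<noteq> 0" for w
  proof -
    define W where "W = (\<Sum>i\<in>UNIV. fscale (\<lambda>_. w $ i) (E i))"
    have WV: "W \<in> VF" unfolding W_def by (intro VF_sum VF_fscale E SF_const)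
    have Wh: "W (h i) p0 = w $ i" for i
    proof -
      have "W (h i) p0 = (\<Sum>j\<in>UNIV. w $ j * E j (h i) p0)"
        unfolding W_def by (rule tensorial_lincomb[OF tensorial_apply[OF h]]) (auto intro: E SF_const)
      then show ?thesis by (simp add: local_frame_delta[OF F p0] if_distrib cong: if_cong)
    qed
    obtain i where "w $ i \<noteq> 0" using \<open>w \<noteq> 0\<close> by (auto simp: vec_eq_iff)
    then have "g W W p0 \<noteq> 0" using metric_zero_imp[OF WV, of p0 "h i"] Wh by auto
    then show ?thesis
      using metric_nonneg[OF WV, of p0] metric_frame[OF F p0 WV WV] by (simp add: q_def Wh)
  qed
  have "continuous_on (sphere 0 1) (q p0)"
    unfolding q_def by (intro continuous_intros)
  moreover have "axis undefined 1 \<in> sphere (0 :: real ^ 'n) 1" by simp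
  ultimately obtain w0 where w0: "w0 \<in> sphere 0 1" "\<And>w. w \<in> sphere 0 1 \<Longrightarrow> q p0 w0 \<le> q p0 w"
    using continuous_attains_inf[of "sphere 0 1" "q p0"] by auto
  define m where "m = q p0 w0"
  have m: "0 < m" unfolding m_def using w0 by (intro pos) auto
  have lower: "m * (norm w * norm w) \<le> q p0 w" for w
  proof (cases "w = 0")
    case False
    define u where "u = (1 / norm w) *\<^sub>R w"
    have "u \<in> sphere 0 1" using False by (simp add: u_def)
    then have "m \<le> q p0 u" using w0 by (simp add: m_def)
    moreover have "q p0 w = norm w * norm w * q p0 u"
      using scale[of p0 "norm w" u] False by (simp add: u_def)
    ultimately show ?thesis
      using mult_right_mono[of m "q p0 u" "norm w * norm w"] by (simp add: mult.commute)
  qed (simp add: q_def)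
  define D where "D p = (\<Sum>i\<in>UNIV. \<Sum>j\<in>UNIV. \<bar>g (E i) (E j) p - g (E i) (E j) p0\<bar>)" for p
  have "continuous_on UNIV (g (E i) (E j))" for i j
    by (rule SF_continuous[OF metric_smooth[OF E E]])
  then have "continuous_on UNIV D" unfolding D_def by (intro continuous_intros)
  then have "open {p. D p < m / 2}" by (intro open_Collect_less continuous_on_const)
  moreover define W where "W = U \<inter> {p. D p < m / 2}"
  ultimately have W: "open W" using U by (simp add: open_Int)
  define G where "G = (\<Sum>i\<in>UNIV. \<Sum>j\<in>UNIV. \<bar>g (E i) (E j) p0\<bar>) + m / 2"
  have le2: "f i j \<le> (\<Sum>i\<in>UNIV. \<Sum>j\<in>UNIV. f i j)" if "\<And>i j. 0 \<le> f i j" for f :: "'n \<Rightarrow> 'n \<Rightarrow> real" and i j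
  proof -
    have "f i j \<le> (\<Sum>j\<in>UNIV. f i j)" by (rule member_le_sum) (use that in auto)
    also have "\<dots> \<le> (\<Sum>i\<in>UNIV. \<Sum>j\<in>UNIV. f i j)"
      by (rule member_le_sum[of i UNIV "\<lambda>i. \<Sum>j\<in>UNIV. f i j"]) (use that in \<open>auto intro: sum_nonneg\<close>)
    finally show ?thesis .
  qed
  show thesis
  proof
    show "open W" "W \<subseteq> U" "p0 \<in> W" using W p0 m by (auto simp: W_def D_def)
    show "0 \<le> sqrt (2 / m)" using m by simp
    show "0 \<le> G" using m by (auto simp: G_def intro!: add_nonneg_nonneg sum_nonneg)
    fix p assume p: "p \<in> W"
    then have Dp: "D p < m / 2" "p \<in> U" by (auto simp: W_def)
    show "\<bar>g (E i) (E j) p\<bar> \<le> G" for i j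
    proof -
      have "\<bar>g (E i) (E j) p - g (E i) (E j) p0\<bar> \<le> D p"
        unfolding D_def by (rule le2) auto
      moreover have "\<bar>g (E i) (E j) p0\<bar> \<le> (\<Sum>i\<in>UNIV. \<Sum>j\<in>UNIV. \<bar>g (E i) (E j) p0\<bar>)"
        by (rule le2) auto
      ultimately show ?thesis using Dp by (simp add: G_def)
    qed
    fix X i assume X: "X \<in> VF" "g X X p = 1"
    define w where "w = (\<chi> i. X (h i) p)"
    have "q p w = 1" using metric_frame[OF F Dp(2) X(1) X(1)] X by (simp add: q_def w_def)
    moreover have "\<bar>q p w - q p0 w\<bar> \<le> D p * (norm w * norm w)"
    proof -
      have "q p w - q p0 w = (\<Sum>i\<in>UNIV. \<Sum>j\<in>UNIV. w $ i * w $ j * (g (E i) (E j) p - g (E i) (E j) p0))"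
        by (simp add: q_def sum_subtractf algebra_simps)
      also have "\<bar>\<dots>\<bar> \<le> (\<Sum>i\<in>UNIV. \<Sum>j\<in>UNIV. \<bar>w $ i * w $ j * (g (E i) (E j) p - g (E i) (E j) p0)\<bar>)"
        by (rule order_trans[OF sum_abs sum_mono[OF sum_abs]])
      also have "\<dots> \<le> (\<Sum>i\<in>UNIV. \<Sum>j\<in>UNIV. (norm w * norm w) * \<bar>g (E i) (E j) p - g (E i) (E j) p0\<bar>)"
        unfolding abs_mult
        by (intro sum_mono mult_mono component_le_norm_cart mult_nonneg_nonneg abs_ge_zero norm_ge_zero order_refl)
      also have "\<dots> = D p * (norm w * norm w)"
        by (simp add: D_def mult.commute flip: sum_distrib_left)
      finally show ?thesis .
    qed
    moreover have "D p * (norm w * norm w) \<le> m / 2 * (norm w * norm w)"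
      using Dp by (intro mult_right_mono) auto
    ultimately have "m / 2 * (norm w * norm w) \<le> 1" using lower[of w] by argo
    then have "(norm w)\<^sup>2 \<le> 2 / m" using m by (simp add: field_simps power2_eq_square)
    then have "norm w \<le> sqrt (2 / m)" by (rule real_le_rsqrt)
    then show "\<bar>X (h i) p\<bar> \<le> sqrt (2 / m)"
      using component_le_norm_cart[of w i] by (simp add: w_def)
  qed
qed

text \<open>The frames \<open>onframe p\<close> come from a separate choice at each point and need
  not vary continuously. Their components in a smooth frame are nevertheless uniformly bounded near
  \<open>p0\<close>, so evaluations on the fixed fields \<open>E\<close> control the inner product,
  with one constant \<open>Q\<close> for all \<open>p\<close> in \<open>W\<close> and all
  forms.\<close>

lemma vform_inner_bound:
  obtains c U E h W Q where "local_frame c U E h" "open W" "p0 \<in> W" "W \<subseteq> U" "0 \<le> Q"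
    "\<And>p \<alpha> \<beta> a b. p \<in> W \<Longrightarrow> tensorial_form k p \<alpha> \<Longrightarrow> tensorial_form k p \<beta> \<Longrightarrow>
      (\<And>Es i. length Es = k \<Longrightarrow> set Es \<subseteq> range E \<Longrightarrow> \<bar>\<alpha> Es (h i) p\<bar> \<le> a) \<Longrightarrow>
      (\<And>Es i. length Es = k \<Longrightarrow> set Es \<subseteq> range E \<Longrightarrow> \<bar>\<beta> Es (h i) p\<bar> \<le> b) \<Longrightarrow>
      \<bar>vinner k \<alpha> \<beta> p\<bar> \<le> Q * a * b"
proof -
  obtain c where c: "c \<in> \<A>" "p0 \<in> fst c" using ex_chart by blast
  obtain U E h where F: "local_frame c U E h" and p0: "p0 \<in> U" by (rule local_frame_exists[OF c])
  obtain W C G where W: "open W" "p0 \<in> W" "W \<subseteq> U" "0 \<le> C" "0 \<le> G"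
    and G: "\<And>p i j. p \<in> W \<Longrightarrow> \<bar>g (E i) (E j) p\<bar> \<le> G"
    and C: "\<And>p X i. p \<in> W \<Longrightarrow> X \<in> VF \<Longrightarrow> g X X p = 1 \<Longrightarrow> \<bar>X (h i) p\<bar> \<le> C"
    by (rule metric_frame_bound[OF F p0]) blast
  have E: "E i \<in> VF" for i using F by (auto simp: local_frame_def)
  define S where "S = {K. K \<subseteq> {..<CARD('n)} \<and> card K = k}"
  define N where "N = (real CARD('n) * C) ^ k"
  define M where "M = real CARD('n) * real CARD('n)"
  have N0: "0 \<le> N" using W(4) by (simp add: N_def)
  show thesis
  proof (rule that[OF F W(1-3)])
    \<comment> \<open>The factors count the index sets \<open>K\<close>, then the pairs of
      coordinate indices in the expansion of the metric by \<open>M\<close>; \<open>N\<close> is the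
      cost of passing from the orthonormal to the smooth frame, once for each form, and
      \<open>G\<close> bounds the metric coefficients.\<close>
    show "0 \<le> real (card S) * M * N * N * G" using N0 W(5) by (simp add: M_def)
    fix p \<alpha> \<beta> a b
    assume p: "p \<in> W" and \<alpha>: "tensorial_form k p \<alpha>" and \<beta>: "tensorial_form k p \<beta>"
      and a: "\<And>Es i. length Es = k \<Longrightarrow> set Es \<subseteq> range E \<Longrightarrow> \<bar>\<alpha> Es (h i) p\<bar> \<le> a"
      and b: "\<And>Es i. length Es = k \<Longrightarrow> set Es \<subseteq> range E \<Longrightarrow> \<bar>\<beta> Es (h i) p\<bar> \<le> b"
    have pU: "p \<in> U" using p W by blast
    let ?e = "onframe p"
    have r: "length (replicate k (E undefined)) = k" "set (replicate k (E undefined)) \<subseteq> range E"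
      by auto
    have a0: "0 \<le> a" and b0: "0 \<le> b"
      using order_trans[OF abs_ge_zero a[OF r]] order_trans[OF abs_ge_zero b[OF r]] by auto
    have el: "length (nths ?e K) = k" "set (nths ?e K) \<subseteq> VF" if "K \<in> S" for K
      using that by (auto simp: S_def length_orthonormal_nths set_orthonormal_nths[THEN subsetD])
    have e: "\<bar>(nths ?e K ! m) (h i) p\<bar> \<le> C" if "K \<in> S" "m < k" for K m i
    proof -
      have "nths ?e K ! m \<in> set (nths ?e K)" using el[OF that(1)] that(2) by simp
      then have "nths ?e K ! m \<in> set ?e" using set_nths_subset[of ?e K] by blast
      then obtain l where "l < CARD('n)" "nths ?e K ! m = ?e ! l"
        using orthonormal_frame[of p] by (auto simp: orthonormal_at_def in_set_conv_nth)
      then show ?thesis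
        using orthonormal_frame[of p] by (intro C[OF p]) (auto simp: orthonormal_at_def)
    qed
    have bd: "\<bar>\<gamma> (nths ?e K) (h i) p\<bar> \<le> N * x" if "K \<in> S" "tensorial_form k p \<gamma>"
      "\<And>Es i. length Es = k \<Longrightarrow> set Es \<subseteq> range E \<Longrightarrow> \<bar>\<gamma> Es (h i) p\<bar> \<le> x" for K i \<gamma> x
      unfolding N_def
      by (rule tensorial_form_bound[OF F pU that(2) W(4) that(3) order_refl el[OF that(1)] e[OF that(1)]]) auto
    have V: "\<alpha> (nths ?e K) \<in> VF" "\<beta> (nths ?e K) \<in> VF" if "K \<in> S" for K
      using el[OF that] \<alpha> \<beta> by (auto simp: tensorial_form_def)
    have gK: "\<bar>g (\<alpha> (nths ?e K)) (\<beta> (nths ?e K)) p\<bar> \<le> M * ((N * a) * (N * b) * G)" if K: "K \<in> S" for K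
    proof -
      have "\<bar>g (\<alpha> (nths ?e K)) (\<beta> (nths ?e K)) p\<bar> \<le>
        (\<Sum>i\<in>UNIV. \<Sum>j\<in>UNIV. \<bar>\<alpha> (nths ?e K) (h i) p * \<beta> (nths ?e K) (h j) p * g (E i) (E j) p\<bar>)"
        unfolding metric_frame[OF F pU V[OF K]] by (rule order_trans[OF sum_abs sum_mono[OF sum_abs]])
      also have "\<dots> \<le> (\<Sum>i\<in>(UNIV :: 'n set). \<Sum>j\<in>(UNIV :: 'n set). (N * a) * (N * b) * G)"
        unfolding abs_mult
        by (intro sum_mono mult_mono bd[OF K \<alpha> a] bd[OF K \<beta> b] G[OF p] mult_nonneg_nonneg abs_ge_zero N0 a0 b0)
      finally show ?thesis by (simp add: M_def mult.assoc)
    qed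
    have "\<bar>vinner k \<alpha> \<beta> p\<bar> \<le> (\<Sum>K\<in>S. \<bar>g (\<alpha> (nths ?e K)) (\<beta> (nths ?e K)) p\<bar>)"
      using \<alpha> \<beta> by (subst vform_inner_orthonormal) (auto simp: S_def tensorial_form_def)
    also have "\<dots> \<le> (\<Sum>K\<in>S. M * ((N * a) * (N * b) * G))" by (rule sum_mono[OF gK])
    finally show "\<bar>vinner k \<alpha> \<beta> p\<bar> \<le> real (card S) * M * N * N * G * a * b"
      by (simp add: mult_ac)
  qed
qed

end

section \<open>Smooth curves of forms\<close>

lemma frechet_derivative_partial_snd:
  assumes "\<Phi> differentiable (at (t, x))"
  shows "fderiv (\<lambda>x. \<Phi> (t, x)) x v = fderiv \<Phi> (t, x) (0, v)"
proof -
  have "((\<lambda>x. (t, x)) has_derivative (\<lambda>v. (0, v))) (at x)"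
    by (auto intro!: derivative_eq_intros)
  from has_derivative_compose[OF this] assms
  have "((\<lambda>x. \<Phi> (t, x)) has_derivative (\<lambda>v. fderiv \<Phi> (t, x) (0, v))) (at x)"
    by (simp add: frechet_derivative_works)
  from frechet_derivative_at[OF this] show ?thesis by metis
qed

lemma has_real_derivative_partial_fst:
  fixes \<Phi> :: "real \<times> 'a::real_normed_vector \<Rightarrow> real"
  assumes "\<Phi> differentiable (at (t, x))"
  shows "((\<lambda>t. \<Phi> (t, x)) has_real_derivative fderiv \<Phi> (t, x) (1, 0)) (at t)"
proof -
  have "((\<lambda>t. (t, x)) has_derivative (\<lambda>s. (s, 0))) (at t)"
    by (auto intro!: derivative_eq_intros)
  from has_derivative_compose[OF this] assms
  have D: "((\<lambda>t. \<Phi> (t, x)) has_derivative (\<lambda>s. fderiv \<Phi> (t, x) (s, 0))) (at t)"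
    by (simp add: frechet_derivative_works)
  have "fderiv \<Phi> (t, x) (s, 0) = fderiv \<Phi> (t, x) (1, 0) * s" for s
  proof -
    have "fderiv \<Phi> (t, x) (s *\<^sub>R (1, 0)) = s *\<^sub>R fderiv \<Phi> (t, x) (1, 0)"
      by (rule linear_cmul[OF linear_frechet_derivative[OF assms]])
    then show ?thesis by (simp add: mult.commute)
  qed
  then have "(\<lambda>s. fderiv \<Phi> (t, x) (s, 0)) = (*) (fderiv \<Phi> (t, x) (1, 0))"
    by (rule ext)
  with D show ?thesis unfolding has_field_derivative_def by metis
qed

lemma continuous_on_product_local:
  fixes F :: "'a::t2_space \<times> 'b::t2_space \<Rightarrow> 'c::topological_space"
  assumes "open T" "\<And>p. \<exists>U. open U \<and> p \<in> U \<and> continuous_on (T \<times> U) F"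
  shows "continuous_on (T \<times> UNIV) F"
proof (rule continuous_at_imp_continuous_on, rule ballI)
  fix z assume z: "z \<in> T \<times> (UNIV :: 'b set)"
  obtain U where U: "open U" "snd z \<in> U" "continuous_on (T \<times> U) F" using assms(2) by blast
  then show "isCont F z"
    using z assms(1) continuous_on_eq_continuous_at[of "T \<times> U" F] by (cases z) (auto simp: open_Times)
qed

context manifold
begin

lemma smooth_curve_chart:
  assumes "smooth_curve \<A> e \<gamma>" "length Xs = k" "set Xs \<subseteq> VF" "f \<in> SF" "c \<in> \<A>"
  shows "smooth_on ({-e<..<e} \<times> snd c ` fst c) (\<lambda>z. \<gamma> (fst z) k Xs f (chart_inv c (snd z)))"
proof -
  have "smooth_on ({-e<..<e} \<times> snd c ` fst c) (\<lambda>(t, x). \<gamma> t k Xs f (chart_inv c x))"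
    using assms unfolding smooth_curve_def by blast
  then show ?thesis by (simp add: split_def)
qed

lemma continuous_on_chart_pullback:
  assumes c: "c \<in> \<A>" and \<Phi>: "continuous_on (T \<times> snd c ` fst c) \<Phi>"
  shows "continuous_on (T \<times> fst c) (\<lambda>z. \<Phi> (fst z, snd c (snd z)))"
  by (rule continuous_on_compose2[OF \<Phi>])
     (auto intro!: continuous_intros continuous_on_compose2[OF continuous_chart[OF c]])

lemma smooth_curve_continuous:
  assumes \<gamma>: "smooth_curve \<A> e \<gamma>" and Xs: "length Xs = k" "set Xs \<subseteq> VF" and f: "f \<in> SF"
  shows "continuous_on ({-e<..<e} \<times> UNIV) (\<lambda>z. \<gamma> (fst z) k Xs f (snd z))"
proof (rule continuous_on_product_local)
  fix p
  obtain c where c: "c \<in> \<A>" "p \<in> fst c" using ex_chart by blast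
  have "continuous_on ({-e<..<e} \<times> fst c) (\<lambda>z. \<gamma> (fst z) k Xs f (snd z))"
    by (rule continuous_on_eq[OF continuous_on_chart_pullback[OF c(1)
          smooth_on_imp_continuous_on[OF smooth_curve_chart[OF \<gamma> Xs f c(1)]]]])
       (use c in auto)
  then show "\<exists>U. open U \<and> p \<in> U \<and> continuous_on ({-e<..<e} \<times> U) (\<lambda>z. \<gamma> (fst z) k Xs f (snd z))"
    using c open_dom[OF c(1)] by blast
qed simp

lemma continuous_on_snd_smooth: "f \<in> SF \<Longrightarrow> continuous_on S (\<lambda>z. f (snd z))"
  by (rule continuous_on_compose2[OF SF_continuous]) (auto intro: continuous_intros)

text \<open>Smoothness of the curve is joint in time and coordinates. In a local frame,
  \<open>X\<close> acts as a combination of spatial partial derivatives of that joint function, with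
  coefficients independent of time.\<close>

lemma smooth_curve_derivative_continuous:
  assumes \<gamma>: "smooth_curve \<A> e \<gamma>" and Xs: "length Xs = k" "set Xs \<subseteq> VF" and f: "f \<in> SF" and X: "X \<in> VF"
    and V: "\<And>t. t \<in> {-e<..<e} \<Longrightarrow> \<gamma> t k Xs \<in> VF"
  shows "continuous_on ({-e<..<e} \<times> UNIV) (\<lambda>z. X (\<gamma> (fst z) k Xs f) (snd z))"
proof (rule continuous_on_product_local)
  fix p
  let ?T = "{-e<..<e}"
  obtain c where c: "c \<in> \<A>" "p \<in> fst c" using ex_chart by blast
  obtain U E h where F: "local_frame c U E h" and p: "p \<in> U" by (rule local_frame_exists[OF c])
  have U: "open U" "U \<subseteq> fst c" and h: "h l \<in> SF" for l using F by (auto simp: local_frame_def)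
  define \<Phi> where "\<Phi> z = \<gamma> (fst z) k Xs f (chart_inv c (snd z))" for z
  have \<Phi>: "smooth_on (?T \<times> snd c ` fst c) \<Phi>" unfolding \<Phi>_def by (rule smooth_curve_chart[OF \<gamma> Xs f c(1)])
  have eq: "X (\<gamma> t k Xs f) q = (\<Sum>l\<in>UNIV. X (h l) q * fderiv \<Phi> (t, snd c q) (0, axis l 1))"
    if t: "t \<in> ?T" and q: "q \<in> U" for t q
  proof -
    have s: "\<gamma> t k Xs f \<in> SF" by (rule VF_smooth[OF V[OF t] f])
    have "E l (\<gamma> t k Xs f) q = fderiv \<Phi> (t, snd c q) (0, axis l 1)" for l
    proof -
      have "E l (\<gamma> t k Xs f) q = fderiv (\<gamma> t k Xs f \<circ> chart_inv c) (snd c q) (axis l 1)"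
        using F q s by (simp add: local_frame_def has_coords_def)
      also have "\<gamma> t k Xs f \<circ> chart_inv c = (\<lambda>x. \<Phi> (t, x))" by (simp add: \<Phi>_def fun_eq_iff)
      also have "fderiv (\<lambda>x. \<Phi> (t, x)) (snd c q) (axis l 1) =
          fderiv \<Phi> (t, snd c q) (0, axis l 1)"
        by (rule frechet_derivative_partial_snd[OF smooth_on_imp_differentiable[OF \<Phi>]]) (use t q U in auto)
      finally show ?thesis .
    qed
    then show ?thesis by (simp add: local_frame_expand[OF F q X s])
  qed
  have "continuous_on (?T \<times> fst c) (\<lambda>z. fderiv \<Phi> (fst z, snd c (snd z)) (0, axis l 1))" for l
    using continuous_on_chart_pullback[OF c(1) smooth_on_imp_continuous_on[OF smooth_on_frechet_derivative[OF \<Phi>]]] .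
  then have "continuous_on (?T \<times> U) (\<lambda>z. \<Sum>l\<in>UNIV. X (h l) (snd z) * fderiv \<Phi> (fst z, snd c (snd z)) (0, axis l 1))"
    by (intro continuous_on_sum continuous_on_mult continuous_on_snd_smooth[OF VF_smooth[OF X h]])
       (rule continuous_on_subset, assumption, use U in auto)
  then have "continuous_on (?T \<times> U) (\<lambda>z. X (\<gamma> (fst z) k Xs f) (snd z))"
    by (rule continuous_on_eq) (auto simp: eq)
  then show "\<exists>U. open U \<and> p \<in> U \<and> continuous_on (?T \<times> U) (\<lambda>z. X (\<gamma> (fst z) k Xs f) (snd z))"
    using U p by blast
qed simp

text \<open>The time derivative is continuous in both variables, hence bounded near
  \<open>(0, p0)\<close>; since the curve vanishes at time 0, the mean value inequality gives linear
  growth with a constant that is uniform in the point.\<close>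

lemma smooth_curve_linear_bound:
  assumes \<gamma>: "smooth_curve \<A> e \<gamma>" and e: "0 < e" and Xs: "length Xs = k" "set Xs \<subseteq> VF" and f: "f \<in> SF"
    and 0: "\<gamma> 0 k Xs f = 0"
  shows "\<exists>L\<ge>0. \<forall>\<^sub>F z in nhds (0, p0). \<bar>\<gamma> (fst z) k Xs f (snd z)\<bar> \<le> L * \<bar>fst z\<bar>"
proof -
  let ?T = "{-e<..<e}"
  obtain c where c: "c \<in> \<A>" "p0 \<in> fst c" using ex_chart by blast
  define \<Phi> where "\<Phi> z = \<gamma> (fst z) k Xs f (chart_inv c (snd z))" for z
  have \<Phi>: "smooth_on (?T \<times> snd c ` fst c) \<Phi>" unfolding \<Phi>_def by (rule smooth_curve_chart[OF \<gamma> Xs f c(1)])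
  define D where "D z = fderiv \<Phi> (fst z, snd c (snd z)) (1, 0)" for z
  have D: "continuous_on (?T \<times> fst c) D"
    unfolding D_def
    by (rule continuous_on_chart_pullback[OF c(1) smooth_on_imp_continuous_on[OF smooth_on_frechet_derivative[OF \<Phi>]]])
  \<comment> \<open>The summand 1 makes the inequality strict at \<open>(0, p0)\<close>, so that it
    persists on an open neighbourhood.\<close>
  define L where "L = \<bar>D (0, p0)\<bar> + 1"
  have o: "open (?T \<times> fst c)" by (intro open_Times open_dom[OF c(1)]) simp
  have "open ((?T \<times> fst c) \<inter> (\<lambda>z. \<bar>D z\<bar>) -` {..<L})"
    by (rule continuous_open_preimage[OF continuous_on_rabs[OF D] o]) simp
  moreover have "(0, p0) \<in> (?T \<times> fst c) \<inter> (\<lambda>z. \<bar>D z\<bar>) -` {..<L}"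
    using e c by (auto simp: L_def)
  ultimately obtain S B where SB: "open S" "open B" "(0, p0) \<in> S \<times> B" "S \<times> B \<subseteq> (?T \<times> fst c) \<inter> (\<lambda>z. \<bar>D z\<bar>) -` {..<L}"
    by (rule open_prod_elim)
  then have "0 \<in> S" by simp
  then obtain r where r: "0 < r" "ball 0 r \<subseteq> S" using SB(1) unfolding open_contains_ball by blast
  have bound: "\<bar>\<gamma> t k Xs f p\<bar> \<le> L * \<bar>t\<bar>" if t: "t \<in> ball 0 r" and p: "p \<in> B" for t p
  proof -
    have in_dom: "(s, p) \<in> ?T \<times> fst c" "\<bar>D (s, p)\<bar> < L" if "s \<in> ball 0 r" for s
      using SB(4) r(2) that p by (auto simp: subset_iff)
    have "norm (\<Phi> (t, snd c p) - \<Phi> (0, snd c p)) \<le> L * norm (t - 0)"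
    proof (rule field_differentiable_bound[of "ball 0 r" "\<lambda>s. \<Phi> (s, snd c p)" "\<lambda>s. D (s, p)"])
      fix s :: real assume s: "s \<in> ball 0 r"
      have "\<Phi> differentiable (at (s, snd c p))"
        by (rule smooth_on_imp_differentiable[OF \<Phi>]) (use in_dom[OF s] in auto)
      from has_real_derivative_partial_fst[OF this]
      show "((\<lambda>s. \<Phi> (s, snd c p)) has_field_derivative D (s, p)) (at s within ball 0 r)"
        by (auto simp: D_def intro: has_field_derivative_at_within)
      show "norm (D (s, p)) \<le> L" using in_dom[OF s] by simp
    qed (use t r in auto)
    moreover have "p \<in> fst c" using in_dom[OF t] by simp
    ultimately show ?thesis using c 0 by (simp add: \<Phi>_def)
  qed
  have "\<forall>\<^sub>F z in nhds (0, p0). \<bar>\<gamma> (fst z) k Xs f (snd z)\<bar> \<le> L * \<bar>fst z\<bar>"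
    unfolding eventually_nhds
    by (rule exI[of _ "ball 0 r \<times> B"]) (use SB r bound in \<open>auto intro: open_Times\<close>)
  then show ?thesis by (intro exI[of _ L]) (auto simp: L_def)
qed

end

context torsion_free_manifold
begin

lemma nabla_sum_apply:
  assumes "X \<in> VF" "\<And>j. j \<in> J \<Longrightarrow> f j \<in> SF" "\<And>j. j \<in> J \<Longrightarrow> E j \<in> VF"
  shows "nabla X (\<Sum>j\<in>J. fscale (f j) (E j)) u p = (\<Sum>j\<in>J. X (f j) p * E j u p + f j p * nabla X (E j) u p)"
  using assms(2,3)
proof (induction J rule: infinite_finite_induct)
  case (insert j J)
  have V: "fscale (f j) (E j) \<in> VF" "(\<Sum>j\<in>J. fscale (f j) (E j)) \<in> VF"
    using insert.prems by (auto intro!: VF_fscale VF_sum)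
  have "nabla X (fscale (f j) (E j)) u p = X (f j) p * E j u p + f j p * nabla X (E j) u p"
    using nabla_fscale[OF insert.prems(1)[of j] assms(1) insert.prems(2)[of j]] by (simp add: fscale_def)
  moreover have "nabla X (\<Sum>j\<in>J. fscale (f j) (E j)) u p = (\<Sum>j\<in>J. X (f j) p * E j u p + f j p * nabla X (E j) u p)"
    using insert.prems by (intro insert.IH) auto
  ultimately show ?case
    unfolding sum.insert[OF insert.hyps] nabla_add[OF assms(1) V] by simp
qed (simp_all add: nabla_zero[OF assms(1)])

text \<open>A global cut-off of the frame expansion is differentiated; near \<open>p\<close> the
  cut-off is constant and leaves no trace. The formula involves \<open>Y\<close> only through the
  functions \<open>Y (h j)\<close>, to which the smoothness of a curve of forms applies.\<close>

lemma nabla_frame: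
  assumes F: "local_frame c U E h" and p: "p \<in> U" and X: "X \<in> VF" and Y: "Y \<in> VF"
  shows "nabla X Y u p = (\<Sum>j\<in>UNIV. X (Y (h j)) p * E j u p + Y (h j) p * nabla X (E j) u p)"
proof -
  have U: "open U" and E: "E j \<in> VF" and h: "h j \<in> SF" for j using F by (auto simp: local_frame_def)
  obtain \<phi> V where \<phi>: "\<phi> \<in> SF" "open V" "p \<in> V" "\<And>q. q \<in> V \<Longrightarrow> \<phi> q = 1" "\<And>q. q \<notin> U \<Longrightarrow> \<phi> q = 0"
    by (rule bump_function[OF U p]) blast
  note G = local_frame_globalize[OF F \<phi>(1,5) Y]
  have "X \<phi> p = X (\<lambda>_. 1) p"
    by (rule VF_local[OF X \<phi>(1) SF_const \<phi>(2,3,4)])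
  then have "nabla X (fscale \<phi> Y) u p = nabla X Y u p"
    using nabla_fscale[OF \<phi>(1) X Y] \<phi>(4)[OF \<phi>(3)] by (simp add: fscale_def VF_apply_const[OF X])
  moreover have "X (\<lambda>q. \<phi> q * Y (h j) q) p = X (Y (h j)) p" for j
  proof (rule VF_local[OF X G(1) VF_smooth[OF Y h] \<phi>(2,3)])
    show "\<phi> q * Y (h j) q = Y (h j) q" if "q \<in> V" for q
      using \<phi>(4)[OF that] by simp
  qed
  ultimately show ?thesis
    using nabla_sum_apply[OF X, of UNIV "\<lambda>j q. \<phi> q * Y (h j) q" E u p] G E \<phi>(4)[OF \<phi>(3)] by simp
qed

lemma smooth_curve_nabla_continuous:
  assumes \<gamma>: "smooth_curve \<A> e \<gamma>" and Xs: "length Xs = k" "set Xs \<subseteq> VF" and f: "f \<in> SF" and X: "X \<in> VF"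
    and V: "\<And>t. t \<in> {-e<..<e} \<Longrightarrow> \<gamma> t k Xs \<in> VF"
  shows "continuous_on ({-e<..<e} \<times> UNIV) (\<lambda>z. nabla X (\<gamma> (fst z) k Xs) f (snd z))"
proof (rule continuous_on_product_local)
  fix p
  let ?T = "{-e<..<e}"
  obtain c where c: "c \<in> \<A>" "p \<in> fst c" using ex_chart by blast
  obtain U E h where F: "local_frame c U E h" and p: "p \<in> U" by (rule local_frame_exists[OF c])
  have U: "open U" and E: "E l \<in> VF" and h: "h l \<in> SF" for l using F by (auto simp: local_frame_def)
  have "continuous_on (?T \<times> U) (\<lambda>z. \<Sum>j\<in>UNIV. X (\<gamma> (fst z) k Xs (h j)) (snd z) * E j f (snd z) +
      \<gamma> (fst z) k Xs (h j) (snd z) * nabla X (E j) f (snd z))"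
    by (intro continuous_on_sum continuous_on_add continuous_on_mult
        continuous_on_snd_smooth VF_smooth[OF E f] VF_smooth[OF nabla_vector_field[OF X E] f]
        continuous_on_subset[OF smooth_curve_derivative_continuous[OF \<gamma> Xs h X V]]
        continuous_on_subset[OF smooth_curve_continuous[OF \<gamma> Xs h]]) auto
  then have "continuous_on (?T \<times> U) (\<lambda>z. nabla X (\<gamma> (fst z) k Xs) f (snd z))"
    by (rule continuous_on_eq) (use V in \<open>auto simp: nabla_frame[OF F _ X]\<close>)
  then show "\<exists>U. open U \<and> p \<in> U \<and> continuous_on (?T \<times> U) (\<lambda>z. nabla X (\<gamma> (fst z) k Xs) f (snd z))"
    using U p by blast
qed simp

lemma smooth_curve_ext_deriv_continuous:
  assumes \<gamma>: "smooth_curve \<A> e \<gamma>" and Xs: "length Xs = Suc k" "set Xs \<subseteq> VF" and f: "f \<in> SF"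
    and \<Omega>: "\<And>t. t \<in> {-e<..<e} \<Longrightarrow> \<gamma> t k \<in> Omega \<A> k"
  shows "continuous_on ({-e<..<e} \<times> UNIV) (\<lambda>z. d (\<gamma> (fst z) k) Xs f (snd z))"
proof -
  have n: "Xs ! i \<in> VF" if "i < Suc k" for i using Xs that by auto
  have s: "set (del_nth i Xs) \<subseteq> VF" "set (del_nth i (del_nth j Xs)) \<subseteq> VF" for i j
    using Xs(2) set_del_nth_subset[of i Xs] set_del_nth_subset[of j Xs] set_del_nth_subset[of i "del_nth j Xs"] by blast+
  have "continuous_on ({-e<..<e} \<times> UNIV) (\<lambda>z. nabla (Xs ! i) (\<gamma> (fst z) k (del_nth i Xs)) f (snd z))" if "i < Suc k" for i
    using that Xs s by (intro smooth_curve_nabla_continuous[OF \<gamma>] f n Omega_vector_field[OF \<Omega>]) (auto simp: length_del_nth)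
  moreover have "continuous_on ({-e<..<e} \<times> UNIV)
      (\<lambda>z. \<gamma> (fst z) k (lie_bracket (Xs ! i) (Xs ! j) # del_nth i (del_nth j Xs)) f (snd z))" if "i < j" "j < Suc k" for i j
    using that Xs s lie_bracket_vector_field n
    by (intro smooth_curve_continuous[OF \<gamma> _ _ f]) (auto simp: length_del_nth dest: subsetD[OF s(2)])
  ultimately show ?thesis
    unfolding ext_deriv_apply[OF Xs(2)] Xs(1)
    by (intro continuous_on_add continuous_on_sum continuous_on_mult continuous_on_const) auto
qed

lemma ext_deriv_tensorial_form:
  assumes "\<alpha> \<in> Omega \<A> k" shows "tensorial_form (Suc k) p (d \<alpha>)"
  using ext_deriv_vector_field[of \<alpha>] Omega_vector_field[OF assms] ext_deriv_tensorial[OF assms]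
  unfolding tensorial_form_def by blast

end

context variational_manifold
begin

text \<open>Of the two factors, \<open>d (\<gamma> t k)\<close> is small by joint continuity and
  \<open>\<gamma> t (Suc k)\<close> is at most linear in \<open>t\<close>, so the product is o(t)
  near \<open>p0\<close>. Controlling both factors on tuples of frame fields suffices.\<close>

lemma vform_inner_curve_local:
  assumes \<gamma>: "smooth_curve \<A> e \<gamma>" and e: "0 < e"
    and \<Omega>: "\<And>t. t \<in> {-e<..<e} \<Longrightarrow> \<gamma> t k \<in> Omega \<A> k" "\<And>t. t \<in> {-e<..<e} \<Longrightarrow> \<gamma> t (Suc k) \<in> Omega \<A> (Suc k)"
    and 0: "d (\<gamma> 0 k) = 0" "\<gamma> 0 (Suc k) = 0" and \<eta>: "0 < \<eta>"
  shows "\<forall>\<^sub>F z in nhds (0, p0). \<bar>vinner (Suc k) (d (\<gamma> (fst z) k)) (\<gamma> (fst z) (Suc k)) (snd z)\<bar> \<le> \<eta> * \<bar>fst z\<bar>"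
proof -
  let ?T = "{-e<..<e}"
  obtain c U E h W Q where F: "local_frame c U E h" and W: "open W" "p0 \<in> W" and Q: "0 \<le> Q"
    and bound: "\<And>p \<alpha> \<beta> a b. p \<in> W \<Longrightarrow> tensorial_form (Suc k) p \<alpha> \<Longrightarrow> tensorial_form (Suc k) p \<beta> \<Longrightarrow>
      (\<And>Es i. length Es = Suc k \<Longrightarrow> set Es \<subseteq> range E \<Longrightarrow> \<bar>\<alpha> Es (h i) p\<bar> \<le> a) \<Longrightarrow>
      (\<And>Es i. length Es = Suc k \<Longrightarrow> set Es \<subseteq> range E \<Longrightarrow> \<bar>\<beta> Es (h i) p\<bar> \<le> b) \<Longrightarrow>
      \<bar>vinner (Suc k) \<alpha> \<beta> p\<bar> \<le> Q * a * b"
    by (rule vform_inner_bound[where ?p0.0 = p0 and k = "Suc k"]) blast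
  have E: "range E \<subseteq> VF" and h: "h i \<in> SF" for i using F by (auto simp: local_frame_def)
  \<comment> \<open>Finitely many tuples of frame fields, each with a coordinate function on which
    the value is tested. Finiteness turns separate bounds into a common one on one
    neighbourhood.\<close>
  define I where "I = {Es. set Es \<subseteq> range E \<and> length Es = Suc k} \<times> (UNIV :: 'n set)"
  have I: "finite I" unfolding I_def by (intro finite_cartesian_product finite_lists_length_eq) auto
  have IV: "length (fst x) = Suc k" "set (fst x) \<subseteq> VF" if "x \<in> I" for x
    using that subset_trans[OF _ E] by (simp_all add: I_def mem_Times_iff)
  have "\<forall>x\<in>I. \<exists>L\<ge>0. \<forall>\<^sub>F z in nhds (0, p0). \<bar>\<gamma> (fst z) (Suc k) (fst x) (h (snd x)) (snd z)\<bar> \<le> L * \<bar>fst z\<bar>"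
  proof
    fix x assume x: "x \<in> I"
    have "\<gamma> 0 (Suc k) (fst x) (h (snd x)) = 0" by (simp add: 0)
    then show "\<exists>L\<ge>0. \<forall>\<^sub>F z in nhds (0, p0). \<bar>\<gamma> (fst z) (Suc k) (fst x) (h (snd x)) (snd z)\<bar> \<le> L * \<bar>fst z\<bar>"
      by (rule smooth_curve_linear_bound[OF \<gamma> e IV[OF x] h])
  qed
  from bchoice[OF this] obtain L where L: "\<And>x. x \<in> I \<Longrightarrow> 0 \<le> L x"
    "\<And>x. x \<in> I \<Longrightarrow> \<forall>\<^sub>F z in nhds (0, p0). \<bar>\<gamma> (fst z) (Suc k) (fst x) (h (snd x)) (snd z)\<bar> \<le> L x * \<bar>fst z\<bar>"
    by blast
  define M where "M = (\<Sum>x\<in>I. L x)"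
  have M0: "0 \<le> M" unfolding M_def using L by (intro sum_nonneg)
  have LM: "L x \<le> M" if "x \<in> I" for x
    unfolding M_def using L that I by (intro member_le_sum) auto
  \<comment> \<open>The final bound is \<open>Q * M * \<kappa>\<close> times the absolute value of
    time, hence the quotient; adding 1 keeps the denominator positive.\<close>
  define \<kappa> where "\<kappa> = \<eta> / (Q * M + 1)"
  have QM: "0 < Q * M + 1" using Q M0 by (simp add: add_nonneg_pos)
  have \<kappa>: "0 < \<kappa>" using \<eta> QM by (simp add: \<kappa>_def)
  have "\<forall>\<^sub>F z in nhds (0, p0). \<forall>x\<in>I. \<bar>\<gamma> (fst z) (Suc k) (fst x) (h (snd x)) (snd z)\<bar> \<le> L x * \<bar>fst z\<bar>"
    using L(2) by (intro eventually_ball_finite[OF I]) auto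
  moreover have "\<forall>\<^sub>F z in nhds (0, p0). \<forall>x\<in>I. \<bar>d (\<gamma> (fst z) k) (fst x) (h (snd x)) (snd z)\<bar> < \<kappa>"
  proof (intro eventually_ball_finite[OF I] ballI)
    fix x assume x: "x \<in> I"
    let ?F = "\<lambda>z. \<bar>d (\<gamma> (fst z) k) (fst x) (h (snd x)) (snd z)\<bar>"
    have o: "open (?T \<times> (UNIV :: 'm set))" by (intro open_Times) auto
    have "continuous_on (?T \<times> UNIV) ?F"
      by (intro continuous_on_rabs smooth_curve_ext_deriv_continuous[OF \<gamma> IV[OF x] h \<Omega>(1)])
    then have "open ((?T \<times> UNIV) \<inter> ?F -` {..<\<kappa>})" by (rule continuous_open_preimage[OF _ o]) simp
    then show "\<forall>\<^sub>F z in nhds (0, p0). ?F z < \<kappa>"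
      unfolding eventually_nhds
      by (rule_tac x = "(?T \<times> UNIV) \<inter> ?F -` {..<\<kappa>}" in exI) (use e \<kappa> 0 in auto)
  qed
  moreover have "\<forall>\<^sub>F z in nhds (0, p0). z \<in> ?T \<times> W"
    unfolding eventually_nhds by (rule exI[of _ "?T \<times> W"]) (use W e in \<open>auto intro: open_Times\<close>)
  ultimately show ?thesis
  proof eventually_elim
    case (elim z)
    then have t: "fst z \<in> ?T" and p: "snd z \<in> W" by auto
    have "\<bar>vinner (Suc k) (d (\<gamma> (fst z) k)) (\<gamma> (fst z) (Suc k)) (snd z)\<bar> \<le> Q * \<kappa> * (M * \<bar>fst z\<bar>)"
    proof (rule bound[OF p ext_deriv_tensorial_form[OF \<Omega>(1)[OF t]] Omega_tensorial_form[OF \<Omega>(2)[OF t]]])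
      fix Es i assume "length Es = Suc k" "set Es \<subseteq> range E"
      then have x: "(Es, i) \<in> I" by (simp add: I_def)
      show "\<bar>d (\<gamma> (fst z) k) Es (h i) (snd z)\<bar> \<le> \<kappa>" using elim(2) x by force
      have "\<bar>\<gamma> (fst z) (Suc k) Es (h i) (snd z)\<bar> \<le> L (Es, i) * \<bar>fst z\<bar>" using elim(1) x by force
      also have "\<dots> \<le> M * \<bar>fst z\<bar>" using LM[OF x] by (rule mult_right_mono) simp
      finally show "\<bar>\<gamma> (fst z) (Suc k) Es (h i) (snd z)\<bar> \<le> M * \<bar>fst z\<bar>" .
    qed
    also have "\<dots> = (Q * M * \<kappa>) * \<bar>fst z\<bar>" by simp
    also have "\<dots> \<le> \<eta> * \<bar>fst z\<bar>"
      using QM \<eta> by (intro mult_right_mono) (auto simp: \<kappa>_def field_simps)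
    finally show ?case .
  qed
qed

text \<open>Each local estimate holds on a product of a time interval around 0 with an open set.
  Finitely many of these sets cover the compact manifold, so the estimate becomes uniform in the
  point, and the total volume is finite.\<close>

lemma L2_curve_small:
  assumes comp: "compact (UNIV :: 'm set)" and \<gamma>: "smooth_curve \<A> e \<gamma>" and e: "0 < e"
    and \<Omega>: "\<And>t. t \<in> {-e<..<e} \<Longrightarrow> \<gamma> t k \<in> Omega \<A> k" "\<And>t. t \<in> {-e<..<e} \<Longrightarrow> \<gamma> t (Suc k) \<in> Omega \<A> (Suc k)"
    and 0: "d (\<gamma> 0 k) = 0" "\<gamma> 0 (Suc k) = 0" and \<eta>: "0 < \<eta>"
  shows "\<forall>\<^sub>F t in nhds 0. \<bar>L2 (Suc k) (d (\<gamma> t k)) (\<gamma> t (Suc k))\<bar> \<le> \<eta> * \<bar>t\<bar>"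
proof -
  define v where "v = measure \<mu> UNIV"
  have fin: "finite_measure \<mu>"
    using finite_volume[OF comp] by (intro finite_measureI) (simp add: space_volume less_top)
  have v: "0 \<le> v" by (simp add: v_def)
  define \<kappa> where "\<kappa> = \<eta> / (v + 1)"
  have \<kappa>: "0 < \<kappa>" using v \<eta> by (simp add: \<kappa>_def)
  let ?I = "\<lambda>t p. vinner (Suc k) (d (\<gamma> t k)) (\<gamma> t (Suc k)) p"
  define \<C> where "\<C> = {N. open N \<and> (\<forall>\<^sub>F t in nhds 0. \<forall>p\<in>N. \<bar>?I t p\<bar> \<le> \<kappa> * \<bar>t\<bar>)}"
  have op: "\<And>N. N \<in> \<C> \<Longrightarrow> open N" by (simp add: \<C>_def)
  have cov: "UNIV \<subseteq> \<Union>\<C>"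
  proof
    fix p0
    have "\<forall>\<^sub>F z in nhds (0, p0). \<bar>?I (fst z) (snd z)\<bar> \<le> \<kappa> * \<bar>fst z\<bar>"
      by (rule vform_inner_curve_local[OF \<gamma> e \<Omega> 0 \<kappa>])
    then obtain S where S: "open S" "(0, p0) \<in> S" "\<And>z. z \<in> S \<Longrightarrow> \<bar>?I (fst z) (snd z)\<bar> \<le> \<kappa> * \<bar>fst z\<bar>"
      unfolding eventually_nhds by blast
    obtain T N where TN: "open T" "open N" "(0, p0) \<in> T \<times> N" "T \<times> N \<subseteq> S"
      by (rule open_prod_elim[OF S(1,2)])
    have "\<forall>\<^sub>F t in nhds 0. \<forall>p\<in>N. \<bar>?I t p\<bar> \<le> \<kappa> * \<bar>t\<bar>"
      unfolding eventually_nhds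
    proof (intro exI[of _ T] conjI ballI)
      fix t p assume "t \<in> T" "p \<in> N"
      then have "(t, p) \<in> S" using TN(4) by blast
      from S(3)[OF this] show "\<bar>?I t p\<bar> \<le> \<kappa> * \<bar>t\<bar>" by simp
    qed (use TN in auto)
    then have "N \<in> \<C>" using TN by (simp add: \<C>_def)
    then show "p0 \<in> \<Union>\<C>" using TN by blast
  qed
  obtain \<D> where \<D>: "\<D> \<subseteq> \<C>" "finite \<D>" "UNIV \<subseteq> \<Union>\<D>"
    by (rule compactE[OF comp cov op]) (simp, rule that)
  have "\<forall>\<^sub>F t in nhds 0. \<forall>N\<in>\<D>. \<forall>p\<in>N. \<bar>?I t p\<bar> \<le> \<kappa> * \<bar>t\<bar>"
    using \<D> by (intro eventually_ball_finite) (auto simp: \<C>_def)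
  then show ?thesis
  proof eventually_elim
    case (elim t)
    have I: "\<bar>?I t p\<bar> \<le> \<kappa> * \<bar>t\<bar>" for p
    proof -
      have "p \<in> \<Union>\<D>" using \<D>(3) by blast
      then show ?thesis using elim by blast
    qed
    have "\<bar>LINT p|\<mu>. ?I t p\<bar> \<le> (\<kappa> * \<bar>t\<bar>) * v"
    proof (cases "integrable \<mu> (?I t)")
      case True
      have "\<bar>LINT p|\<mu>. ?I t p\<bar> \<le> (LINT p|\<mu>. \<bar>?I t p\<bar>)" by (rule integral_abs_bound)
      also have "\<dots> \<le> (LINT p|\<mu>. \<kappa> * \<bar>t\<bar>)"
        using True I finite_measure.integrable_const[OF fin] by (intro integral_mono) auto
      finally show ?thesis by (simp add: v_def space_volume mult_ac)
    next
      \<comment> \<open>Integrability of the products of \<open>Omega\<close> forms does not settle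
        this integrand, as \<open>d (\<gamma> t k)\<close> is not shown to lie in
        \<open>Omega\<close> for general \<open>k\<close>. If it is not integrable, its integral has
        the default value 0 and satisfies the bound.\<close>
      case False
      then show ?thesis using \<kappa> v by (simp add: not_integrable_integral_eq)
    qed
    also have "\<dots> = (\<kappa> * v) * \<bar>t\<bar>" by simp
    also have "\<dots> \<le> \<eta> * \<bar>t\<bar>"
      using v \<eta> by (intro mult_right_mono) (auto simp: \<kappa>_def field_simps)
    finally show ?case by (simp add: L2_degree_def)
  qed
qed

end

section \<open>Critical points and the Kaehler condition\<close>

context variational_manifold
begin

lemma
  assumes "\<alpha> \<in> Omega \<A> k"
  shows L2_zero_left: "L2 k 0 \<alpha> = 0"
    and L2_zero_right: "L2 k \<alpha> 0 = 0"
    and L2_ext_deriv_zero_right: "L2 (Suc k) (d \<alpha>) 0 = 0"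
  using Omega_vector_field[OF assms]
  by (simp_all add: L2_degree_def vform_inner_zero_left vform_inner_zero_right ext_deriv_vector_field)

lemma adjoint_vform: "\<beta> \<in> Omega \<A> (Suc k) \<Longrightarrow> \<delta> \<beta> \<in> Omega \<A> k"
  using adjoint unfolding formal_adjoint_def by blast

lemma adjoint_eq:
  "\<beta> \<in> Omega \<A> (Suc k) \<Longrightarrow> \<alpha> \<in> Omega \<A> k \<Longrightarrow>
    L2 (Suc k) (d \<alpha>) \<beta> = L2 k \<alpha> (\<delta> \<beta>)"
  using adjoint unfolding formal_adjoint_def by blast

text \<open>Only adjointness is known of \<delta>. It gives \<open>\<delta> 0\<close> square norm
  zero, and definiteness concludes. This puts forms concentrated in degree one into
  \<open>coclosed_3\<close>.\<close>

lemma adjoint_zero: "\<delta> 0 = 0"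
proof -
  have "\<delta> 0 \<in> Omega \<A> 2" using adjoint_vform[OF Omega_zero, of 2] by simp
  moreover from this have "L2 2 (\<delta> 0) (\<delta> 0) = 0"
    using adjoint_eq[OF Omega_zero, of "\<delta> 0" 2] L2_ext_deriv_zero_right[of "\<delta> 0" 2] by simp
  ultimately show ?thesis by (rule L2_definite)
qed

section \<open>The truncated functionals and their critical points\<close>

abbreviation functional :: "nat set \<Rightarrow> 'm gform \<Rightarrow> real" where
  "functional S \<gamma> \<equiv> L2_product \<A> g \<mu> (trunc_deriv \<A> nabla S \<gamma>) \<gamma>"

lemma trunc_deriv_Suc: "trunc_deriv \<A> nabla S \<gamma> (Suc i) = (if i \<in> S then 0 else d (\<gamma> i))"
  by (simp add: trunc_deriv_def)

lemma Omega_total_degree: "\<gamma> \<in> Omega_total \<A> \<Longrightarrow> \<gamma> k \<in> Omega \<A> k"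
  unfolding Omega_total_def using Omega_zero by (cases "k \<le> CARD('n)") auto

text \<open>Along the straight line that adds multiples of \<open>\<eta> = d (\<gamma> 1)\<close> to
  the degree-two component, the functional is affine in \<open>t\<close> with slope
  \<open>L2 2 \<eta> \<eta>\<close>, so the first variation is this square norm.\<close>

lemma critical_imp_closed:
  assumes crit: "\<gamma> \<in> critical_points \<A> (functional S) \<Sigma>" and \<Sigma>: "\<Sigma> \<subseteq> Omega_total \<A>"
    and vary: "\<And>\<eta>. \<eta> \<in> Omega \<A> 2 \<Longrightarrow> \<gamma>(2 := \<eta>) \<in> \<Sigma>"
    and S: "1 \<notin> S" and \<gamma>3: "2 \<in> S \<or> \<delta> (\<gamma> 3) = 0" and n: "2 \<le> CARD('n)"
  shows "d (\<gamma> 1) = 0"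
proof -
  have \<gamma>\<Sigma>: "\<gamma> \<in> \<Sigma>" using crit by (simp add: critical_points_def)
  then have \<gamma>: "\<gamma> k \<in> Omega \<A> k" for k using \<Sigma> Omega_total_degree by blast
  define \<eta> where "\<eta> = d (\<gamma> 1)"
  have \<eta>: "\<eta> \<in> Omega \<A> 2" unfolding \<eta>_def by (rule ext_deriv_Omega_1[OF \<gamma>])
  define \<beta> where "\<beta> t = (\<lambda>Xs. \<gamma> 2 Xs + fscale (\<lambda>_. t) (\<eta> Xs))" for t :: real
  have \<beta>: "\<beta> t \<in> Omega \<A> 2" for t
    unfolding \<beta>_def by (intro Omega_add Omega_fscale \<gamma> \<eta> SF_const)
  define c where "c t = \<gamma>(2 := \<beta> t)" for t
  have "\<beta> 0 = \<gamma> 2" by (simp add: \<beta>_def)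
  then have c0: "c 0 = \<gamma>" by (simp add: c_def)
  have curve: "smooth_curve \<A> 1 c"
    unfolding smooth_curve_def
  proof (intro allI ballI impI, elim conjE)
    fix k Xs f ch assume f: "f \<in> SF" and ch: "ch \<in> \<A>" and Xs: "length Xs = k" "set Xs \<subseteq> VF"
    let ?T = "{-1<..<1::real} \<times> snd ch ` fst ch"
    have o: "open ?T" by (intro open_Times open_img[OF ch]) simp
    have sm: "smooth_on ?T (\<lambda>z. (\<alpha> Xs f \<circ> chart_inv ch) (snd z))" if "\<alpha> \<in> Omega \<A> j" for \<alpha> j
      by (rule smooth_on_compose[OF SF_chart[OF VF_smooth[OF
              Omega_vector_field[OF that Xs(2)] f] ch] smooth_on_bounded_linear[OF bounded_linear_snd] o open_img[OF ch]])
         auto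
    have "smooth_on ?T (\<lambda>z. c (fst z) k Xs f (chart_inv ch (snd z)))"
    proof (cases "k = 2")
      case True
      have "smooth_on ?T (\<lambda>z. (\<gamma> 2 Xs f \<circ> chart_inv ch) (snd z) + fst z * (\<eta> Xs f \<circ> chart_inv ch) (snd z))"
        by (intro smooth_on_add smooth_on_mult o sm[OF \<gamma>] sm[OF \<eta>] smooth_on_bounded_linear[OF bounded_linear_fst])
      then show ?thesis
        by (rule smooth_on_cong_imp[OF _ o]) (simp add: True c_def \<beta>_def fscale_def)
    next
      case False
      then show ?thesis using sm[OF \<gamma>[of k]] by (simp add: c_def comp_def)
    qed
    then show "smooth_on ?T (\<lambda>(t, x). c t k Xs f (chart_inv ch x))" by (simp add: split_def)
  qed
  have "((\<lambda>t. functional S (c t)) has_real_derivative 0) (at 0)"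
    using crit curve c0 vary[OF \<beta>] unfolding critical_points_def c_def
    by (elim CollectE conjE allE[of _ "1::real"] impE) auto
  moreover have "functional S (c t) = functional S \<gamma> + t * L2 2 \<eta> \<eta>" for t
  proof -
    have "L2 k (trunc_deriv \<A> nabla S (c t) k) (c t k) =
      L2 k (trunc_deriv \<A> nabla S \<gamma> k) (\<gamma> k) + (if k = 2 then t * L2 2 \<eta> \<eta> else 0)" for k
    proof (cases k)
      case (Suc i)
      consider "i = 1" | "i = 2" | "i \<noteq> 1" "i \<noteq> 2" by blast
      then show ?thesis
      proof cases
        case 1
        have "L2 2 \<eta> (\<beta> t) = L2 2 \<eta> (\<gamma> 2) + t * L2 2 \<eta> \<eta>"
          unfolding \<beta>_def by (rule L2_add_right[OF \<eta> \<gamma> \<eta>])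
        then show ?thesis using Suc 1 S by (simp add: trunc_deriv_def c_def \<eta>_def numeral_2_eq_2)
      next
        case 2
        have "L2 3 (d \<alpha>) (\<gamma> 3) = 0" if "\<alpha> \<in> Omega \<A> 2" "2 \<notin> S" for \<alpha>
          using adjoint_eq[of "\<gamma> 3" 2 \<alpha>] \<gamma>[of 3] that \<gamma>3 L2_zero_right by simp
        moreover have "trunc_deriv \<A> nabla S x 3 = (if 2 \<in> S then 0 else d (x 2))" for x
          using trunc_deriv_Suc[of S x 2] by simp
        moreover have "k = 3" using Suc 2 by simp
        ultimately show ?thesis using \<beta> \<gamma> by (simp add: c_def)
      next
        case 3
        then show ?thesis using Suc by (simp add: trunc_deriv_def c_def)
      qed
    qed (simp add: trunc_deriv_def c_def)
    \<comment> \<open>Dimension at least 2 guarantees that degree two occurs in the sum over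
      degrees.\<close>
    then show ?thesis using n by (simp add: L2_product_def sum.distrib)
  qed
  moreover have "((\<lambda>t. functional S \<gamma> + t * L2 2 \<eta> \<eta>) has_real_derivative L2 2 \<eta> \<eta>) (at 0)"
    by (auto intro!: derivative_eq_intros)
  ultimately have "L2 2 \<eta> \<eta> = 0"
    using DERIV_unique by simp
  then show ?thesis using L2_definite[OF \<eta>] by (simp add: \<eta>_def)
qed

definition concentrated :: "'m vform \<Rightarrow> 'm gform" where
  "concentrated A = (\<lambda>k. if k = 1 then A else 0)"

lemma concentrated_Omega_total: "A \<in> Omega \<A> 1 \<Longrightarrow> concentrated A \<in> Omega_total \<A>"
  by (auto simp: concentrated_def Omega_total_def Omega_zero)

text \<open>The functional vanishes at time 0, and for every positive \<eta> it is bounded by \<eta>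
  times the absolute value of \<open>t\<close> near 0; hence its derivative is 0 along any curve in
  \<Sigma>, whatever the constraint set is.\<close>

lemma closed_imp_critical:
  assumes comp: "compact (UNIV :: 'm set)" and \<Sigma>: "\<Sigma> \<subseteq> Omega_total \<A>" and A: "concentrated A \<in> \<Sigma>"
    and S: "0 \<in> S" and dA: "d A = 0"
  shows "concentrated A \<in> critical_points \<A> (functional S) \<Sigma>"
  unfolding critical_points_def
proof (intro CollectI conjI allI impI A, elim conjE)
  fix \<epsilon> :: real and c assume \<epsilon>: "0 < \<epsilon>" and c: "smooth_curve \<A> \<epsilon> c" "c 0 = concentrated A"
    and c\<Sigma>: "\<forall>t\<in>{-\<epsilon><..<\<epsilon>}. c t \<in> \<Sigma>"
  have \<Omega>: "c t k \<in> Omega \<A> k" if "t \<in> {-\<epsilon><..<\<epsilon>}" for t k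
    using c\<Sigma> that \<Sigma> Omega_total_degree by blast
  have A1: "concentrated A k \<in> Omega \<A> k" for k using A \<Sigma> Omega_total_degree by blast
  let ?t = "\<lambda>t k. L2 k (trunc_deriv \<A> nabla S (c t) k) (c t k)"
  have term_small: "\<forall>\<^sub>F t in nhds 0. \<bar>?t t k\<bar> \<le> \<eta> * \<bar>t\<bar>" if \<eta>: "0 < \<eta>" for k \<eta>
  proof (cases "\<exists>m. k = Suc m \<and> m \<notin> S")
    case True
    then obtain m where m: "k = Suc m" "m \<notin> S" by blast
    \<comment> \<open>Here \<open>0 \<in> S\<close> is essential: the pairing of
      \<open>d (c t 0)\<close> with \<open>c t 1\<close> is the only one whose second factor, being
      \<open>A\<close> at time 0, does not vanish there.\<close>
    then have "m \<noteq> 0" using S by (cases m) auto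
    then have 0: "d (c 0 m) = 0" "c 0 (Suc m) = 0"
      using dA ext_deriv_zero by (auto simp: c concentrated_def)
    have "\<forall>\<^sub>F t in nhds 0. \<bar>L2 (Suc m) (d (c t m)) (c t (Suc m))\<bar> \<le> \<eta> * \<bar>t\<bar>"
      by (rule L2_curve_small[OF comp c(1) \<epsilon> \<Omega> \<Omega> 0 \<eta>])
    then show ?thesis using m by (simp add: trunc_deriv_def)
  next
    case False
    have "\<forall>\<^sub>F t in nhds 0. t \<in> {-\<epsilon><..<\<epsilon>}" by (rule eventually_nhds_in_open) (use \<epsilon> in auto)
    then show ?thesis
    proof eventually_elim
      case (elim t)
      have "trunc_deriv \<A> nabla S (c t) k = 0"
        using False by (cases k) (auto simp: trunc_deriv_def)
      then show ?case using L2_zero_left[OF \<Omega>[OF elim]] \<eta> by simp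
    qed
  qed
  have F0: "functional S (c 0) = 0"
  proof -
    have "?t 0 k = 0" for k
    proof (cases "\<exists>m. k = Suc m \<and> m \<notin> S")
      case True
      then obtain m where m: "k = Suc m" "m \<notin> S" by blast
      then have "c 0 k = 0" using S by (cases m) (auto simp: c concentrated_def)
      then show ?thesis using m L2_ext_deriv_zero_right[OF A1, of m] by (simp add: trunc_deriv_def c)
    next
      case False
      have "trunc_deriv \<A> nabla S (c 0) k = 0"
        using False by (cases k) (auto simp: trunc_deriv_def)
      then show ?thesis using L2_zero_left[OF A1, of k] by (simp add: c)
    qed
    then show ?thesis by (simp add: L2_product_def)
  qed
  have F: "\<forall>\<^sub>F t in nhds 0. \<bar>functional S (c t)\<bar> \<le> \<eta> * \<bar>t\<bar>" if \<eta>: "0 < \<eta>" for \<eta>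
  proof -
    define \<kappa> where "\<kappa> = \<eta> / real (Suc CARD('n))"
    have \<kappa>: "0 < \<kappa>" using \<eta> by (simp add: \<kappa>_def)
    have "\<forall>\<^sub>F t in nhds 0. \<forall>k\<in>{..CARD('n)}. \<bar>?t t k\<bar> \<le> \<kappa> * \<bar>t\<bar>"
      using term_small[OF \<kappa>] by (intro eventually_ball_finite) auto
    then show ?thesis
    proof eventually_elim
      case (elim t)
      have "\<bar>functional S (c t)\<bar> \<le> (\<Sum>k\<le>CARD('n). \<bar>?t t k\<bar>)"
        unfolding L2_product_def by (rule sum_abs)
      also have "\<dots> \<le> (\<Sum>k\<le>CARD('n). \<kappa> * \<bar>t\<bar>)" using elim by (intro sum_mono) auto
      also have "\<dots> = (real (Suc CARD('n)) * \<kappa>) * \<bar>t\<bar>" by simp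
      also have "real (Suc CARD('n)) * \<kappa> = \<eta>" unfolding \<kappa>_def by simp
      finally show ?case .
    qed
  qed
  show "((\<lambda>t. functional S (c t)) has_real_derivative 0) (at 0)"
    unfolding has_field_derivative_iff
  proof (rule tendstoI)
    fix e :: real assume e: "0 < e"
    have "\<forall>\<^sub>F t in nhds 0. \<bar>functional S (c t)\<bar> \<le> e / 2 * \<bar>t\<bar>" using F[of "e / 2"] e by simp
    then have "\<forall>\<^sub>F t in at 0. \<bar>functional S (c t)\<bar> \<le> e / 2 * \<bar>t\<bar>"
      unfolding eventually_at_filter by eventually_elim simp
    moreover have "\<forall>\<^sub>F t in at (0::real). t \<noteq> 0" by (simp add: eventually_at_filter)
    ultimately show "\<forall>\<^sub>F t in at 0. dist ((functional S (c t) - functional S (c 0)) / (t - 0)) 0 < e"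
    proof eventually_elim
      case (elim t)
      then have "\<bar>functional S (c t)\<bar> / \<bar>t\<bar> \<le> e / 2" by (simp add: divide_le_eq)
      also have "e / 2 < e" using e by simp
      finally show ?case using F0 by (simp add: abs_divide)
    qed
  qed
qed

text \<open>A condition \<open>P\<close> on the degree-one component alone covers both the
  integrable and the metric structures. For the projection it is enough to have one critical point
  above each \<open>A\<close>, and the form concentrated in degree one serves for both
  functionals.\<close>

lemma realized_by_critical_points:
  assumes P: "P \<subseteq> AC \<A>" and n: "2 \<le> CARD('n)"
  shows "(\<lambda>\<gamma>. \<gamma> 1) ` critical_points \<A> (functional {0}) (coclosed_3 \<A> \<delta> \<inter> {\<gamma> \<in> Omega_total \<A>. \<gamma> 1 \<in> P}) =
      {A \<in> P. d A = 0}" (is "_ ` ?C1 = ?R")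
    and "(\<lambda>\<gamma>. \<gamma> 1) ` critical_points \<A> (functional {0, 2}) {\<gamma> \<in> Omega_total \<A>. \<gamma> 1 \<in> P} =
      {A \<in> P. d A = 0}" (is "_ ` ?C2 = ?R")
proof -
  \<comment> \<open>Changing the degree-two component touches neither the degree-one component,
    which carries \<open>P\<close>, nor the degree-three component, which carries coclosedness, so
    the variation stays in both constraint sets.\<close>
  have vary: "\<gamma>(2 := \<eta>) \<in> Omega_total \<A>" if "\<gamma> \<in> Omega_total \<A>" "\<eta> \<in> Omega \<A> 2" for \<gamma> \<eta>
    using that n by (auto simp: Omega_total_def)
  have 1: "\<gamma> 1 \<in> ?R" if \<gamma>: "\<gamma> \<in> ?C1" for \<gamma>
  proof -
    have "\<gamma> \<in> coclosed_3 \<A> \<delta>" "\<gamma> \<in> Omega_total \<A>" "\<gamma> 1 \<in> P" using \<gamma> by (auto simp: critical_points_def)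
    then show ?thesis
      using vary n critical_imp_closed[OF \<gamma>] by (simp add: coclosed_3_def subset_iff)
  qed
  have 2: "\<gamma> 1 \<in> ?R" if \<gamma>: "\<gamma> \<in> ?C2" for \<gamma>
  proof -
    have "\<gamma> \<in> Omega_total \<A>" "\<gamma> 1 \<in> P" using \<gamma> by (auto simp: critical_points_def)
    then show ?thesis
      using vary n critical_imp_closed[OF \<gamma>] by (simp add: subset_iff)
  qed
  have 3: "concentrated A \<in> ?C1 \<and> concentrated A \<in> ?C2 \<and> concentrated A 1 = A" if A: "A \<in> ?R" for A
  proof -
    have AC: "A \<in> AC \<A>" "A \<in> P" "d A = 0" using A P by auto
    have \<Omega>: "concentrated A \<in> Omega_total \<A>"
      using AC by (intro concentrated_Omega_total) (simp add: AC_def)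
    have c1: "concentrated A 1 = A" "concentrated A 3 = 0" by (simp_all add: concentrated_def)
    note comp = compact_manifold[OF AC(1)]
    show ?thesis
      using \<Omega> AC c1 adjoint_zero
      by (intro conjI closed_imp_critical[OF comp]) (auto simp: coclosed_3_def)
  qed
  have img: "(\<lambda>\<gamma>. \<gamma> 1) ` C = R" if "\<And>\<gamma>. \<gamma> \<in> C \<Longrightarrow> \<gamma> 1 \<in> R"
    "\<And>A. A \<in> R \<Longrightarrow> concentrated A \<in> C \<and> concentrated A 1 = A" for C R
  proof
    show "(\<lambda>\<gamma>. \<gamma> 1) ` C \<subseteq> R" using that(1) by blast
    show "R \<subseteq> (\<lambda>\<gamma>. \<gamma> 1) ` C"
    proof
      fix A assume "A \<in> R"
      from that(2)[OF this] show "A \<in> (\<lambda>\<gamma>. \<gamma> 1) ` C" by (intro image_eqI[of _ _ "concentrated A"]) auto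
    qed
  qed
  show "(\<lambda>\<gamma>. \<gamma> 1) ` ?C1 = ?R" by (rule img; use 1 3 in blast)
  show "(\<lambda>\<gamma>. \<gamma> 1) ` ?C2 = ?R" by (rule img; use 2 3 in blast)
qed

text \<open>For the Levi-Civita connection \<open>d A\<close>, the Nijenhuis tensor and the exterior
  derivative of the fundamental form are all expressed through the covariant derivative of
  \<open>A\<close>. Integrability, not demanded on the left, follows once that derivative is
  zero.\<close>

lemma kaehler_eq_closed:
  assumes lc: "levi_civita \<A> g nabla"
  shows "{A \<in> AC_metric \<A> g. d A = 0} = kaehler_structures \<A> g"
proof -
  have compat: "X (g Y Z) p = g (nabla X Y) Z p + g Y (nabla X Z) p" if "X \<in> VF" "Y \<in> VF" "Z \<in> VF" for X Y Z p
    using lc that unfolding levi_civita_def by simp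
  note add_l = tensorial_add[OF tensorial_metric_left] and diff_l = tensorial_diff[OF tensorial_metric_left]
    and min_l = tensorial_uminus[OF tensorial_metric_left] and min_r = tensorial_uminus[OF tensorial_metric_right]
  have "A \<in> kaehler_structures \<A> g \<longleftrightarrow> d A = 0" if A: "A \<in> AC_metric \<A> g" for A
  proof -
    have AC: "A \<in> AC \<A>" and a: "A \<in> Omega \<A> 1" using A by (auto simp: AC_metric_def AC_def)
    have sq: "A [A [X]] = - X" if "X \<in> VF" for X using AC that by (simp add: AC_def)
    have JV: "A [X] \<in> VF" if "X \<in> VF" for X using Omega_vector_field[OF a, of "[X]"] that by simp
    have gJ: "g (A [X]) (A [Y]) p = g X Y p" if "X \<in> VF" "Y \<in> VF" for X Y p
      using A that by (simp add: AC_metric_def)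
    have TJ: "tensorial p (\<lambda>X. A [X] f p)" for f p
      using Omega_tensorial_middle[OF a, of "[]" "[]" p f] by simp
    have Jadd: "A [X + Y] = A [X] + A [Y]" if "X \<in> VF" "Y \<in> VF" for X Y
      using tensorial_add[OF TJ that] by (intro ext) simp
    have Jdiff: "A [X - Y] = A [X] - A [Y]" if "X \<in> VF" "Y \<in> VF" for X Y
      using tensorial_diff[OF TJ that] by (intro ext) simp
    have J0: "A [0] = 0" using tensorial_zero[OF TJ] by (intro ext) simp
    \<comment> \<open>The covariant derivative of \<open>A\<close> in direction \<open>X\<close>,
      applied to \<open>Y\<close>.\<close>
    define N where "N X Y = nabla X (A [Y]) - A [nabla X Y]" for X Y
    note V = JV nabla_vector_field VF_diff VF_add VF_uminus
    have NV: "N X Y \<in> VF" if "X \<in> VF" "Y \<in> VF" for X Y unfolding N_def using that by (intro V)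
    have gskew: "g (A [X]) Y p = - g X (A [Y]) p" if "X \<in> VF" "Y \<in> VF" for X Y p
      using gJ[of X "A [Y]" p] min_r[of "A [X]" Y p] that by (simp add: JV sq)
    define T where "T X Y Z p = g (N X Y) Z p" for X Y Z p
    have T_eq: "T X Y Z p = g (nabla X (A [Y])) Z p + g (nabla X Y) (A [Z]) p"
      if "X \<in> VF" "Y \<in> VF" "Z \<in> VF" for X Y Z p
      using that by (simp add: T_def N_def diff_l V gskew)
    \<comment> \<open>Differentiating the skewness of \<open>A\<close> with respect to
      \<open>g\<close> and using that \<open>nabla\<close> preserves \<open>g\<close>.\<close>
    have skew: "T X Y Z p = - T X Z Y p" if v: "X \<in> VF" "Y \<in> VF" "Z \<in> VF" for X Y Z p
    proof -
      have "g (A [Y]) Z = (\<lambda>p. - 1 * g Y (A [Z]) p)" using gskew[OF v(2,3)] by (intro ext) simp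
      then have "X (g (A [Y]) Z) p = - X (g Y (A [Z])) p"
        using VF_apply_mult[OF v(1) SF_const[of "-1"] metric_smooth[OF v(2) JV[OF v(3)]], of p]
          VF_apply_const[OF v(1), of "-1" p] by simp
      then have "g (nabla X (A [Y])) Z p + g (A [Y]) (nabla X Z) p + (g (nabla X Y) (A [Z]) p + g Y (nabla X (A [Z])) p) = 0"
        using compat[OF v(1) JV[OF v(2)] v(3), of p] compat[OF v(1,2) JV[OF v(3)], of p] by simp
      moreover have "g (A [Y]) (nabla X Z) = g (nabla X Z) (A [Y])" "g Y (nabla X (A [Z])) = g (nabla X (A [Z])) Y"
        using v by (auto intro!: metric_sym V)
      ultimately show ?thesis using v by (simp add: T_eq)
    qed
    \<comment> \<open>The covariant derivative of \<open>A\<close> anticommutes with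
      \<open>A\<close>, by differentiating \<open>A [A [Y]] = - Y\<close>.\<close>
    have NJ: "N X (A [Y]) = - A [N X Y]" if v: "X \<in> VF" "Y \<in> VF" for X Y
    proof -
      have m: "nabla X (- Y) = - nabla X Y"
        using nabla_add[of X Y "- Y"] v nabla_zero[OF v(1)] by (simp add: V eq_neg_iff_add_eq_0 add.commute)
      have "A [N X Y] = A [nabla X (A [Y])] + nabla X Y"
        unfolding N_def using v by (simp add: Jdiff V sq)
      then show ?thesis using v by (simp add: N_def sq m)
    qed
    have TJ2: "T X (A [Y]) Z p = T X Y (A [Z]) p" if v: "X \<in> VF" "Y \<in> VF" "Z \<in> VF" for X Y Z p
      using v by (simp add: T_def NJ min_l V NV gskew)
    have TJZ: "T X Y (A [A [Z]]) p = - T X Y Z p" if v: "X \<in> VF" "Y \<in> VF" "Z \<in> VF" for X Y Z p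
      using v by (simp add: T_def sq min_r NV)
    have dA: "d A [X, Y] = N X Y - N Y X" if v: "X \<in> VF" "Y \<in> VF" for X Y
      using v by (simp add: ext_deriv_1 N_def torsion_free Jdiff V)
    \<comment> \<open>Torsion-freeness replaces the brackets by covariant derivatives, and all terms
      not containing a derivative of \<open>A\<close> cancel.\<close>
    have nij: "nijenhuis A X Y = N (A [X]) Y - N (A [Y]) X - A [N X Y] + A [N Y X]"
      if v: "X \<in> VF" "Y \<in> VF" for X Y
      unfolding nijenhuis_def N_def using v
      by (simp add: torsion_free Jdiff Jadd V sq algebra_simps)
    \<comment> \<open>Metric compatibility differentiates \<open>g (A [Y]) Z\<close>,
      torsion-freeness rewrites the brackets; what remains is the cyclic sum of
      \<open>T\<close>.\<close>
    have d\<omega>: "ext_deriv \<A> (\<lambda>X f. X f) (fundamental_form g A) [X, Y, Z] p = T X Y Z p + T Y Z X p + T Z X Y p"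
      if v: "X \<in> VF" "Y \<in> VF" "Z \<in> VF" for X Y Z p
    proof -
      have "ext_deriv \<A> (\<lambda>X f. X f) (fundamental_form g A) [X, Y, Z] p =
          X (g (A [Y]) Z) p - Y (g (A [X]) Z) p + Z (g (A [X]) Y) p
          - g (A [lie_bracket X Y]) Z p + g (A [lie_bracket X Z]) Y p - g (A [lie_bracket Y Z]) X p"
        using v by (simp add: ext_deriv_def lessThan_Suc del_nth_def alt_sign_def fundamental_form_def)
      moreover have lie: "g (A [lie_bracket V W]) U p = g (A [nabla V W]) U p - g (A [nabla W V]) U p"
        if "V \<in> VF" "W \<in> VF" "U \<in> VF" for V W U
        using that by (simp add: torsion_free Jdiff V diff_l)
      have T: "T V W U p = g (nabla V (A [W])) U p - g (A [nabla V W]) U p"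
        if "V \<in> VF" "W \<in> VF" "U \<in> VF" for V W U
        using that by (simp add: T_def N_def V diff_l)
      have swap: "g (A [V]) W p + g (A [W]) V p = 0" if "V \<in> VF" "W \<in> VF" for V W
        using gskew[OF that, of p] metric_sym[OF that(1) JV[OF that(2)]] by simp
      note nV = nabla_vector_field
      ultimately show ?thesis
        using compat[OF v(1) JV[OF v(2)] v(3), of p] compat[OF v(2) JV[OF v(1)] v(3), of p]
          compat[OF v(3) JV[OF v(1)] v(2), of p] skew[OF v(2,3,1), of p]
          lie[OF v(1,2,3)] lie[OF v(1,3,2)] lie[OF v(2,3,1)] T[OF v(1,2,3)] T[OF v(2,1,3)] T[OF v(3,1,2)]
          swap[OF v(2) nV[OF v(1,3)]] swap[OF v(1) nV[OF v(2,3)]] swap[OF v(1) nV[OF v(3,2)]]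
        by linarith
    qed
    have N0: "N X Y = 0" if T0: "\<And>X Y Z p. X \<in> VF \<Longrightarrow> Y \<in> VF \<Longrightarrow> Z \<in> VF \<Longrightarrow> T X Y Z p = 0"
      and v: "X \<in> VF" "Y \<in> VF" for X Y
      using metric_zero_imp[OF NV[OF v]] T0[OF v NV[OF v]] by (intro ext) (simp add: T_def)
    show ?thesis
    proof
      assume "d A = 0"
      then have sym: "T X Y Z p = T Y X Z p" if v: "X \<in> VF" "Y \<in> VF" "Z \<in> VF" for X Y Z p
        using dA[OF v(1,2)] by (simp add: T_def)
      \<comment> \<open>\<open>T\<close> is symmetric in the first two arguments and skew in the
        last two. Alternating these exchanges passes through all six orders and returns to the first
        with the opposite sign.\<close>
      have T0: "T X Y Z p = 0" if v: "X \<in> VF" "Y \<in> VF" "Z \<in> VF" for X Y Z p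
        using sym[OF v(1,2,3), of p] skew[OF v(2,1,3), of p] sym[OF v(2,3,1), of p]
          skew[OF v(3,2,1), of p] sym[OF v(3,1,2), of p] skew[OF v(1,3,2), of p] by linarith
      have "nijenhuis A X Y = 0" if v: "X \<in> VF" "Y \<in> VF" for X Y
        using v by (simp add: nij N0[OF T0] JV J0)
      then have "A \<in> complex_structures \<A>" using AC by (simp add: complex_structures_def)
      moreover have "ext_deriv \<A> (\<lambda>X f. X f) (fundamental_form g A) Xs p = 0" for Xs p
      proof (cases "set Xs \<subseteq> VF")
        case True
        show ?thesis
        proof (cases "length Xs = 3")
          case l: True
          then obtain X Y Z where "Xs = [X, Y, Z]"
            by (auto simp: length_Suc_conv numeral_3_eq_3)
          then show ?thesis using True d\<omega>[of X Y Z p] by (simp add: T0)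
        next
          case l: False
          have "(Xs ! i) (fundamental_form g A (del_nth i Xs)) = 0" if "i < length Xs" for i
          proof -
            have "Xs ! i \<in> VF" using True that by auto
            moreover have "fundamental_form g A (del_nth i Xs) = 0"
              using that l by (auto simp: fundamental_form_def length_del_nth)
            ultimately show ?thesis by (simp only: VF_apply_zero)
          qed
          then have "(\<Sum>i<length Xs. alt_sign i ((Xs ! i) (fundamental_form g A (del_nth i Xs)))) = 0"
            by (intro sum.neutral ballI) (simp only: alt_sign_zero lessThan_iff)
          moreover have "fundamental_form g A (B # del_nth i (del_nth j Xs)) = 0" if "i < j" "j < length Xs" for B i j
            using that l by (auto simp: fundamental_form_def length_del_nth)
          ultimately show ?thesis by (simp add: ext_deriv_def)
        qed
      qed (simp add: ext_deriv_def)
      ultimately show "A \<in> kaehler_structures \<A> g"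
        using A by (auto simp: kaehler_structures_def fun_eq_iff)
    next
      assume K: "A \<in> kaehler_structures \<A> g"
      have cyc: "T X Y Z p + T Y Z X p + T Z X Y p = 0" if v: "X \<in> VF" "Y \<in> VF" "Z \<in> VF" for X Y Z p
        using K d\<omega>[OF v, of p] by (simp add: kaehler_structures_def)
      have nz: "T (A [Y]) Z W p - T (A [Z]) Y W p + T Y Z (A [W]) p - T Z Y (A [W]) p = 0"
        if v: "Y \<in> VF" "Z \<in> VF" "W \<in> VF" for Y Z W p
      proof -
        have "g (nijenhuis A Y Z) W p = 0"
          using K v tensorial_zero[OF tensorial_metric_left[OF v(3)]]
          by (simp add: kaehler_structures_def complex_structures_def)
        then show ?thesis
          using v by (simp add: nij add_l diff_l V NV gskew T_def)
      qed
      \<comment> \<open>With \<open>\<omega>\<close> the fundamental form, the facts combine to the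
        classical identity that \<open>2 * T X Y Z p\<close> is \<open>d\<omega>(X, Y, Z) -
        d\<omega>(X, AY, AZ) + g (nijenhuis A Y Z) (A [X]) p\<close>. The relations
        \<open>TJ2\<close>, \<open>TJZ\<close> and \<open>skew\<close> move \<open>A\<close> between
        the slots to make the other terms match.\<close>
      have T0: "T X Y Z p = 0" if v: "X \<in> VF" "Y \<in> VF" "Z \<in> VF" for X Y Z p
      proof -
        note j = JV[OF v(1)] JV[OF v(2)] JV[OF v(3)]
        show ?thesis
          using cyc[OF v, of p] cyc[OF v(1) j(2,3), of p] TJ2[OF v(1,2) j(3), of p] TJZ[OF v, of p]
            TJ2[OF j(2) v(3,1), of p] TJ2[OF j(3) v(1,2), of p] nz[OF v(2,3) j(1), of p] TJZ[OF v(2,3,1), of p] TJZ[OF v(3,2,1), of p]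
            skew[OF j(3) v(2) j(1), of p] skew[OF v(3,2,1), of p]
          by linarith
      qed
      have "d A [X, Y] = 0" if "X \<in> VF" "Y \<in> VF" for X Y
        using that by (simp add: dA N0[OF T0])
      moreover have "d A Xs = 0" if "\<not> (length Xs = 2 \<and> set Xs \<subseteq> VF)" for Xs
        using Omega_invalid[OF ext_deriv_Omega_1[OF a]] that by blast
      ultimately have "d A Xs = 0" for Xs
        by (cases "length Xs = 2 \<and> set Xs \<subseteq> VF") (auto simp: length_Suc_conv numeral_2_eq_2)
      then show "d A = 0" by (intro ext) simp
    qed
  qed
  moreover have "kaehler_structures \<A> g \<subseteq> AC_metric \<A> g" by (auto simp: kaehler_structures_def)
  ultimately show ?thesis by blast
qed

end

theorem corollary1:
  fixes \<A> :: "('m::{t2_space,second_countable_topology}, 'n::finite) chart set"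
    and g :: "'m vfield \<Rightarrow> 'm vfield \<Rightarrow> 'm \<Rightarrow> real"
    and nabla :: "'m vfield \<Rightarrow> 'm vfield \<Rightarrow> 'm vfield"
    and \<delta> :: "'m vform \<Rightarrow> 'm vform"
    and \<mu> :: "'m measure"
  assumes "smooth_atlas \<A>"
    and "even CARD('n)" and "2 \<le> CARD('n)"
    and "AC \<A> \<noteq> {}"
    and "riemannian_metric \<A> g"
    and "symmetric_connection \<A> nabla"
    and "riemannian_volume \<A> g \<mu>"
    and "integrals_defined \<A> g \<mu>"
    and "formal_adjoint \<A> g \<mu> nabla \<delta>"
  shows "(\<lambda>\<gamma>. \<gamma> 1) ` critical_points \<A> (C_1 \<A> g \<mu> nabla) (coclosed_3 \<A> \<delta> \<inter> complex_total \<A>) =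
           {A \<in> complex_structures \<A>. ext_deriv \<A> nabla A = 0} \<and>
         (\<lambda>\<gamma>. \<gamma> 1) ` critical_points \<A> (C_1_3 \<A> g \<mu> nabla) (complex_total \<A>) =
           {A \<in> complex_structures \<A>. ext_deriv \<A> nabla A = 0} \<and>
         (levi_civita \<A> g nabla \<longrightarrow>
           (\<lambda>\<gamma>. \<gamma> 1) ` critical_points \<A> (C_1 \<A> g \<mu> nabla) (coclosed_3 \<A> \<delta> \<inter> AC_metric_total \<A> g) =
             kaehler_structures \<A> g \<and>
           (\<lambda>\<gamma>. \<gamma> 1) ` critical_points \<A> (C_1_3 \<A> g \<mu> nabla) (AC_metric_total \<A> g) =
             kaehler_structures \<A> g)"
proof -
  interpret variational_manifold \<A> g nabla \<mu> \<delta>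
    using assms by unfold_locales
  have C: "C_1 \<A> g \<mu> nabla = functional {0}" "C_1_3 \<A> g \<mu> nabla = functional {0, 2}"
    by (simp_all add: C_1_def C_1_3_def fun_eq_iff)
  have P: "complex_structures \<A> \<subseteq> AC \<A>" "AC_metric \<A> g \<subseteq> AC \<A>"
    by (auto simp: complex_structures_def AC_metric_def)
  show ?thesis
    unfolding C complex_total_def AC_metric_total_def
      realized_by_critical_points[OF P(1) assms(3)] realized_by_critical_points[OF P(2) assms(3)]
    using kaehler_eq_closed by simp
qed

end
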